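(* Let $(R,\mathfrak m,k)$ be a Noetherian local ring, let $M$ be a nonzero finitely generated $R$-module of dimension $D\geq1$, and let $J_1,\ldots,J_s$ be $\mathfrak m$-primary ideals. Then, for every $\mathbf n=(n_1,\ldots,n_s)\in\mathbb N^s$, $$e\bigl(J_1^{n_1}\cdots J_s^{n_s};M\bigr)=\sum_{\substack{\mathbf d\in\mathbb N^s\\ |\mathbf d|=D}}\frac{D!}{d_1!\cdots d_s!}\,e\bigl(J_1^{[d_1]},\ldots,J_s^{[d_s]};M\bigr)\,n_1^{d_1}\cdots n_s^{d_s}.$$
   Context: $\mathbb N=\{0,1,2,\ldots\}$, $|\mathbf d|=d_1+\cdots+d_s$, and $\lambda_R$ denotes length. For an ideal $I$ with $\lambda_R(M/IM)<\infty$, $e(I;M)=\lim_{n\to\infty}D!\,\lambda_R(M/I^nM)/n^D$ is the Hilbert--Samuel multiplicity (so it is $0$ when $I=R$, the case $\mathbf n=\mathbf 0$). A product of $\mathfrak m$-primary ideals with exponent $n_\ell=0$ omits that factor. Classical mixed multiplicities: for $\mathbf u=(u_1,\ldots,u_s)$ with all coordinates sufficiently large, $\lambda_R(M/J_1^{u_1}\cdots J_s^{u_s}M)$ agrees with a polynomial of total degree $D$ whose homogeneous component of degree $D$ is $\sum_{|\mathbf d|=D}\frac{e(J_1^{[d_1]},\ldots,J_s^{[d_s]};M)}{d_1!\cdots d_s!}u_1^{d_1}\cdots u_s^{d_s}$; this defines the integers $e(J_1^{[d_1]},\ldots,J_s^{[d_s]};M)$. $J_\ell^{[d_\ell]}$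 is repetition notation, not a power. *)

theory Defs
  imports Complex_Main "HOL-Library.Extended_Nat" "HOL-Library.FuncSet" "HOL-Algebra.Module"
    "HOL-Algebra.QuotRing" "HOL-Algebra.Ideal_Product" "HOL-Algebra.Ring_Divisibility"
begin

section \<open>Local rings and primary ideals\<close>

definition local_ring :: "('a, 'r) ring_scheme \<Rightarrow> 'a set \<Rightarrow> bool" where
  "local_ring R \<mm> \<longleftrightarrow>
     cring R \<and> maximalideal \<mm> R \<and> (\<forall>I. maximalideal I R \<longrightarrow> I = \<mm>)"

definition radical :: "('a, 'r) ring_scheme \<Rightarrow> 'a set \<Rightarrow> 'a set" where
  "radical R I = {x \<in> carrier R. \<exists>n::nat. x [^]\<^bsub>R\<^esub> n \<in> I}"

definition primary_ideal :: "('a, 'r) ring_scheme \<Rightarrow> 'a set \<Rightarrow> bool" where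
  "primary_ideal R Q \<longleftrightarrow> ideal Q R \<and> Q \<noteq> carrier R \<and>
     (\<forall>x\<in>carrier R. \<forall>y\<in>carrier R. x \<otimes>\<^bsub>R\<^esub> y \<in> Q \<longrightarrow> x \<in> Q \<or> y \<in> radical R Q)"

definition primary_to :: "('a, 'r) ring_scheme \<Rightarrow> 'a set \<Rightarrow> 'a set \<Rightarrow> bool" where
  "primary_to R P Q \<longleftrightarrow> primary_ideal R Q \<and> radical R Q = P"

section \<open>Modules: generation, quotients, length, dimension\<close>

definition submodule_span ::
    "('a, 'r) ring_scheme \<Rightarrow> ('a, 'b, 'm) module_scheme \<Rightarrow> 'b set \<Rightarrow> 'b set" where
  "submodule_span R M S = \<Inter>{N. submodule N R M \<and> S \<subseteq> N}"

definition fin_gen_module ::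
    "('a, 'r) ring_scheme \<Rightarrow> ('a, 'b, 'm) module_scheme \<Rightarrow> bool" where
  "fin_gen_module R M \<longleftrightarrow> (\<exists>S\<subseteq>carrier M. finite S \<and> submodule_span R M S = carrier M)"

text \<open>The submodule \<open>IM\<close>.\<close>

definition ideal_smult ::
    "('a, 'r) ring_scheme \<Rightarrow> 'a set \<Rightarrow> ('a, 'b, 'm) module_scheme \<Rightarrow> 'b set" where
  "ideal_smult R I M = submodule_span R M {r \<odot>\<^bsub>M\<^esub> x | r x. r \<in> I \<and> x \<in> carrier M}"

text \<open>The quotient \<open>M/N\<close> by a submodule \<open>N\<close>. The fields \<open>mult\<close> and \<open>one\<close> of a
  \<open>module\<close> record play no role in the theory of modules.\<close>

definition quot_module ::
    "('a, 'b, 'm) module_scheme \<Rightarrow> 'b set \<Rightarrow> ('a, 'b set) module" where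
  "quot_module M N =
     \<lparr>carrier = a_rcosets\<^bsub>M\<^esub> N, monoid.mult = (\<lambda>_ _. undefined), one = undefined,
      zero = N, add = set_add M,
      smult = (\<lambda>r C. \<Union>x\<in>C. N +>\<^bsub>M\<^esub> (r \<odot>\<^bsub>M\<^esub> x))\<rparr>"

definition module_length ::
    "('a, 'r) ring_scheme \<Rightarrow> ('a, 'b, 'm) module_scheme \<Rightarrow> enat" where
  "module_length R M = Sup {enat n | n. \<exists>N :: nat \<Rightarrow> 'b set.
     (\<forall>i\<le>n. submodule (N i) R M) \<and> (\<forall>i<n. N i \<subset> N (Suc i))}"

definition krull_dim :: "('a, 'r) ring_scheme \<Rightarrow> enat" where
  "krull_dim R = Sup {enat n | n. \<exists>P :: nat \<Rightarrow> 'a set.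
     (\<forall>i\<le>n. primeideal (P i) R) \<and> (\<forall>i<n. P i \<subset> P (Suc i))}"

definition annihilator ::
    "('a, 'r) ring_scheme \<Rightarrow> ('a, 'b, 'm) module_scheme \<Rightarrow> 'a set" where
  "annihilator R M = {r \<in> carrier R. \<forall>x\<in>carrier M. r \<odot>\<^bsub>M\<^esub> x = \<zero>\<^bsub>M\<^esub>}"

definition module_dim ::
    "('a, 'r) ring_scheme \<Rightarrow> ('a, 'b, 'm) module_scheme \<Rightarrow> enat" where
  "module_dim R M = krull_dim (R Quot annihilator R M)"

section \<open>Multiplicities\<close>

text \<open>The length of \<open>M/IM\<close> as a real number; meaningful only when that length is finite.\<close>

definition colength ::
    "('a, 'r) ring_scheme \<Rightarrow> ('a, 'b, 'm) module_scheme \<Rightarrow> 'a set \<Rightarrow> real" where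
  "colength R M I = real (the_enat (module_length R (quot_module M (ideal_smult R I M))))"

definition hilbert_samuel_mult ::
    "('a, 'r) ring_scheme \<Rightarrow> ('a, 'b, 'm) module_scheme \<Rightarrow> 'a set \<Rightarrow> real" where
  "hilbert_samuel_mult R M I =
     (let D = the_enat (module_dim R M)
      in lim (\<lambda>n. fact D * colength R M (I [^]\<^bsub>ideals_set R\<^esub> n) / real n ^ D))"

text \<open>The ideal \<open>J\<^sub>1\<^bsup>u\<^sub>1\<^esup> \<cdots> J\<^sub>s\<^bsup>u\<^sub>s\<^esup>\<close>. The unit of the monoid of ideals is the unit
  ideal, so factors with exponent \<open>0\<close> disappear.\<close>

definition ideal_power_prod ::
    "('a, 'r) ring_scheme \<Rightarrow> nat \<Rightarrow> (nat \<Rightarrow> 'a set) \<Rightarrow> (nat \<Rightarrow> nat) \<Rightarrow> 'a set" where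
  "ideal_power_prod R s J u =
     (\<Otimes>\<^bsub>ideals_set R\<^esub> i\<in>{1..s}. J i [^]\<^bsub>ideals_set R\<^esub> u i)"

text \<open>The \<open>d \<in> \<nat>\<^sup>s\<close> with \<open>|d| = k\<close>, as functions on \<open>{1..s}\<close>.\<close>

definition multi_indices :: "nat \<Rightarrow> nat \<Rightarrow> (nat \<Rightarrow> nat) set" where
  "multi_indices s k = {d \<in> {1..s} \<rightarrow>\<^sub>E UNIV. (\<Sum>i=1..s. d i) = k}"

text \<open>\<open>e\<close> is a system of mixed multiplicities: the lengths of \<open>M / J\<^sub>1\<^bsup>u\<^sub>1\<^esup> \<cdots> J\<^sub>s\<^bsup>u\<^sub>s\<^esup> M\<close>
  are, for all large \<open>u\<close>, the values of a polynomial whose part of degree \<open>D = dim M\<close> is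
  given by \<open>e\<close> and whose remaining part (coefficients \<open>c\<close>) has degree less than \<open>D\<close>. That
  its degree is exactly \<open>D\<close> and that the values of \<open>e\<close> are integers are not imposed: a
  polynomial is determined by its values at large \<open>u\<close>, so \<open>e\<close> is unique anyway.\<close>

definition mixed_multiplicity_system ::
    "('a, 'r) ring_scheme \<Rightarrow> ('a, 'b, 'm) module_scheme \<Rightarrow> nat \<Rightarrow> (nat \<Rightarrow> 'a set)
      \<Rightarrow> ((nat \<Rightarrow> nat) \<Rightarrow> real) \<Rightarrow> bool" where
  "mixed_multiplicity_system R M s J e \<longleftrightarrow>
     (let D = the_enat (module_dim R M)
      in \<exists>(c :: (nat \<Rightarrow> nat) \<Rightarrow> real) (u0 :: nat). \<forall>u :: nat \<Rightarrow> nat. (\<forall>i\<in>{1..s}. u0 \<le> u i) \<longrightarrow>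
           colength R M (ideal_power_prod R s J u) =
             (\<Sum>d\<in>multi_indices s D. e d / (\<Prod>i=1..s. fact (d i)) * (\<Prod>i=1..s. real (u i) ^ d i))
             + (\<Sum>k<D. \<Sum>d\<in>multi_indices s k. c d * (\<Prod>i=1..s. real (u i) ^ d i)))"

text \<open>\<open>e(J\<^sub>1\<^bsup>[d\<^sub>1]\<^esup>, \<dots>, J\<^sub>s\<^bsup>[d\<^sub>s]\<^esup>; M)\<close> for \<open>d \<in> multi_indices s (dim M)\<close>; other \<open>d\<close> are
  not constrained by \<^const>\<open>mixed_multiplicity_system\<close>.\<close>

definition mixed_multiplicity ::
    "('a, 'r) ring_scheme \<Rightarrow> ('a, 'b, 'm) module_scheme \<Rightarrow> nat \<Rightarrow> (nat \<Rightarrow> 'a set)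
      \<Rightarrow> (nat \<Rightarrow> nat) \<Rightarrow> real" where
  "mixed_multiplicity R M s J d = (THE x. \<exists>e. mixed_multiplicity_system R M s J e \<and> e d = x)"

end

theory Submission
  imports Defs "HOL-Computational_Algebra.Polynomial"
begin

text \<open>
  Write \<open>J\<^bsup>u\<^esup>\<close> for the product of the \<open>J\<^sub>i\<close> with exponents \<open>u\<^sub>i\<close> and \<open>G(u)\<close> for the length
  of \<open>M/J\<^bsup>u\<^esup>M\<close>. Since \<open>(J\<^bsup>n\<^esup>)\<^bsup>k\<^esup> = J\<^bsup>kn\<^esup>\<close>, the multiplicity of \<open>J\<^bsup>n\<^esup>\<close> is \<open>D!\<close> times the
  limit of \<open>G(kn)/k\<^bsup>D\<^esup>\<close>. If \<open>G\<close> agrees for large \<open>u\<close> with a polynomial of degree at most \<open>D\<close> whose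
  part of degree \<open>D\<close> is \<open>h\<close>, then \<open>G(kn + v)/k\<^bsup>D\<^esup>\<close> tends to \<open>h(n)\<close> for every large constant vector
  \<open>v\<close>, and \<open>D! h(n)\<close> is the right-hand side. The limits \<open>h(n)\<close> also determine the coefficients of
  \<open>h\<close>, so the mixed multiplicities are well defined. When some \<open>n\<^sub>i\<close> vanish, the ray \<open>kn\<close> never
  enters the region where the polynomial is valid. But if \<open>n \<noteq> 0\<close>, then \<open>J\<^bsup>Nn\<^esup> \<subseteq> J\<^bsup>v\<^esup>\<close> for some
  \<open>N\<close>, hence \<open>J\<^bsup>(k+N)n\<^esup> \<subseteq> J\<^bsup>kn+v\<^esup> \<subseteq> J\<^bsup>kn\<^esup>\<close>, and \<open>G\<close> is squeezed to the same limit
  (\<open>colength_power_limit\<close>).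

  It remains to see that \<open>G\<close> is eventually a polynomial, and that its degree is at most \<open>D\<close>.

  For the first point it suffices that every difference \<open>G(u + e\<^sub>j) - G(u)\<close>, which is the length of
  \<open>J\<^bsup>u\<^esup>M/J\<^bsup>u+e\<^sub>j\<^esup>M\<close>, is eventually polynomial (\<open>eventually_poly_of_differences\<close>). This is the Hilbert
  function of a multigraded module over the multi-Rees algebra. Instead of graded modules the proof
  uses families \<open>u \<mapsto> A\<^sub>u\<close> of submodules of \<open>M\<close> with \<open>J\<^sub>i A\<^sub>u \<subseteq> A\<^bsub>u+e\<^sub>i\<^esub>\<close>, and subquotients \<open>A/B\<close> of
  such families. Multiplication by a generator of \<open>J\<^sub>j\<close> has a kernel and a cokernel of the same
  kind, which that generator annihilates; so \<open>hilbert_polynomial\<close> follows by induction on the number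
  of generators that do not annihilate \<open>A/B\<close>. The induction ends when all generators of some \<open>J\<^sub>j\<close>
  annihilate \<open>A/B\<close>. Then \<open>artin_rees\<close>, which says \<open>A\<^bsub>u+e\<^sub>j\<^esub> = J\<^sub>j A\<^sub>u\<close> for large \<open>u\<^sub>j\<close>, makes \<open>A/B\<close>
  vanish in these degrees. It is proved as the Hilbert basis theorem is, with leading coefficients
  taken in \<open>M\<close> itself.

  For the second point, \<open>module_growth\<close> bounds the length of \<open>M/\<mm>\<^bsup>n\<^esup>M\<close> by \<open>C (n+1)\<^bsup>D\<^esup>\<close>. No system of
  parameters is constructed: \<open>cyclic_growth\<close> is a Noetherian induction on an ideal annihilating a
  cyclic module, in which the exponent can drop by one when the ideal is a prime different from
  \<open>\<mm>\<close>. As \<open>\<mm>\<^bsup>c\<bar>u\<bar>\<^esup> \<subseteq> J\<^bsup>u\<^esup>\<close> for a constant \<open>c\<close>, the homogeneous parts of degree above \<open>D\<close> vanish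
  (\<open>JM_colength_polynomial\<close>).
\<close>

section \<open>Polynomial functions of several natural variables\<close>

abbreviation monval :: "nat \<Rightarrow> (nat \<Rightarrow> nat) \<Rightarrow> (nat \<Rightarrow> nat) \<Rightarrow> real" where
  "monval s d u \<equiv> (\<Prod>i=1..s. real (u i) ^ d i)"

text \<open>The inductive form matches its use: substitution of a constant, shift and antidifference
  in one variable are all linear and act on one monomial at a time.\<close>

inductive polyfun :: "nat \<Rightarrow> ((nat \<Rightarrow> nat) \<Rightarrow> real) \<Rightarrow> bool" for s where
  zero: "polyfun s (\<lambda>u. 0)"
| add_monomial: "polyfun s f \<Longrightarrow> d \<in> {1..s} \<rightarrow>\<^sub>E UNIV \<Longrightarrow> polyfun s (\<lambda>u. f u + c * monval s d u)"

lemma polyfun_monomial: "d \<in> {1..s} \<rightarrow>\<^sub>E UNIV \<Longrightarrow> polyfun s (\<lambda>u. c * monval s d u)"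
  using polyfun.add_monomial[OF polyfun.zero] by fastforce

lemma polyfun_const: "polyfun s (\<lambda>u. c)"
  using polyfun_monomial[of "restrict (\<lambda>_. 0) {1..s}" s c] by simp

lemma polyfun_add:
  assumes "polyfun s f" and "polyfun s g"
  shows "polyfun s (\<lambda>u. f u + g u)"
  using assms(2)
proof induction
  case zero
  then show ?case using assms(1) by simp
next
  case (add_monomial g d c)
  from polyfun.add_monomial[OF add_monomial.IH add_monomial.hyps(2), of c] show ?case
    by (simp add: add.assoc)
qed

lemma polyfun_sum:
  assumes "finite A" and "\<And>x. x \<in> A \<Longrightarrow> polyfun s (f x)"
  shows "polyfun s (\<lambda>u. \<Sum>x\<in>A. f x u)"
  using assms by (induction A rule: finite_induct) (auto intro: polyfun.zero polyfun_add)

lemma polyfun_uminus: "polyfun s f \<Longrightarrow> polyfun s (\<lambda>u. - f u)"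
proof (induction rule: polyfun.induct)
  case zero
  then show ?case by (simp add: polyfun.zero)
next
  case (add_monomial f d c)
  from polyfun.add_monomial[OF add_monomial.IH add_monomial.hyps(2), of "- c"] show ?case
    by simp
qed

lemma polyfun_diff: "polyfun s f \<Longrightarrow> polyfun s g \<Longrightarrow> polyfun s (\<lambda>u. f u - g u)"
  using polyfun_add[of s f "\<lambda>u. - g u"] polyfun_uminus[of s g] by simp

lemma monval_split:
  "i \<in> {1..s} \<Longrightarrow> monval s d u = real (u i) ^ d i * (\<Prod>j\<in>{1..s}-{i}. real (u j) ^ d j)"
  by (subst prod.remove[of _ i]) auto

lemma fun_upd_PiE: "d \<in> I \<rightarrow>\<^sub>E UNIV \<Longrightarrow> i \<in> I \<Longrightarrow> d(i := k) \<in> I \<rightarrow>\<^sub>E UNIV"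
  by (auto simp: PiE_iff extensional_def)

lemma polyfun_subst_const:
  assumes "polyfun s f" and i: "i \<in> {1..s}"
  shows "polyfun s (\<lambda>u. f (u(i := c)))"
  using assms(1)
proof induction
  case zero
  then show ?case by (simp add: polyfun.zero)
next
  case (add_monomial f d a)
  have "a * monval s d (u(i := c)) = a * real c ^ d i * monval s (d(i := 0)) u" for u
    by (simp only: monval_split[OF i]) (simp add: algebra_simps)
  moreover have "polyfun s (\<lambda>u. f (u(i := c)) + a * real c ^ d i * monval s (d(i := 0)) u)"
    by (rule polyfun.add_monomial[OF add_monomial.IH fun_upd_PiE[OF add_monomial.hyps(2) i]])
  ultimately show ?case by (simp only:)
qed

text \<open>Expand \<open>(t + 1)\<^bsup>k+1\<^esup> - t\<^bsup>k+1\<^esup>\<close> by the binomial theorem: its leading term is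
  \<open>(k + 1) t\<^bsup>k\<^esup>\<close>, and the lower terms have antidifferences by induction.\<close>

lemma power_antidifference: "\<exists>S :: real poly. \<forall>t. poly S (t + 1) - poly S t = t ^ k"
proof (induction k rule: less_induct)
  case (less k)
  define S :: "nat \<Rightarrow> real poly" where
    "S j = (SOME S. \<forall>t. poly S (t + 1) - poly S t = t ^ j)" for j
  have S: "poly (S j) (t + 1) - poly (S j) t = t ^ j" if "j < k" for j t
    unfolding S_def using someI_ex[OF less.IH[OF that]] by blast
  define T where "T = smult (1 / real (Suc k)) (monom 1 (Suc k) -
    (\<Sum>j<k. smult (real (Suc k choose j)) (S j)))"
  have "poly T (t + 1) - poly T t = t ^ k" for t
  proof -
    have "(t + 1) ^ Suc k = (\<Sum>j\<le>Suc k. real (Suc k choose j) * t ^ j)"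
      using binomial_ring[of t 1 "Suc k"] by (simp only: power_one mult_1_right)
    also have "{..Suc k} = insert (Suc k) (insert k {..<k})" by auto
    finally have 1: "(t + 1) ^ Suc k - t ^ Suc k =
        (\<Sum>j<k. real (Suc k choose j) * t ^ j) + real (Suc k) * t ^ k"
      by (simp del: binomial_Suc_Suc power_Suc of_nat_Suc)
    have 2: "(\<Sum>j<k. real (Suc k choose j) * poly (S j) (t + 1)) -
        (\<Sum>j<k. real (Suc k choose j) * poly (S j) t) = (\<Sum>j<k. real (Suc k choose j) * t ^ j)"
      by (simp add: sum_subtractf[symmetric] right_diff_distrib[symmetric] S)
    have "poly T (t + 1) - poly T t = ((t + 1) ^ Suc k - t ^ Suc k -
        ((\<Sum>j<k. real (Suc k choose j) * poly (S j) (t + 1)) -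
        (\<Sum>j<k. real (Suc k choose j) * poly (S j) t))) / real (Suc k)"
      by (simp add: T_def poly_monom poly_sum diff_divide_distrib del: of_nat_Suc power_Suc binomial_Suc_Suc)
    also have "\<dots> = t ^ k"
      unfolding 1 2 by (simp del: of_nat_Suc)
    finally show ?thesis .
  qed
  then show ?case by blast
qed

text \<open>In a monomial only the factor \<open>u\<^sub>i\<^bsup>d\<^sub>i\<^esup>\<close> has to be replaced, by a polynomial
  antidifference of this power.\<close>

lemma polyfun_antidifference:
  assumes "polyfun s f" and i: "i \<in> {1..s}"
  shows "\<exists>F. polyfun s F \<and> (\<forall>u. F (u(i := Suc (u i))) - F u = f u)"
  using assms(1)
proof induction
  case zero
  then show ?case by (intro exI[of _ "\<lambda>u. 0"]) (simp add: polyfun.zero)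
next
  case (add_monomial f d c)
  then obtain F where F: "polyfun s F" "\<And>u. F (u(i := Suc (u i))) - F u = f u" by blast
  obtain S :: "real poly" where S: "\<And>t. poly S (t + 1) - poly S t = t ^ d i"
    using power_antidifference by blast
  define G where "G u = (\<Sum>k\<le>degree S. c * coeff S k * monval s (d(i := k)) u)" for u
  have G_eq: "G u = c * poly S (real (u i)) * (\<Prod>j\<in>{1..s}-{i}. real (u j) ^ d j)" for u
    unfolding G_def poly_altdef sum_distrib_left sum_distrib_right monval_split[OF i]
    by (intro sum.cong) simp_all
  have "polyfun s G"
    unfolding G_def by (intro polyfun_sum polyfun_monomial fun_upd_PiE[OF add_monomial.hyps(2) i]) auto
  moreover have "G (u(i := Suc (u i))) - G u = c * monval s d u" for u
  proof -
    have "G (u(i := Suc (u i))) - G u =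
        c * (poly S (real (u i) + 1) - poly S (real (u i))) * (\<Prod>j\<in>{1..s}-{i}. real (u j) ^ d j)"
      unfolding G_eq by (simp add: algebra_simps)
    then show ?thesis unfolding S monval_split[OF i] by simp
  qed
  ultimately have "polyfun s (\<lambda>u. F u + G u) \<and>
      (\<forall>u. (F (u(i := Suc (u i))) + G (u(i := Suc (u i)))) - (F u + G u) = f u + c * monval s d u)"
    using F by (auto intro: polyfun_add simp add: add_diff_add simp del: fun_upd_apply)
  then show ?case by (intro exI[of _ "\<lambda>u. F u + G u"]) (simp only: simp_thms)
qed

lemma finite_multi_indices: "finite (multi_indices s k)"
proof (rule finite_subset)
  show "multi_indices s k \<subseteq> {1..s} \<rightarrow>\<^sub>E {..k}"
  proof
    fix d assume d: "d \<in> multi_indices s k"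
    then have "d i \<le> k" if "i \<in> {1..s}" for i
      using member_le_sum[OF that, of d] by (auto simp: multi_indices_def)
    with d show "d \<in> {1..s} \<rightarrow>\<^sub>E {..k}" by (auto simp: multi_indices_def PiE_iff)
  qed
qed (auto intro: finite_PiE)

definition hom_part :: "nat \<Rightarrow> ((nat \<Rightarrow> nat) \<Rightarrow> real) \<Rightarrow> nat \<Rightarrow> (nat \<Rightarrow> nat) \<Rightarrow> real" where
  "hom_part s c k u = (\<Sum>d\<in>multi_indices s k. c d * monval s d u)"

text \<open>The number of homogeneous parts may be chosen as large as desired; this allows
  comparison with a prescribed degree that may exceed the degree of \<open>f\<close>.\<close>

lemma polyfun_normal_form:
  assumes "polyfun s f"
  shows "\<exists>K c. \<forall>L\<ge>K. \<forall>u. f u = (\<Sum>k<L. hom_part s c k u)"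
proof -
  have "\<exists>K c. (\<forall>k\<ge>K. \<forall>d\<in>multi_indices s k. c d = 0) \<and> (\<forall>u. f u = (\<Sum>k<K. hom_part s c k u))"
    using assms
  proof induction
    case zero
    then show ?case by (intro exI[of _ 0] exI[of _ "\<lambda>_. 0"]) simp
  next
    case (add_monomial f e a)
    then obtain K c where c0: "\<And>k d. k \<ge> K \<Longrightarrow> d \<in> multi_indices s k \<Longrightarrow> c d = 0"
      and f: "\<And>u. f u = (\<Sum>k<K. hom_part s c k u)" by metis
    define l where "l = (\<Sum>i=1..s. e i)"
    define K' where "K' = max K (Suc l)"
    \<comment> \<open>The monomial may already occur in \<open>f\<close>, so its coefficient is added to the old one.\<close>
    define c' where "c' = c(e := c e + a)"
    have e: "e \<in> multi_indices s k \<longleftrightarrow> k = l" for k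
      using add_monomial.hyps(2) by (auto simp: multi_indices_def l_def)
    have "hom_part s c' k u = hom_part s c k u + (if k = l then a * monval s e u else 0)" for k u
    proof (cases "k = l")
      case True
      then have "e \<in> multi_indices s k" using e by simp
      then show ?thesis
        unfolding hom_part_def c'_def True
        by (subst (1 2) sum.remove[of _ e]) (auto simp: finite_multi_indices algebra_simps intro!: sum.cong)
    next
      case False
      then have "e \<notin> multi_indices s k" using e by simp
      then show ?thesis using False
        unfolding hom_part_def c'_def by (auto intro!: sum.cong)
    qed
    then have "(\<Sum>k<K'. hom_part s c' k u) = (\<Sum>k<K'. hom_part s c k u) + a * monval s e u" for u
      by (simp add: sum.distrib K'_def)
    moreover have "(\<Sum>k<K'. hom_part s c k u) = (\<Sum>k<K. hom_part s c k u)" for u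
      by (rule sum.mono_neutral_right) (auto simp: K'_def hom_part_def c0)
    moreover have "c' d = 0" if "k \<ge> K'" "d \<in> multi_indices s k" for k d
    proof -
      have "d \<noteq> e" using e[of k] that by (auto simp: K'_def)
      then show ?thesis using c0[of k d] that by (auto simp: c'_def K'_def)
    qed
    ultimately show ?case
      using f by (intro exI[of _ K'] exI[of _ c']) auto
  qed
  then obtain K c where c0: "\<forall>k\<ge>K. \<forall>d\<in>multi_indices s k. c d = 0"
    and f: "\<And>u. f u = (\<Sum>k<K. hom_part s c k u)" by blast
  have "(\<Sum>k<K. hom_part s c k u) = (\<Sum>k<L. hom_part s c k u)" if "L \<ge> K" for L u
    using that c0 by (intro sum.mono_neutral_left) (auto simp: hom_part_def)
  then show ?thesis using f by metis
qed

text \<open>Exponent vectors are functions on all natural numbers. A vector vanishing off \<open>{1..s}\<close> is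
  determined by its \<open>s\<close> coordinates, so that equality of functions is equality of vectors.\<close>

definition vecs :: "nat \<Rightarrow> (nat \<Rightarrow> nat) set" where
  "vecs s = {u. \<forall>j. j \<notin> {1..s} \<longrightarrow> u j = 0}"

lemma vecs_upd: "u \<in> vecs s \<Longrightarrow> j \<in> {1..s} \<Longrightarrow> u(j := k) \<in> vecs s"
  by (auto simp: vecs_def)

definition eventually_poly :: "nat \<Rightarrow> ((nat \<Rightarrow> nat) \<Rightarrow> real) \<Rightarrow> bool" where
  "eventually_poly s f \<longleftrightarrow> (\<exists>p u0. polyfun s p \<and> (\<forall>u\<in>vecs s. (\<forall>j\<in>{1..s}. u0 \<le> u j) \<longrightarrow> f u = p u))"

lemma eventually_poly_diff:
  assumes "eventually_poly s f" "eventually_poly s g"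
  shows "eventually_poly s (\<lambda>u. f u - g u)"
proof -
  obtain p u0 where p: "polyfun s p" "\<forall>u\<in>vecs s. (\<forall>j\<in>{1..s}. u0 \<le> u j) \<longrightarrow> f u = p u"
    using assms(1) unfolding eventually_poly_def by blast
  obtain q u1 where q: "polyfun s q" "\<forall>u\<in>vecs s. (\<forall>j\<in>{1..s}. u1 \<le> u j) \<longrightarrow> g u = q u"
    using assms(2) unfolding eventually_poly_def by blast
  show ?thesis unfolding eventually_poly_def
    using p q by (intro exI[of _ "\<lambda>u. p u - q u"] exI[of _ "max u0 u1"]) (auto intro: polyfun_diff)
qed

lemma eventually_poly_shift_const:
  assumes "\<forall>u\<in>vecs s. (\<forall>j\<in>{1..s}. u0 \<le> u j) \<longrightarrow> f u = g u" and "eventually_poly s g"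
  shows "eventually_poly s f"
proof -
  obtain q u1 where q: "polyfun s q" "\<forall>u\<in>vecs s. (\<forall>j\<in>{1..s}. u1 \<le> u j) \<longrightarrow> g u = q u"
    using assms(2) unfolding eventually_poly_def by blast
  show ?thesis unfolding eventually_poly_def
    using assms(1) q by (intro exI[of _ q] exI[of _ "max u0 u1"]) auto
qed

text \<open>Starting from the corner where all coordinates equal \<open>u0\<close>, one coordinate
  after the other is released. Along coordinate \<open>i\<close> the function is a telescoping sum of a
  polynomial, and an antidifference \<open>Q\<close> of this polynomial evaluates the sum.\<close>

lemma eventually_poly_of_differences:
  assumes "\<And>j. j \<in> {1..s} \<Longrightarrow> eventually_poly s (\<lambda>u. G (u(j := Suc (u j))) - G u)"
  shows "eventually_poly s G"
proof -
  have "\<forall>j\<in>{1..s}. \<exists>p u0. polyfun s p \<and>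
      (\<forall>u\<in>vecs s. (\<forall>i\<in>{1..s}. u0 \<le> u i) \<longrightarrow> G (u(j := Suc (u j))) - G u = p u)"
    using assms unfolding eventually_poly_def by blast
  then obtain p b where p: "\<And>j. j \<in> {1..s} \<Longrightarrow> polyfun s (p j)"
    "\<And>j u. j \<in> {1..s} \<Longrightarrow> u \<in> vecs s \<Longrightarrow> (\<forall>i\<in>{1..s}. b j \<le> u i) \<Longrightarrow> G (u(j := Suc (u j))) - G u = p j u"
    by metis
  define u0 where "u0 = (\<Sum>j=1..s. b j)"
  have b: "b j \<le> u0" if "j \<in> {1..s}" for j
    unfolding u0_def using that by (intro member_le_sum) auto
  have "\<exists>q. polyfun s q \<and> (\<forall>u\<in>vecs s. (\<forall>j\<in>{1..s}. u0 \<le> u j \<and> (k < j \<longrightarrow> u j = u0)) \<longrightarrow> G u = q u)"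
    if "k \<le> s" for k
    using that
  proof (induction k)
    case 0
    define w where "w = (\<lambda>j. if j \<in> {1..s} then u0 else 0)"
    have "u = w" if "u \<in> vecs s" "\<forall>j\<in>{1..s}. u0 \<le> u j \<and> (0 < j \<longrightarrow> u j = u0)" for u
      using that by (intro ext) (auto simp: w_def vecs_def)
    then show ?case by (intro exI[of _ "\<lambda>_. G w"]) (auto simp: polyfun_const)
  next
    case (Suc k)
    then obtain q where q: "polyfun s q"
      "\<And>u. u \<in> vecs s \<Longrightarrow> \<forall>j\<in>{1..s}. u0 \<le> u j \<and> (k < j \<longrightarrow> u j = u0) \<Longrightarrow> G u = q u"
      by force
    define i where "i = Suc k"
    have i: "i \<in> {1..s}" using Suc.prems by (simp add: i_def)
    obtain Q where Q: "polyfun s Q" "\<And>u. Q (u(i := Suc (u i))) - Q u = p i u"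
      using polyfun_antidifference[OF p(1)[OF i] i] by blast
    define q' where "q' u = q (u(i := u0)) + (Q u - Q (u(i := u0)))" for u
    have "polyfun s q'"
      unfolding q'_def by (intro polyfun_add polyfun_diff polyfun_subst_const q(1) Q(1) i)
    moreover have "G u = q' u"
      if u: "u \<in> vecs s" "\<forall>j\<in>{1..s}. u0 \<le> u j \<and> (Suc k < j \<longrightarrow> u j = u0)" for u
    proof -
      have "G (u(i := u0 + t)) = q (u(i := u0)) + (Q (u(i := u0 + t)) - Q (u(i := u0)))" for t
      proof (induction t)
        case 0
        have "G (u(i := u0)) = q (u(i := u0))"
          using u i by (intro q(2)) (auto simp: i_def intro: vecs_upd)
        then show ?case by (simp del: fun_upd_apply)
      next
        case (Suc t)
        let ?v = "u(i := u0 + t)"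
        have "\<forall>j\<in>{1..s}. b i \<le> ?v j"
          using u b[OF i] by (auto intro: order_trans trans_le_add1)
        then have "G (?v(i := Suc (?v i))) - G ?v = p i ?v"
          by (intro p(2)[OF i] vecs_upd[OF u(1) i])
        moreover have "Q (?v(i := Suc (?v i))) - Q ?v = p i ?v" by (rule Q(2))
        moreover have "?v(i := Suc (?v i)) = u(i := u0 + Suc t)" by simp
        ultimately show ?case using Suc by (simp only:)
      qed
      from this[of "u i - u0"] have "G u = q (u(i := u0)) + (Q u - Q (u(i := u0)))"
        using u(2) i by simp
      then show ?thesis by (simp add: q'_def)
    qed
    ultimately show ?case by blast
  qed
  from this[of s] show ?thesis unfolding eventually_poly_def by fastforce
qed

lemma poly_leading_limit:
  "(\<lambda>t. (\<Sum>k<Suc n. a k * real t ^ k) / real t ^ n) \<longlonglongrightarrow> a n"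
proof -
  have "(\<lambda>t. a k * real t ^ k / real t ^ n) \<longlonglongrightarrow> 0" if "k < n" for k
  proof (rule Lim_transform_eventually)
    have "(\<lambda>t. a k * (inverse (real t)) ^ (n - k)) \<longlonglongrightarrow> a k * 0 ^ (n - k)"
      by (intro tendsto_intros lim_inverse_n)
    then show "(\<lambda>t. a k * (inverse (real t)) ^ (n - k)) \<longlonglongrightarrow> 0"
      using that by (simp add: power_0_left)
    show "\<forall>\<^sub>F t in sequentially. a k * (inverse (real t)) ^ (n - k) = a k * real t ^ k / real t ^ n"
      using eventually_gt_at_top[of 0]
    proof eventually_elim
      case (elim t)
      then have "real t ^ n = real t ^ k * real t ^ (n - k)"
        using that by (simp add: power_add[symmetric])
      then show ?case using elim by (simp add: field_simps power_inverse)
    qed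
  qed
  then have "(\<lambda>t. \<Sum>k<n. a k * real t ^ k / real t ^ n) \<longlonglongrightarrow> (\<Sum>k<n. 0)"
    by (intro tendsto_sum) auto
  moreover have "(\<lambda>t. a n * real t ^ n / real t ^ n) \<longlonglongrightarrow> a n"
    by (rule Lim_transform_eventually[OF tendsto_const])
      (use eventually_gt_at_top[of 0] in eventually_elim, simp)
  ultimately have "(\<lambda>t. (\<Sum>k<n. a k * real t ^ k / real t ^ n) + a n * real t ^ n / real t ^ n) \<longlonglongrightarrow> (\<Sum>k<n. 0) + a n"
    by (rule tendsto_add)
  then show ?thesis by (simp add: sum_divide_distrib add_divide_distrib)
qed

text \<open>If \<open>K = n + 1\<close> and \<open>m \<le> n\<close>, then dividing by \<open>t\<^bsup>n\<^esup>\<close> instead of \<open>t\<^bsup>m\<^esup>\<close> keeps the limit \<open>0\<close>, but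
  the limit is also the top coefficient \<open>a n\<close>. Remove this coefficient and repeat.\<close>

lemma poly_tail_zero:
  assumes "(\<lambda>t. (\<Sum>k<K. a k * real t ^ k) / real t ^ m) \<longlonglongrightarrow> 0" and "m \<le> k" "k < K"
  shows "a k = 0"
  using assms
proof (induction K)
  case (Suc n)
  have "a n = 0" if "m \<le> n"
  proof -
    have "(\<lambda>t. (\<Sum>k<Suc n. a k * real t ^ k) / real t ^ m * inverse (real t) ^ (n - m)) \<longlonglongrightarrow> 0 * 0 ^ (n - m)"
      by (intro tendsto_intros lim_inverse_n Suc.prems(1))
    moreover have "\<forall>\<^sub>F t in sequentially. (\<Sum>k<Suc n. a k * real t ^ k) / real t ^ m * inverse (real t) ^ (n - m)
        = (\<Sum>k<Suc n. a k * real t ^ k) / real t ^ n"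
      using eventually_gt_at_top[of 0]
    proof eventually_elim
      case (elim t)
      then have "real t ^ n = real t ^ m * real t ^ (n - m)"
        using that by (simp add: power_add[symmetric])
      then show ?case using elim by (simp add: field_simps power_inverse del: sum.lessThan_Suc)
    qed
    ultimately have "(\<lambda>t. (\<Sum>k<Suc n. a k * real t ^ k) / real t ^ n) \<longlonglongrightarrow> 0 * 0 ^ (n - m)"
      by (rule Lim_transform_eventually)
    then have "(\<lambda>t. (\<Sum>k<Suc n. a k * real t ^ k) / real t ^ n) \<longlonglongrightarrow> 0" by simp
    then show ?thesis using poly_leading_limit LIMSEQ_unique by blast
  qed
  moreover have "(\<lambda>t. (\<Sum>k<n. a k * real t ^ k) / real t ^ m) \<longlonglongrightarrow> 0" if "a n = 0"
    using Suc.prems(1) that by simp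
  ultimately show ?case
    using Suc.IH Suc.prems(2,3) by (cases "k = n") auto
qed simp

text \<open>The exponents in \<open>S\<close> need only be distinguished by their values on \<open>I\<close>. In this form
  the statement is stable under removal of a coordinate \<open>j\<close> from \<open>I\<close>: grouping \<open>S\<close> by the value of
  \<open>d j\<close> turns the sum into a polynomial in \<open>u j\<close>, whose coefficients are instances for the smaller
  set of coordinates.\<close>

lemma vanishing_form_coeffs:
  assumes "finite I" and "finite S"
    and "\<And>d d'. d \<in> S \<Longrightarrow> d' \<in> S \<Longrightarrow> (\<And>i. i \<in> I \<Longrightarrow> d i = d' i) \<Longrightarrow> d = d'"
    and "\<And>u :: nat \<Rightarrow> nat. (\<And>i. 1 \<le> u i) \<Longrightarrow> (\<Sum>d\<in>S. c d * (\<Prod>i\<in>I. real (u i) ^ d i)) = (0::real)"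
    and "d \<in> S"
  shows "c d = 0"
  using assms
proof (induction I arbitrary: S d rule: finite_induct)
  case empty
  have "S = {d}" using empty.prems(2,4) by auto
  then show ?case using empty.prems(3)[of "\<lambda>_. 1"] by simp
next
  case (insert j I)
  define S' where "S' k = {d \<in> S. d j = k}" for k
  define K where "K = Suc (\<Sum>d\<in>S. d j)"
  have K: "d j < K" if "d \<in> S" for d
    unfolding K_def using member_le_sum[OF that, of "\<lambda>d. d j"] insert.prems(1) by simp
  have "(\<Sum>d\<in>S' k. c d * (\<Prod>i\<in>I. real (u i) ^ d i)) = 0"
    if u: "\<And>i. 1 \<le> u i" for u k
  proof (cases "k < K")
    case True
    define a where "a k = (\<Sum>d\<in>S' k. c d * (\<Prod>i\<in>I. real (u i) ^ d i))" for k
    have "(\<Sum>k<K. a k * real t ^ k) = 0" if "t \<ge> 1" for t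
    proof -
      let ?v = "u(j := t)"
      have v: "(\<Prod>i\<in>insert j I. real (?v i) ^ d i) = (\<Prod>i\<in>I. real (u i) ^ d i) * real t ^ d j" for d
      proof -
        have "(\<Prod>i\<in>I. real (?v i) ^ d i) = (\<Prod>i\<in>I. real (u i) ^ d i)"
          using insert.hyps by (intro prod.cong) auto
        then show ?thesis using insert.hyps by simp
      qed
      have "0 = (\<Sum>d\<in>S. c d * (\<Prod>i\<in>insert j I. real (?v i) ^ d i))"
        by (rule insert.prems(3)[symmetric]) (use u that in auto)
      also have "\<dots> = (\<Sum>k<K. \<Sum>d\<in>S' k. c d * (\<Prod>i\<in>insert j I. real (?v i) ^ d i))"
        unfolding S'_def by (rule sum.group[symmetric]) (use insert.prems(1) K in auto)
      also have "\<dots> = (\<Sum>k<K. a k * real t ^ k)"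
        unfolding v a_def sum_distrib_right by (intro sum.cong) (auto simp: S'_def)
      finally show ?thesis by simp
    qed
    then have "\<forall>\<^sub>F t in sequentially. 0 = (\<Sum>k<K. a k * real t ^ k) / real t ^ 0"
      by (intro eventually_sequentiallyI[of 1]) simp
    then have "(\<lambda>t. (\<Sum>k<K. a k * real t ^ k) / real t ^ 0) \<longlonglongrightarrow> 0"
      by (rule Lim_transform_eventually[OF tendsto_const])
    from poly_tail_zero[OF this _ True] show ?thesis by (simp add: a_def)
  next
    case False
    then have "S' k = {}" using K by (force simp: S'_def)
    then show ?thesis by simp
  qed
  moreover have "finite (S' (d j))" using insert.prems(1) by (simp add: S'_def)
  moreover have "e = e'" if "e \<in> S' (d j)" "e' \<in> S' (d j)" "\<And>i. i \<in> I \<Longrightarrow> e i = e' i" for e e'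
    using that by (intro insert.prems(2)) (auto simp: S'_def)
  ultimately show ?case
    using insert.IH[of "S' (d j)" d] insert.prems(4) by (auto simp: S'_def)
qed

lemma hom_part_scale: "hom_part s c k (\<lambda>i. t * u i) = hom_part s c k u * real t ^ k"
proof -
  have "monval s d (\<lambda>i. t * u i) = monval s d u * real t ^ k" if "d \<in> multi_indices s k" for d
  proof -
    have "monval s d (\<lambda>i. t * u i) = monval s d u * (\<Prod>i=1..s. real t ^ d i)"
      by (simp add: power_mult_distrib prod.distrib mult.commute)
    also have "(\<Prod>i=1..s. real t ^ d i) = real t ^ k"
      using that by (simp add: power_sum[symmetric] multi_indices_def)
    finally show ?thesis .
  qed
  then show ?thesis
    unfolding hom_part_def sum_distrib_right by (intro sum.cong) (simp_all only: mult.assoc)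
qed

lemma hom_part_zero_coeffs:
  assumes "\<And>u. (\<And>i. 1 \<le> u i) \<Longrightarrow> hom_part s c k u = 0" and "d \<in> multi_indices s k"
  shows "c d = 0"
proof (rule vanishing_form_coeffs[of "{1..s}" "multi_indices s k" c d])
  fix d d' assume "d \<in> multi_indices s k" "d' \<in> multi_indices s k" "\<And>i. i \<in> {1..s} \<Longrightarrow> d i = d' i"
  then show "d = d'" unfolding multi_indices_def by (intro PiE_ext[of d "{1..s}" "\<lambda>_. UNIV" d']) auto
next
  fix u :: "nat \<Rightarrow> nat" assume "\<And>i. 1 \<le> u i"
  then show "(\<Sum>d\<in>multi_indices s k. c d * monval s d u) = 0"
    using assms(1) by (simp add: hom_part_def)
qed (use assms(2) finite_multi_indices in auto)

lemma polyfun_shift: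
  assumes "polyfun s f" and i: "i \<in> {1..s}"
  shows "polyfun s (\<lambda>u. f (u(i := Suc (u i))))"
  using assms(1)
proof induction
  case zero
  then show ?case by (simp add: polyfun.zero)
next
  case (add_monomial f d c)
  have "c * monval s d (u(i := Suc (u i))) = (\<Sum>k\<le>d i. (c * real (d i choose k)) * monval s (d(i := k)) u)" for u
  proof -
    have "real (Suc (u i)) ^ d i = (\<Sum>k\<le>d i. real (d i choose k) * real (u i) ^ k)"
      using binomial_ring[of "real (u i)" 1 "d i"] by (simp add: add.commute)
    moreover have "(\<Prod>j\<in>{1..s}-{i}. real ((u(i := Suc (u i))) j) ^ d j) = (\<Prod>j\<in>{1..s}-{i}. real (u j) ^ d j)"
      by (intro prod.cong) auto
    moreover have "(\<Prod>j\<in>{1..s}-{i}. real (u j) ^ (d(i := k)) j) = (\<Prod>j\<in>{1..s}-{i}. real (u j) ^ d j)" for k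
      by (intro prod.cong) auto
    ultimately show ?thesis
      unfolding monval_split[OF i]
      by (simp add: sum_distrib_left sum_distrib_right mult.assoc del: of_nat_Suc)
  qed
  moreover have "polyfun s (\<lambda>u. f (u(i := Suc (u i))) +
      (\<Sum>k\<le>d i. (c * real (d i choose k)) * monval s (d(i := k)) u))"
    by (intro polyfun_add add_monomial.IH polyfun_sum polyfun_monomial fun_upd_PiE[OF add_monomial.hyps(2) i]) auto
  ultimately show ?case by (simp only:)
qed

lemma eventually_poly_shift:
  assumes "eventually_poly s f" and i: "i \<in> {1..s}"
  shows "eventually_poly s (\<lambda>u. f (u(i := Suc (u i))))"
proof -
  obtain p u0 where p: "polyfun s p" "\<forall>u\<in>vecs s. (\<forall>j\<in>{1..s}. u0 \<le> u j) \<longrightarrow> f u = p u"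
    using assms(1) unfolding eventually_poly_def by blast
  have "f (u(i := Suc (u i))) = p (u(i := Suc (u i)))" if "u \<in> vecs s" "\<forall>j\<in>{1..s}. u0 \<le> u j" for u
    using that i by (intro p(2)[rule_format] vecs_upd) (auto simp: le_SucI)
  then show ?thesis unfolding eventually_poly_def using polyfun_shift[OF p(1) i] by blast
qed

lemma monval_cong: "(\<And>i. i \<in> {1..s} \<Longrightarrow> u i = v i) \<Longrightarrow> monval s d u = monval s d v"
  by (intro prod.cong) auto

lemma hom_part_cong: "(\<And>i. i \<in> {1..s} \<Longrightarrow> u i = v i) \<Longrightarrow> hom_part s c k u = hom_part s c k v"
  unfolding hom_part_def using monval_cong[of s u v] by simp

lemma ratio_limit: "(\<lambda>k. real (k * a + b) / real k) \<longlonglongrightarrow> real a"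
proof (rule Lim_transform_eventually)
  have "(\<lambda>k. real a + real b * inverse (real k)) \<longlonglongrightarrow> real a + real b * 0"
    by (intro tendsto_intros lim_inverse_n)
  then show "(\<lambda>k. real a + real b * inverse (real k)) \<longlonglongrightarrow> real a" by simp
  show "\<forall>\<^sub>F k in sequentially. real a + real b * inverse (real k) = real (k * a + b) / real k"
    using eventually_gt_at_top[of 0] by eventually_elim (simp add: field_simps)
qed

text \<open>On the ray \<open>kn + v\<close> the constant \<open>v\<close> is negligible against \<open>k\<close>. It is kept because
  \<open>n\<close> may have coordinates equal to \<open>0\<close>, and only with \<open>v\<close> is the argument large in all coordinates.\<close>

lemma hom_part_ray_limit:
  assumes "j \<le> D"
  shows "(\<lambda>k. hom_part s c j (\<lambda>i. k * n i + v) / real k ^ D) \<longlonglongrightarrow> (if j = D then hom_part s c D n else 0)"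
proof -
  have "(\<lambda>k. \<Sum>d\<in>multi_indices s j. c d * ((\<Prod>i=1..s. (real (k * n i + v) / real k) ^ d i) * inverse (real k) ^ (D - j)))
      \<longlonglongrightarrow> (\<Sum>d\<in>multi_indices s j. c d * ((\<Prod>i=1..s. real (n i) ^ d i) * 0 ^ (D - j)))"
    by (intro tendsto_intros lim_inverse_n ratio_limit)
  also have "(\<Sum>d\<in>multi_indices s j. c d * ((\<Prod>i=1..s. real (n i) ^ d i) * 0 ^ (D - j))) =
      (if j = D then hom_part s c D n else 0)"
    using assms by (auto simp: hom_part_def power_0_left)
  finally show ?thesis
  proof (rule Lim_transform_eventually)
    show "\<forall>\<^sub>F k in sequentially. (\<Sum>d\<in>multi_indices s j. c d *
        ((\<Prod>i=1..s. (real (k * n i + v) / real k) ^ d i) * inverse (real k) ^ (D - j))) =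
        hom_part s c j (\<lambda>i. k * n i + v) / real k ^ D"
      using eventually_gt_at_top[of 0]
    proof eventually_elim
      case (elim k)
      have "(\<Prod>i=1..s. (real (k * n i + v) / real k) ^ d i) * inverse (real k) ^ (D - j) =
          monval s d (\<lambda>i. k * n i + v) / real k ^ D" if d: "d \<in> multi_indices s j" for d
      proof -
        have "(\<Prod>i=1..s. (real (k * n i + v) / real k) ^ d i) =
            monval s d (\<lambda>i. k * n i + v) / (\<Prod>i=1..s. real k ^ d i)"
          by (simp only: power_divide prod_dividef)
        also have "(\<Prod>i=1..s. real k ^ d i) = real k ^ j"
          using d by (simp add: power_sum[symmetric] multi_indices_def)
        finally have 1: "(\<Prod>i=1..s. (real (k * n i + v) / real k) ^ d i) =
            monval s d (\<lambda>i. k * n i + v) / real k ^ j" .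
        have "real k ^ D = real k ^ j * real k ^ (D - j)"
          using assms by (simp add: power_add[symmetric])
        then show ?thesis unfolding 1 using elim by (simp add: field_simps power_inverse)
      qed
      then show ?case unfolding hom_part_def sum_divide_distrib by (intro sum.cong) simp_all
    qed
  qed
qed

definition incr :: "nat \<Rightarrow> (nat \<Rightarrow> nat) \<Rightarrow> nat \<Rightarrow> nat" where
  "incr a \<alpha> = \<alpha>(a := Suc (\<alpha> a))"

lemma vecs_induct [consumes 1, case_names zero step]:
  assumes "u \<in> vecs s" and "P (\<lambda>_. 0)"
    and "\<And>j u. j \<in> {1..s} \<Longrightarrow> u \<in> vecs s \<Longrightarrow> P u \<Longrightarrow> P (incr j u)"
  shows "P u"
  using assms(1)
proof (induction "\<Sum>i=1..s. u i" arbitrary: u)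
  case 0
  then have "u = (\<lambda>_. 0)" by (intro ext) (auto simp: vecs_def)
  then show ?case using assms(2) by simp
next
  case (Suc k)
  then obtain j where j: "j \<in> {1..s}" "u j \<noteq> 0"
    by (metis (no_types, lifting) Zero_not_Suc sum.neutral)
  define v where "v = u(j := u j - 1)"
  have v: "v \<in> vecs s" unfolding v_def using Suc.prems j(1) by (rule vecs_upd)
  have uv: "u = incr j v" using j(2) by (auto simp: v_def incr_def)
  have "(\<Sum>i=1..s. u i) = u j + (\<Sum>i\<in>{1..s}-{j}. u i)" using j(1) by (intro sum.remove) auto
  moreover have "(\<Sum>i=1..s. v i) = v j + (\<Sum>i\<in>{1..s}-{j}. v i)" using j(1) by (intro sum.remove) auto
  moreover have "(\<Sum>i\<in>{1..s}-{j}. v i) = (\<Sum>i\<in>{1..s}-{j}. u i)" by (intro sum.cong) (auto simp: v_def)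
  ultimately have "k = (\<Sum>i=1..s. v i)" using Suc.hyps(2) j(2) by (simp add: v_def)
  then have "P v" using Suc.hyps(1) v by blast
  then show ?case unfolding uv by (rule assms(3)[OF j(1) v])
qed

lemma sum_incr: "j \<in> {1..s} \<Longrightarrow> (\<Sum>i=1..s. incr j u i) = Suc (\<Sum>i=1..s. u i)"
proof -
  assume j: "j \<in> {1..s}"
  have "(\<Sum>i=1..s. incr j u i) = (\<Sum>i=1..s. u i + (if i = j then 1 else 0))"
    by (intro sum.cong) (auto simp: incr_def)
  then show ?thesis using j by (simp add: sum.distrib)
qed

section \<open>Length of intervals of submodules\<close>

definition steps :: "nat \<Rightarrow> (nat \<Rightarrow> 'c set) \<Rightarrow> nat" where
  "steps n N = card {i. i < n \<and> N i \<noteq> N (Suc i)}"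

text \<open>Lengths below are measured by weakly increasing chains, in which the strict steps are
  counted; dropping repetitions gives the strictly increasing chains of \<^const>\<open>module_length\<close>.\<close>

lemma strict_subchain:
  fixes F :: "nat \<Rightarrow> 'c set"
  assumes "\<forall>i<n. F i \<subseteq> F (Suc i)"
  shows "\<exists>G. (\<forall>i\<le>card {i. i < n \<and> F i \<noteq> F (Suc i)}. \<exists>j\<le>n. G i = F j) \<and>
    (\<forall>i<card {i. i < n \<and> F i \<noteq> F (Suc i)}. G i \<subset> G (Suc i)) \<and>
    G (card {i. i < n \<and> F i \<noteq> F (Suc i)}) = F n"
  using assms
proof (induction n)
  case 0
  then show ?case by (intro exI[of _ F]) auto
next
  case (Suc n)
  define k where "k = card {i. i < n \<and> F i \<noteq> F (Suc i)}"
  obtain G where G: "\<forall>i\<le>k. \<exists>j\<le>n. G i = F j" "\<forall>i<k. G i \<subset> G (Suc i)" "G k = F n"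
    using Suc unfolding k_def by auto
  show ?case
  proof (cases "F n = F (Suc n)")
    case True
    then have "{i. i < Suc n \<and> F i \<noteq> F (Suc i)} = {i. i < n \<and> F i \<noteq> F (Suc i)}"
      by (auto simp: less_Suc_eq)
    then have c: "card {i. i < Suc n \<and> F i \<noteq> F (Suc i)} = k" by (simp add: k_def)
    show ?thesis unfolding c using G True by (intro exI[of _ G]) (auto, meson le_SucI)
  next
    case False
    then have "{i. i < Suc n \<and> F i \<noteq> F (Suc i)} = insert n {i. i < n \<and> F i \<noteq> F (Suc i)}"
      by (auto simp: less_Suc_eq)
    then have c: "card {i. i < Suc n \<and> F i \<noteq> F (Suc i)} = Suc k"
      by (simp add: k_def)
    have "F n \<subset> F (Suc n)" using False Suc.prems by auto
    then show ?thesis unfolding c using G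
      by (intro exI[of _ "G(Suc k := F (Suc n))"]) (auto simp: le_Suc_eq less_Suc_eq)
  qed
qed

lemma enat_Sup_add_le:
  fixes X Y :: "enat set"
  assumes "\<And>x y. x \<in> X \<Longrightarrow> y \<in> Y \<Longrightarrow> x + y \<le> z" and "x0 \<in> X" "y0 \<in> Y"
  shows "Sup X + Sup Y \<le> z"
proof (cases z)
  case (enat c)
  have le_diff: "a \<le> enat c - b \<longleftrightarrow> a + b \<le> enat c" if "b \<le> enat c" for a b :: enat
    using that by (cases a; cases b) auto
  have y: "y \<le> enat c" if "y \<in> Y" for y
    using assms(1)[OF assms(2) that] enat by (metis add_increasing zero_le order_trans order_refl)
  have 1: "Sup X + y \<le> enat c" if "y \<in> Y" for y
    using assms(1)[OF _ that] enat le_diff[OF y[OF that]] by (metis Sup_least)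
  then have "Sup X \<le> enat c"
    using assms(3) by (metis add_increasing2 zero_le order_trans order_refl)
  then have "Sup Y \<le> enat c - Sup X"
    using 1 le_diff by (metis Sup_least add.commute)
  then show ?thesis
    using le_diff[OF \<open>Sup X \<le> enat c\<close>] enat by (simp add: add.commute)
qed simp

context module
begin

abbreviation add_M (infixl \<open>\<oplus>\<^sub>M\<close> 65) where "x \<oplus>\<^sub>M y \<equiv> x \<oplus>\<^bsub>M\<^esub> y"
abbreviation neg_M (\<open>\<ominus>\<^sub>M _\<close> [81] 80) where "\<ominus>\<^sub>M x \<equiv> \<ominus>\<^bsub>M\<^esub> x"
abbreviation diff_M (\<open>(_ \<ominus>\<^sub>M _)\<close> [65, 66] 65) where "x \<ominus>\<^sub>M y \<equiv> x \<ominus>\<^bsub>M\<^esub> y"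
abbreviation smult_M (infixl \<open>\<odot>\<^sub>M\<close> 70) where "r \<odot>\<^sub>M x \<equiv> r \<odot>\<^bsub>M\<^esub> x"
abbreviation zero_M (\<open>\<zero>\<^sub>M\<close>) where "\<zero>\<^sub>M \<equiv> \<zero>\<^bsub>M\<^esub>"
abbreviation set_add_M (infixl \<open><+>\<^sub>M\<close> 60) where "A <+>\<^sub>M B \<equiv> A <+>\<^bsub>M\<^esub> B"
abbreviation coset_M (infixl \<open>+>\<^sub>M\<close> 60) where "N +>\<^sub>M x \<equiv> N +>\<^bsub>M\<^esub> x"

abbreviation subm :: "'c set \<Rightarrow> bool" where "subm N \<equiv> submodule N R M"

lemma subm_carr: "subm N \<Longrightarrow> x \<in> N \<Longrightarrow> x \<in> carrier M"
  using submoduleE(1) by blast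

lemma subm_add: "subm N \<Longrightarrow> x \<in> N \<Longrightarrow> y \<in> N \<Longrightarrow> x \<oplus>\<^sub>M y \<in> N"
  using submoduleE(5) by blast

lemma subm_neg: "subm N \<Longrightarrow> x \<in> N \<Longrightarrow> \<ominus>\<^sub>M x \<in> N"
  using submoduleE(3) by blast

lemma subm_smult: "subm N \<Longrightarrow> r \<in> carrier R \<Longrightarrow> x \<in> N \<Longrightarrow> r \<odot>\<^sub>M x \<in> N"
  using submoduleE(4) by blast

lemma subm_diff: "subm N \<Longrightarrow> x \<in> N \<Longrightarrow> y \<in> N \<Longrightarrow> x \<ominus>\<^sub>M y \<in> N"
  unfolding a_minus_def by (intro subm_add subm_neg)

lemma subm_zero: "subm N \<Longrightarrow> \<zero>\<^sub>M \<in> N"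
  using submoduleE(2) subm_smult[of N \<zero>] subm_carr by (metis R.zero_closed ex_in_conv smult_l_null)

lemma submI:
  assumes "H \<subseteq> carrier M" and "\<zero>\<^sub>M \<in> H"
    and "\<And>a b. a \<in> H \<Longrightarrow> b \<in> H \<Longrightarrow> a \<oplus>\<^sub>M b \<in> H"
    and "\<And>r x. r \<in> carrier R \<Longrightarrow> x \<in> H \<Longrightarrow> r \<odot>\<^sub>M x \<in> H"
  shows "subm H"
proof (rule submoduleI)
  fix a assume a: "a \<in> H"
  then have "\<ominus>\<^sub>M a = (\<ominus> \<one>) \<odot>\<^sub>M a"
    using assms(1) by (simp add: smult_l_minus subsetD)
  then show "\<ominus>\<^sub>M a \<in> H" using assms(4) a by simp
qed (use assms in auto)

lemma subm_Int: "subm A \<Longrightarrow> subm B \<Longrightarrow> subm (A \<inter> B)"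
  by (rule submI) (auto intro: subm_carr subm_zero subm_add subm_smult)

lemma add_diff_cancel_left: "a \<in> carrier M \<Longrightarrow> b \<in> carrier M \<Longrightarrow> (a \<oplus>\<^sub>M b) \<ominus>\<^sub>M a = b"
  by (simp add: a_minus_def M.a_comm[of a b] M.a_assoc M.r_neg)

lemma diff_add_cancel: "x \<in> carrier M \<Longrightarrow> y \<in> carrier M \<Longrightarrow> (x \<ominus>\<^sub>M y) \<oplus>\<^sub>M y = x"
  by (simp add: a_minus_def M.a_assoc M.l_neg)

lemma mem_plus: "z \<in> A <+>\<^sub>M B \<longleftrightarrow> (\<exists>a\<in>A. \<exists>b\<in>B. z = a \<oplus>\<^sub>M b)"
  by (auto simp: set_add_def')

lemma subm_plus:
  assumes "subm A" "subm B" shows "subm (A <+>\<^sub>M B)"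
proof (rule submI)
  show "A <+>\<^sub>M B \<subseteq> carrier M"
    using assms by (auto simp: mem_plus intro!: M.a_closed intro: subm_carr[of A] subm_carr[of B])
  show "\<zero>\<^sub>M \<in> A <+>\<^sub>M B"
    using subm_zero assms by (metis M.zero_closed M.l_zero mem_plus)
  fix x y assume "x \<in> A <+>\<^sub>M B" "y \<in> A <+>\<^sub>M B"
  then obtain a b a' b' where ab: "a \<in> A" "b \<in> B" "x = a \<oplus>\<^sub>M b" "a' \<in> A" "b' \<in> B" "y = a' \<oplus>\<^sub>M b'"
    by (auto simp: mem_plus)
  have "x \<oplus>\<^sub>M y = (a \<oplus>\<^sub>M a') \<oplus>\<^sub>M (b \<oplus>\<^sub>M b')"
    using ab assms subm_carr M.a_ac by (simp add: M.a_ac)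
  then show "x \<oplus>\<^sub>M y \<in> A <+>\<^sub>M B"
    using ab assms by (auto simp: mem_plus intro: subm_add)
next
  fix r x assume r: "r \<in> carrier R" "x \<in> A <+>\<^sub>M B"
  then obtain a b where ab: "a \<in> A" "b \<in> B" "x = a \<oplus>\<^sub>M b" by (auto simp: mem_plus)
  have "r \<odot>\<^sub>M x = (r \<odot>\<^sub>M a) \<oplus>\<^sub>M (r \<odot>\<^sub>M b)"
    using ab assms r subm_carr by (simp add: smult_r_distr)
  then show "r \<odot>\<^sub>M x \<in> A <+>\<^sub>M B"
    using ab assms r by (auto simp: mem_plus intro: subm_smult)
qed

lemma plus_upper1: "subm A \<Longrightarrow> subm B \<Longrightarrow> A \<subseteq> A <+>\<^sub>M B"
  by (metis M.r_zero mem_plus subm_carr subm_zero subsetI)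

lemma plus_upper2: "subm A \<Longrightarrow> subm B \<Longrightarrow> B \<subseteq> A <+>\<^sub>M B"
  by (metis M.l_zero mem_plus subm_carr subm_zero subsetI)

lemma plus_least: "subm C \<Longrightarrow> A \<subseteq> C \<Longrightarrow> B \<subseteq> C \<Longrightarrow> A <+>\<^sub>M B \<subseteq> C"
  by (auto simp: mem_plus intro!: subm_add[of C])

lemma plus_mono: "A \<subseteq> A' \<Longrightarrow> B \<subseteq> B' \<Longrightarrow> A <+>\<^sub>M B \<subseteq> A' <+>\<^sub>M B'"
  by (auto simp: mem_plus) blast

lemma modular_le:
  assumes "subm A" "subm B" "subm C" "A \<subseteq> C"
  shows "(A <+>\<^sub>M B) \<inter> C \<subseteq> A <+>\<^sub>M (B \<inter> C)"
proof
  fix z assume "z \<in> (A <+>\<^sub>M B) \<inter> C"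
  then obtain a b where ab: "a \<in> A" "b \<in> B" "z = a \<oplus>\<^sub>M b" "z \<in> C" by (auto simp: mem_plus)
  have carr: "a \<in> carrier M" "b \<in> carrier M" using ab assms subm_carr by auto
  have "b = z \<ominus>\<^sub>M a" using ab(3) carr by (simp add: add_diff_cancel_left)
  then have "b \<in> C" using ab assms subm_diff[of C z a] by auto
  then show "z \<in> A <+>\<^sub>M (B \<inter> C)" using ab by (auto simp: mem_plus)
qed

lemma modular_eq:
  assumes "subm X" "subm Y" "subm B" "X \<subseteq> Y" "X \<inter> B = Y \<inter> B" "X <+>\<^sub>M B = Y <+>\<^sub>M B"
  shows "X = Y"
proof
  have "Y \<subseteq> (X <+>\<^sub>M B) \<inter> Y" using assms plus_upper1 by auto
  also have "\<dots> \<subseteq> X <+>\<^sub>M (B \<inter> Y)" using modular_le[OF assms(1,3,2,4)] .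
  also have "\<dots> \<subseteq> X" using assms by (intro plus_least) auto
  finally show "Y \<subseteq> X" .
qed (use assms in auto)

definition sub_chain :: "nat \<Rightarrow> (nat \<Rightarrow> 'c set) \<Rightarrow> 'c set \<Rightarrow> 'c set \<Rightarrow> bool" where
  "sub_chain n N A B \<longleftrightarrow> (\<forall>i\<le>n. subm (N i) \<and> A \<subseteq> N i \<and> N i \<subseteq> B) \<and> (\<forall>i<n. N i \<subseteq> N (Suc i))"

text \<open>The length of \<open>B/A\<close>, seen as an interval in the lattice of submodules. Intersecting a chain with
  a submodule, or adding a submodule to it, may create repetitions; this is why the chains are only
  weakly increasing and why their strict steps are counted.\<close>

definition len :: "'c set \<Rightarrow> 'c set \<Rightarrow> enat" where
  "len A B = Sup {enat (steps n N) | n N. sub_chain n N A B}"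

lemma len_upper: "sub_chain n N A B \<Longrightarrow> enat (steps n N) \<le> len A B"
  unfolding len_def by (rule Sup_upper) blast

lemma len_least: "(\<And>n N. sub_chain n N A B \<Longrightarrow> enat (steps n N) \<le> z) \<Longrightarrow> len A B \<le> z"
  unfolding len_def by (rule Sup_least) blast

lemma len_mono: "A' \<subseteq> A \<Longrightarrow> B \<subseteq> B' \<Longrightarrow> len A B \<le> len A' B'"
  by (rule len_least, rule len_upper) (fastforce simp: sub_chain_def)

lemma len_self [simp]: "len A A = 0"
proof -
  have "len A A \<le> 0"
  proof (rule len_least)
    fix n N assume "sub_chain n N A A"
    then have "{i. i < n \<and> N i \<noteq> N (Suc i)} = {}"
      unfolding sub_chain_def by (metis (mono_tags, lifting) Suc_leI empty_Collect_eq order_less_imp_le subset_antisym)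
    then show "enat (steps n N) \<le> 0" by (simp add: steps_def zero_enat_def)
  qed
  then show ?thesis by simp
qed

text \<open>A strictly monotone map of intervals preserves strict steps.\<close>

lemma len_le_map:
  assumes f: "\<And>X. subm X \<Longrightarrow> A \<subseteq> X \<Longrightarrow> X \<subseteq> B \<Longrightarrow> subm (f X) \<and> A' \<subseteq> f X \<and> f X \<subseteq> B'"
    and mono: "\<And>X Y. subm X \<Longrightarrow> subm Y \<Longrightarrow> A \<subseteq> X \<Longrightarrow> X \<subseteq> Y \<Longrightarrow> Y \<subseteq> B \<Longrightarrow> f X \<subseteq> f Y"
    and inj: "\<And>X Y. subm X \<Longrightarrow> subm Y \<Longrightarrow> A \<subseteq> X \<Longrightarrow> X \<subseteq> Y \<Longrightarrow> Y \<subseteq> B \<Longrightarrow> f X = f Y \<Longrightarrow> Y \<subseteq> X"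
  shows "len A B \<le> len A' B'"
proof (rule len_least)
  fix n N assume N: "sub_chain n N A B"
  then have "sub_chain n (\<lambda>i. f (N i)) A' B'"
    unfolding sub_chain_def using f mono by (meson Suc_leI less_imp_le)
  then have "enat (steps n (\<lambda>i. f (N i))) \<le> len A' B'" by (rule len_upper)
  moreover have "steps n N \<le> steps n (\<lambda>i. f (N i))"
    unfolding steps_def
  proof (rule card_mono)
    show "{i. i < n \<and> N i \<noteq> N (Suc i)} \<subseteq> {i. i < n \<and> f (N i) \<noteq> f (N (Suc i))}"
    proof clarify
      fix i assume i: "i < n" "N i \<noteq> N (Suc i)" "f (N i) = f (N (Suc i))"
      then have "N (Suc i) \<subseteq> N i"
        using inj[of "N i" "N (Suc i)"] N unfolding sub_chain_def by auto
      then show False using i N unfolding sub_chain_def by auto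
    qed
  qed simp
  ultimately show "enat (steps n N) \<le> len A' B'" by (meson enat_ord_simps(1) order_trans)
qed

text \<open>By modularity, a step of a chain \<open>N\<close> that is strict stays strict in \<open>N \<inter> B\<close> or in
  \<open>N + B\<close>; the first is a chain from \<open>A\<close> to \<open>B\<close>, the second one from \<open>B\<close> to \<open>C\<close>.\<close>

lemma len_add_le:
  assumes "subm A" "subm B" "subm C" "A \<subseteq> B" "B \<subseteq> C"
  shows "len A C \<le> len A B + len B C"
proof (rule len_least)
  fix n N assume N: "sub_chain n N A C"
  let ?P = "\<lambda>i. N i \<inter> B" and ?Q = "\<lambda>i. N i <+>\<^sub>M B"
  have "sub_chain n ?P A B"
    using N assms unfolding sub_chain_def by (auto intro: subm_Int)
  then have 1: "enat (steps n ?P) \<le> len A B" by (rule len_upper)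
  have "sub_chain n ?Q B C"
    using N assms unfolding sub_chain_def
    by (intro conjI allI impI subm_plus plus_upper2 plus_least[of C] plus_mono) auto
  then have 2: "enat (steps n ?Q) \<le> len B C" by (rule len_upper)
  have "{i. i < n \<and> N i \<noteq> N (Suc i)} \<subseteq>
      {i. i < n \<and> ?P i \<noteq> ?P (Suc i)} \<union> {i. i < n \<and> ?Q i \<noteq> ?Q (Suc i)}"
  proof clarify
    fix i assume i: "i < n" "N i \<noteq> N (Suc i)" "?Q i = ?Q (Suc i)" and p: "?P i = ?P (Suc i)"
    have "N i = N (Suc i)"
      using N i(1) by (intro modular_eq[OF _ _ assms(2) _ p i(3)]) (auto simp: sub_chain_def)
    then show False using i(2) by simp
  qed
  then have "steps n N \<le> card ({i. i < n \<and> ?P i \<noteq> ?P (Suc i)} \<union> {i. i < n \<and> ?Q i \<noteq> ?Q (Suc i)})"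
    unfolding steps_def by (intro card_mono) auto
  also have "\<dots> \<le> steps n ?P + steps n ?Q" unfolding steps_def by (rule card_Un_le)
  finally have "enat (steps n N) \<le> enat (steps n ?P) + enat (steps n ?Q)" by simp
  then show "enat (steps n N) \<le> len A B + len B C"
    using 1 2 by (meson add_mono order_trans)
qed

lemma len_add_ge:
  assumes "subm A" "subm B" "subm C" "A \<subseteq> B" "B \<subseteq> C"
  shows "len A B + len B C \<le> len A C"
  unfolding len_def[of A B] len_def[of B C]
proof (rule enat_Sup_add_le)
  fix x y
  assume "x \<in> {enat (steps n N) | n N. sub_chain n N A B}" "y \<in> {enat (steps n N) | n N. sub_chain n N B C}"
  then obtain n N p P where N: "sub_chain n N A B" "x = enat (steps n N)"
    and P: "sub_chain p P B C" "y = enat (steps p P)" by blast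
  \<comment> \<open>The two chains are placed one after the other; the extra step from \<open>N n\<close> to \<open>P 0\<close> need not be strict.\<close>
  define Q where "Q i = (if i \<le> n then N i else P (i - Suc n))" for i
  have "sub_chain (n + Suc p) Q A C"
    unfolding sub_chain_def
  proof (intro conjI allI impI)
    fix i assume i: "i \<le> n + Suc p"
    show "subm (Q i)" using N P i by (auto simp: Q_def sub_chain_def)
    show "A \<subseteq> Q i"
    proof (cases "i \<le> n")
      case False
      then have "i - Suc n \<le> p" using i by simp
      then show ?thesis using P assms(4) False unfolding Q_def sub_chain_def by auto
    qed (use N in \<open>auto simp: Q_def sub_chain_def\<close>)
    show "Q i \<subseteq> C"
    proof (cases "i \<le> n")
      case True
      then show ?thesis using N assms(5) unfolding Q_def sub_chain_def by auto
    qed (use P i in \<open>auto simp: Q_def sub_chain_def\<close>)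
  next
    fix i assume i: "i < n + Suc p"
    consider "i < n" | "i = n" | "i > n" by linarith
    then show "Q i \<subseteq> Q (Suc i)"
    proof cases
      case 2
      have "N n \<subseteq> B" "B \<subseteq> P 0" using N P by (auto simp: sub_chain_def)
      then show ?thesis using 2 by (auto simp: Q_def)
    next
      case 3
      then have "Suc i - Suc n = Suc (i - Suc n)" "i - Suc n < p" using i by auto
      then show ?thesis using P 3 by (auto simp: Q_def sub_chain_def simp del: diff_Suc_Suc)
    qed (use N in \<open>auto simp: Q_def sub_chain_def\<close>)
  qed
  then have "enat (steps (n + Suc p) Q) \<le> len A C" by (rule len_upper)
  moreover have "steps n N + steps p P \<le> steps (n + Suc p) Q"
  proof -
    let ?S = "{i. i < n \<and> N i \<noteq> N (Suc i)}" and ?T = "{i. i < p \<and> P i \<noteq> P (Suc i)}"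
    have "?S \<union> (\<lambda>i. i + Suc n) ` ?T \<subseteq> {i. i < n + Suc p \<and> Q i \<noteq> Q (Suc i)}"
      by (auto simp: Q_def)
    then have "card (?S \<union> (\<lambda>i. i + Suc n) ` ?T) \<le> steps (n + Suc p) Q"
      unfolding steps_def by (intro card_mono) auto
    moreover have "card (?S \<union> (\<lambda>i. i + Suc n) ` ?T) = card ?S + card ((\<lambda>i. i + Suc n) ` ?T)"
      by (rule card_Un_disjoint) auto
    moreover have "card ((\<lambda>i. i + Suc n) ` ?T) = card ?T" by (rule card_image) (simp add: inj_on_def)
    ultimately show ?thesis unfolding steps_def by simp
  qed
  ultimately show "x + y \<le> len A C"
    using N(2) P(2) by (metis enat_ord_simps(1) order_trans plus_enat_simps(1))
next
  have "sub_chain 0 (\<lambda>_. A) A B" "sub_chain 0 (\<lambda>_. B) B C" using assms by (auto simp: sub_chain_def)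
  then show "enat (steps 0 (\<lambda>_. A)) \<in> {enat (steps n N) | n N. sub_chain n N A B}"
    "enat (steps 0 (\<lambda>_. B)) \<in> {enat (steps n N) | n N. sub_chain n N B C}" by blast+
qed

lemma len_add:
  assumes "subm A" "subm B" "subm C" "A \<subseteq> B" "B \<subseteq> C"
  shows "len A C = len A B + len B C"
  using len_add_le[OF assms] len_add_ge[OF assms] by (rule order_antisym)

text \<open>\<open>(Y + Z)/(X + Z)\<close> is a quotient of \<open>Y/X\<close>. In terms of intervals, \<open>W \<mapsto> W \<inter> Y\<close> is injective
  because \<open>W = (W \<inter> Y) + Z\<close> for \<open>Z \<subseteq> W \<subseteq> Y + Z\<close>.\<close>

lemma len_shift:
  assumes "subm X" "subm Y" "subm Z" "X \<subseteq> Y"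
  shows "len (X <+>\<^sub>M Z) (Y <+>\<^sub>M Z) \<le> len X Y"
proof (rule len_le_map[where f = "\<lambda>W. W \<inter> Y"])
  fix W assume W: "subm W" "X <+>\<^sub>M Z \<subseteq> W" "W \<subseteq> Y <+>\<^sub>M Z"
  then show "subm (W \<inter> Y) \<and> X \<subseteq> W \<inter> Y \<and> W \<inter> Y \<subseteq> Y"
    using assms plus_upper1[of X Z] by (auto intro: subm_Int)
next
  fix V W
  assume *: "subm V" "subm W" "X <+>\<^sub>M Z \<subseteq> V" "V \<subseteq> W" "W \<subseteq> Y <+>\<^sub>M Z" "V \<inter> Y = W \<inter> Y"
  have Z: "Z \<subseteq> V" "Z \<subseteq> W" using plus_upper2[of X Z] assms * by auto
  have "W \<subseteq> (Z <+>\<^sub>M Y) \<inter> W"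
  proof -
    have "Y <+>\<^sub>M Z \<subseteq> Z <+>\<^sub>M Y"
      using assms plus_upper1[of Z Y] plus_upper2[of Z Y] by (intro plus_least subm_plus) auto
    then show ?thesis using *(5) by blast
  qed
  also have "\<dots> \<subseteq> Z <+>\<^sub>M (Y \<inter> W)" by (rule modular_le) (use assms * Z in auto)
  also have "\<dots> \<subseteq> V" using * Z by (intro plus_least) auto
  finally show "W \<subseteq> V" .
qed auto

lemma subm_smult_image:
  assumes "subm A" "y \<in> carrier R" shows "subm ((\<lambda>a. y \<odot>\<^sub>M a) ` A)"
proof (rule submI)
  show "(\<lambda>a. y \<odot>\<^sub>M a) ` A \<subseteq> carrier M" using assms by (auto intro: subm_carr)
  show "\<zero>\<^sub>M \<in> (\<lambda>a. y \<odot>\<^sub>M a) ` A"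
    using assms subm_zero[of A] by (metis imageI smult_r_null)
  fix a b assume "a \<in> (\<lambda>a. y \<odot>\<^sub>M a) ` A" "b \<in> (\<lambda>a. y \<odot>\<^sub>M a) ` A"
  then obtain a' b' where ab: "a' \<in> A" "a = y \<odot>\<^sub>M a'" "b' \<in> A" "b = y \<odot>\<^sub>M b'" by blast
  then have "a \<oplus>\<^sub>M b = y \<odot>\<^sub>M (a' \<oplus>\<^sub>M b')"
    using assms by (simp add: smult_r_distr subm_carr)
  then show "a \<oplus>\<^sub>M b \<in> (\<lambda>a. y \<odot>\<^sub>M a) ` A"
    using ab assms by (auto intro: subm_add)
next
  fix r x assume r: "r \<in> carrier R" and "x \<in> (\<lambda>a. y \<odot>\<^sub>M a) ` A"
  then obtain a where a: "a \<in> A" "x = y \<odot>\<^sub>M a" by blast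
  have "r \<odot>\<^sub>M x = y \<odot>\<^sub>M (r \<odot>\<^sub>M a)"
    using a r assms subm_carr by (simp add: smult_assoc1[symmetric] R.m_comm)
  then show "r \<odot>\<^sub>M x \<in> (\<lambda>a. y \<odot>\<^sub>M a) ` A" using a r assms by (auto intro: subm_smult)
qed

lemma subm_colon:
  assumes "subm A" "subm B" "y \<in> carrier R" shows "subm {a \<in> A. y \<odot>\<^sub>M a \<in> B}"
proof (rule submI)
  fix r x assume r: "r \<in> carrier R" and x: "x \<in> {a \<in> A. y \<odot>\<^sub>M a \<in> B}"
  have "y \<odot>\<^sub>M (r \<odot>\<^sub>M x) = r \<odot>\<^sub>M (y \<odot>\<^sub>M x)"
    using x r assms subm_carr by (simp add: smult_assoc1[symmetric] R.m_comm)
  then show "r \<odot>\<^sub>M x \<in> {a \<in> A. y \<odot>\<^sub>M a \<in> B}" using x r assms by (auto intro: subm_smult)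
next
  fix a b assume "a \<in> {a \<in> A. y \<odot>\<^sub>M a \<in> B}" "b \<in> {a \<in> A. y \<odot>\<^sub>M a \<in> B}"
  then show "a \<oplus>\<^sub>M b \<in> {a \<in> A. y \<odot>\<^sub>M a \<in> B}"
    using assms by (auto simp: smult_r_distr subm_carr intro: subm_add)
qed (use assms in \<open>auto intro: subm_carr subm_zero\<close>)

text \<open>Multiplication by \<open>y\<close> induces an isomorphism from \<open>A/{a \<in> A. ya \<in> B}\<close> to \<open>(B + yA)/B\<close>.
  Images and preimages of submodules give the two inequalities.\<close>

lemma len_smult:
  assumes A: "subm A" and B: "subm B" and y: "y \<in> carrier R"
  shows "len {a \<in> A. y \<odot>\<^sub>M a \<in> B} A = len B (B <+>\<^sub>M (\<lambda>a. y \<odot>\<^sub>M a) ` A)"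
proof (rule order_antisym)
  show "len {a \<in> A. y \<odot>\<^sub>M a \<in> B} A \<le> len B (B <+>\<^sub>M (\<lambda>a. y \<odot>\<^sub>M a) ` A)"
  proof (rule len_le_map[where f = "\<lambda>X. B <+>\<^sub>M (\<lambda>a. y \<odot>\<^sub>M a) ` X"])
    fix X assume X: "subm X" "X \<subseteq> A"
    show "subm (B <+>\<^sub>M (\<lambda>a. y \<odot>\<^sub>M a) ` X) \<and> B \<subseteq> B <+>\<^sub>M (\<lambda>a. y \<odot>\<^sub>M a) ` X \<and>
        B <+>\<^sub>M (\<lambda>a. y \<odot>\<^sub>M a) ` X \<subseteq> B <+>\<^sub>M (\<lambda>a. y \<odot>\<^sub>M a) ` A"
      using X B y by (intro conjI subm_plus plus_upper1 plus_mono subm_smult_image) auto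
  next
    fix X X'
    assume *: "subm X" "subm X'" "{a \<in> A. y \<odot>\<^sub>M a \<in> B} \<subseteq> X" "X \<subseteq> X'" "X' \<subseteq> A"
      "B <+>\<^sub>M (\<lambda>a. y \<odot>\<^sub>M a) ` X = B <+>\<^sub>M (\<lambda>a. y \<odot>\<^sub>M a) ` X'"
    show "X' \<subseteq> X"
    proof
      fix x' assume x': "x' \<in> X'"
      then have "y \<odot>\<^sub>M x' \<in> B <+>\<^sub>M (\<lambda>a. y \<odot>\<^sub>M a) ` X"
        using plus_upper2[OF B subm_smult_image[OF *(2) y]] *(6) by auto
      then obtain b x where bx: "b \<in> B" "x \<in> X" "y \<odot>\<^sub>M x' = b \<oplus>\<^sub>M y \<odot>\<^sub>M x"
        by (auto simp: mem_plus)
      have carr: "x \<in> carrier M" "x' \<in> carrier M" "b \<in> carrier M"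
        using bx x' * B subm_carr by auto
      have "y \<odot>\<^sub>M (x' \<ominus>\<^sub>M x) = b"
        using bx(3) carr y by (simp add: a_minus_def smult_r_distr smult_r_minus M.a_assoc M.r_neg)
      moreover have "x' \<ominus>\<^sub>M x \<in> A" using x' bx * A by (auto intro: subm_diff)
      ultimately have "x' \<ominus>\<^sub>M x \<in> X" using bx(1) *(3) by auto
      then have "(x' \<ominus>\<^sub>M x) \<oplus>\<^sub>M x \<in> X" using bx *(1) by (intro subm_add)
      then show "x' \<in> X" using diff_add_cancel carr by simp
    qed
  next
    fix X Y :: "'c set" assume "X \<subseteq> Y"
    then show "B <+>\<^sub>M (\<lambda>a. y \<odot>\<^sub>M a) ` X \<subseteq> B <+>\<^sub>M (\<lambda>a. y \<odot>\<^sub>M a) ` Y" by (intro plus_mono) auto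
  qed
  show "len B (B <+>\<^sub>M (\<lambda>a. y \<odot>\<^sub>M a) ` A) \<le> len {a \<in> A. y \<odot>\<^sub>M a \<in> B} A"
  proof (rule len_le_map[where f = "\<lambda>Y. {a \<in> A. y \<odot>\<^sub>M a \<in> Y}"])
    fix Y Y'
    assume *: "subm Y" "subm Y'" "B \<subseteq> Y" "Y \<subseteq> Y'" "Y' \<subseteq> B <+>\<^sub>M (\<lambda>a. y \<odot>\<^sub>M a) ` A"
      "{a \<in> A. y \<odot>\<^sub>M a \<in> Y} = {a \<in> A. y \<odot>\<^sub>M a \<in> Y'}"
    show "Y' \<subseteq> Y"
    proof
      fix z assume z: "z \<in> Y'"
      then obtain b a where ba: "b \<in> B" "a \<in> A" "z = b \<oplus>\<^sub>M y \<odot>\<^sub>M a"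
        using *(5) by (auto simp: mem_plus subset_iff)
      have carr: "b \<in> carrier M" "a \<in> carrier M" using ba A B subm_carr by auto
      have "y \<odot>\<^sub>M a = z \<ominus>\<^sub>M b"
        using ba(3) carr y by (simp add: add_diff_cancel_left)
      then have "y \<odot>\<^sub>M a \<in> Y'" using z ba(1) * by (auto intro: subm_diff)
      then have "y \<odot>\<^sub>M a \<in> Y" using ba(2) *(6) by blast
      then show "z \<in> Y" using ba * by (auto intro: subm_add)
    qed
  qed (use A y in \<open>auto intro: subm_colon\<close>)
qed

lemma subm_abelian_subgroup: "subm N \<Longrightarrow> abelian_subgroup N M"
  by (intro abelian_subgroupI3 additive_subgroup.intro submodule.axioms(1) M.abelian_group_axioms)

lemma coset_eqI:
  assumes "subm N" "x \<in> carrier M" "y \<in> carrier M" "x \<ominus>\<^sub>M y \<in> N"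
  shows "N +>\<^sub>M x = N +>\<^sub>M y"
proof -
  interpret N: abelian_subgroup N M by (rule subm_abelian_subgroup[OF assms(1)])
  have "x \<in> N +>\<^sub>M y"
    using N.a_rcos_module_rev[OF assms(3,2)] assms(4) by (simp add: a_minus_def)
  then show ?thesis using M.add.repr_independence[of x N y] assms(1,3) submodule.axioms(1)[OF assms(1)]
    by (simp add: a_r_coset_def)
qed

lemma coset_self: "subm N \<Longrightarrow> x \<in> carrier M \<Longrightarrow> x \<in> N +>\<^sub>M x"
  using abelian_subgroup.a_rcos_self[OF subm_abelian_subgroup] by blast

lemma mem_coset: "z \<in> N +>\<^sub>M x \<longleftrightarrow> (\<exists>h\<in>N. z = h \<oplus>\<^sub>M x)"
  by (auto simp: a_r_coset_def')

lemma coset_zero: "subm N \<Longrightarrow> N +>\<^sub>M \<zero>\<^sub>M = N"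
  using submoduleE(1)[of N] by (auto simp: mem_coset subset_iff)

lemma quot_smult:
  assumes N: "subm N" and "r \<in> carrier R" "x \<in> carrier M"
  shows "r \<odot>\<^bsub>quot_module M N\<^esub> (N +>\<^sub>M x) = N +>\<^sub>M (r \<odot>\<^sub>M x)"
proof -
  have "N +>\<^sub>M (r \<odot>\<^sub>M x') = N +>\<^sub>M (r \<odot>\<^sub>M x)" if x': "x' \<in> N +>\<^sub>M x" for x'
  proof -
    obtain h where h: "h \<in> N" "x' = h \<oplus>\<^sub>M x" using x' by (auto simp: mem_coset)
    have hc: "h \<in> carrier M" using h N subm_carr by auto
    have "r \<odot>\<^sub>M x' = r \<odot>\<^sub>M x \<oplus>\<^sub>M r \<odot>\<^sub>M h"
      using h hc assms by (simp add: smult_r_distr M.a_comm)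
    then have "r \<odot>\<^sub>M x' \<ominus>\<^sub>M r \<odot>\<^sub>M x = r \<odot>\<^sub>M h"
      using hc assms by (simp add: add_diff_cancel_left)
    then show ?thesis using h hc assms by (intro coset_eqI) (auto intro: subm_smult)
  qed
  moreover have "x \<in> N +>\<^sub>M x" using coset_self N assms by blast
  ultimately have "(\<Union>x'\<in>N +>\<^sub>M x. N +>\<^sub>M (r \<odot>\<^sub>M x')) = N +>\<^sub>M (r \<odot>\<^sub>M x)" by blast
  then show ?thesis by (simp add: quot_module_def)
qed

lemma quot_carrier: "carrier (quot_module M N) = {N +>\<^sub>M x | x. x \<in> carrier M}"
  by (auto simp: quot_module_def A_RCOSETS_def')

lemma quot_add:
  "subm N \<Longrightarrow> x \<in> carrier M \<Longrightarrow> y \<in> carrier M \<Longrightarrow>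
    (N +>\<^sub>M x) \<oplus>\<^bsub>quot_module M N\<^esub> (N +>\<^sub>M y) = N +>\<^sub>M (x \<oplus>\<^sub>M y)"
  by (simp add: quot_module_def abelian_subgroup.a_rcos_sum[OF subm_abelian_subgroup])

lemma quot_zero: "\<zero>\<^bsub>quot_module M N\<^esub> = N"
  by (simp add: quot_module_def)

lemma quot_abelian_group:
  assumes N: "subm N" shows "abelian_group (quot_module M N)"
proof (rule abelian_groupI)
  let ?Q = "quot_module M N"
  fix X assume "X \<in> carrier ?Q"
  then obtain x where x: "x \<in> carrier M" "X = N +>\<^sub>M x" by (auto simp: quot_carrier)
  then have "(N +>\<^sub>M (\<ominus>\<^sub>M x)) \<oplus>\<^bsub>?Q\<^esub> X = \<zero>\<^bsub>?Q\<^esub>"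
    using N by (simp add: quot_add M.l_neg coset_zero quot_zero)
  then show "\<exists>Y\<in>carrier ?Q. Y \<oplus>\<^bsub>?Q\<^esub> X = \<zero>\<^bsub>?Q\<^esub>"
    using x by (auto simp: quot_carrier intro!: exI[of _ "N +>\<^sub>M (\<ominus>\<^sub>M x)"])
  show "\<zero>\<^bsub>?Q\<^esub> \<oplus>\<^bsub>?Q\<^esub> X = X"
    using x N quot_add[OF N M.zero_closed x(1)] by (simp add: coset_zero quot_zero)
next
  show "\<zero>\<^bsub>quot_module M N\<^esub> \<in> carrier (quot_module M N)"
    using coset_zero[OF N] by (auto simp: quot_carrier quot_zero intro!: exI[of _ "\<zero>\<^sub>M"])
next
  fix X Y Z assume "X \<in> carrier (quot_module M N)" "Y \<in> carrier (quot_module M N)" "Z \<in> carrier (quot_module M N)"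
  then show "X \<oplus>\<^bsub>quot_module M N\<^esub> Y \<oplus>\<^bsub>quot_module M N\<^esub> Z = X \<oplus>\<^bsub>quot_module M N\<^esub> (Y \<oplus>\<^bsub>quot_module M N\<^esub> Z)"
    using N by (auto simp: quot_carrier quot_add M.a_ac)
next
  fix X Y assume XY: "X \<in> carrier (quot_module M N)" "Y \<in> carrier (quot_module M N)"
  then show "X \<oplus>\<^bsub>quot_module M N\<^esub> Y = Y \<oplus>\<^bsub>quot_module M N\<^esub> X"
    using N by (auto simp: quot_carrier quot_add M.a_ac)
  show "X \<oplus>\<^bsub>quot_module M N\<^esub> Y \<in> carrier (quot_module M N)"
    using N XY by (auto simp: quot_carrier quot_add)
qed

lemma subm_quot_preimage:
  assumes N: "subm N" and X: "submodule X R (quot_module M N)"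
  shows "subm {x \<in> carrier M. N +>\<^sub>M x \<in> X}"
proof (rule submI)
  interpret X: submodule X R "quot_module M N" by (rule X)
  show "\<zero>\<^sub>M \<in> {x \<in> carrier M. N +>\<^sub>M x \<in> X}"
    using X.one_closed by (simp add: coset_zero[OF N] quot_zero)
  fix a b assume "a \<in> {x \<in> carrier M. N +>\<^sub>M x \<in> X}" "b \<in> {x \<in> carrier M. N +>\<^sub>M x \<in> X}"
  then show "a \<oplus>\<^sub>M b \<in> {x \<in> carrier M. N +>\<^sub>M x \<in> X}"
    using X.m_closed[of "N +>\<^sub>M a" "N +>\<^sub>M b"] by (simp add: quot_add[OF N])
next
  interpret X: submodule X R "quot_module M N" by (rule X)
  fix r x assume "r \<in> carrier R" "x \<in> {x \<in> carrier M. N +>\<^sub>M x \<in> X}"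
  then show "r \<odot>\<^sub>M x \<in> {x \<in> carrier M. N +>\<^sub>M x \<in> X}"
    using X.smult_closed[of r "N +>\<^sub>M x"] by (simp add: quot_smult[OF N])
qed auto

lemma subm_quot_image:
  assumes N: "subm N" and X: "subm X"
  shows "submodule ((\<lambda>x. N +>\<^sub>M x) ` X) R (quot_module M N)"
proof -
  interpret Q: abelian_group "quot_module M N" by (rule quot_abelian_group[OF N])
  show ?thesis
  proof (rule submodule.intro)
    show "submodule_axioms ((\<lambda>x. N +>\<^sub>M x) ` X) R (quot_module M N)"
      by (rule submodule_axioms.intro)
        (use X subm_carr in \<open>auto simp: quot_smult[OF N] intro!: imageI subm_smult\<close>)
    show "subgroup ((\<lambda>x. N +>\<^sub>M x) ` X) (add_monoid (quot_module M N))"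
    proof (rule Q.add.subgroupI)
      show "(\<lambda>x. N +>\<^sub>M x) ` X \<subseteq> carrier (quot_module M N)"
        using X subm_carr by (auto simp: quot_carrier)
      show "(\<lambda>x. N +>\<^sub>M x) ` X \<noteq> {}" using subm_zero[OF X] by auto
      fix a assume "a \<in> (\<lambda>x. N +>\<^sub>M x) ` X"
      then obtain x where x: "x \<in> X" "a = N +>\<^sub>M x" by blast
      have xc: "x \<in> carrier M" using x X subm_carr by blast
      have "\<ominus>\<^bsub>quot_module M N\<^esub> a = N +>\<^sub>M (\<ominus>\<^sub>M x)"
      proof (rule Q.minus_equality)
        show "(N +>\<^sub>M (\<ominus>\<^sub>M x)) \<oplus>\<^bsub>quot_module M N\<^esub> a = \<zero>\<^bsub>quot_module M N\<^esub>"
          using x xc N by (simp add: quot_add M.l_neg coset_zero quot_zero)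
      qed (use x xc in \<open>auto simp: quot_carrier\<close>)
      then show "\<ominus>\<^bsub>quot_module M N\<^esub> a \<in> (\<lambda>x. N +>\<^sub>M x) ` X"
        using x X subm_neg by auto
    next
      fix a b assume "a \<in> (\<lambda>x. N +>\<^sub>M x) ` X" "b \<in> (\<lambda>x. N +>\<^sub>M x) ` X"
      then show "a \<oplus>\<^bsub>quot_module M N\<^esub> b \<in> (\<lambda>x. N +>\<^sub>M x) ` X"
        using X subm_carr by (auto simp: quot_add[OF N] intro!: imageI subm_add)
    qed
  qed
qed

text \<open>Submodules of \<open>M/N\<close> correspond to submodules of \<open>M\<close> containing \<open>N\<close>. From here on only
  submodules of the one module \<open>M\<close> occur.\<close>

lemma module_length_quot:
  assumes N: "subm N"
  shows "module_length R (quot_module M N) = len N (carrier M)"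
proof (rule order_antisym)
  show "module_length R (quot_module M N) \<le> len N (carrier M)"
    unfolding module_length_def
  proof (rule Sup_least, clarify)
    fix n F
    assume F: "\<forall>i\<le>n. submodule (F i) R (quot_module M N)" "\<forall>i<n. F i \<subset> F (Suc i)"
    define G where "G i = {x \<in> carrier M. N +>\<^sub>M x \<in> F i}" for i
    have coset_N: "N +>\<^sub>M x = N" if "x \<in> N" for x
      using coset_eqI[OF N, of x "\<zero>\<^sub>M"] that subm_carr[OF N that]
        subm_diff[OF N that subm_zero[OF N]] by (simp add: coset_zero[OF N])
    have "sub_chain n G N (carrier M)"
      unfolding sub_chain_def
    proof (intro conjI allI impI)
      fix i assume i: "i \<le> n"
      then interpret X: submodule "F i" R "quot_module M N" using F(1) by blast
      show "subm (G i)" unfolding G_def using subm_quot_preimage[OF N] F i by blast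
      show "N \<subseteq> G i"
        using subm_carr[OF N] coset_N X.one_closed by (auto simp: G_def quot_zero)
    qed (use F in \<open>auto simp: G_def\<close>)
    moreover have "G i \<noteq> G (Suc i)" if i: "i < n" for i
    proof -
      obtain X where X: "X \<in> F (Suc i)" "X \<notin> F i" using F i by blast
      interpret X: submodule "F (Suc i)" R "quot_module M N" using F(1) i by simp
      obtain x where "x \<in> carrier M" "X = N +>\<^sub>M x" using X.mem_carrier[OF X(1)] by (auto simp: quot_carrier)
      then show ?thesis using X by (auto simp: G_def)
    qed
    then have "{i. i < n \<and> G i \<noteq> G (Suc i)} = {..<n}" by auto
    then have "steps n G = n" by (simp add: steps_def)
    ultimately show "enat n \<le> len N (carrier M)" using len_upper by metis
  qed
  show "len N (carrier M) \<le> module_length R (quot_module M N)"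
  proof (rule len_least)
    fix n F assume F: "sub_chain n F N (carrier M)"
    define H where "H i = (\<lambda>x. N +>\<^sub>M x) ` F i" for i
    have "\<forall>i<n. H i \<subseteq> H (Suc i)" using F by (simp add: H_def sub_chain_def image_mono)
    from strict_subchain[OF this] obtain G where G:
      "\<forall>i\<le>steps n H. \<exists>j\<le>n. G i = H j" "\<forall>i<steps n H. G i \<subset> G (Suc i)"
      unfolding steps_def by blast
    have "\<forall>i\<le>steps n H. submodule (G i) R (quot_module M N)"
      using G(1) subm_quot_image[OF N] F unfolding H_def sub_chain_def by metis
    then have 1: "enat (steps n H) \<le> module_length R (quot_module M N)"
      unfolding module_length_def using G(2) by (intro Sup_upper) blast
    have "F i = F (Suc i)" if i: "i < n" and eq: "H i = H (Suc i)" for i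
    proof
      show "F i \<subseteq> F (Suc i)" using F i by (auto simp: sub_chain_def)
      have Fi: "subm (F i)" "N \<subseteq> F i" "subm (F (Suc i))" using F i by (auto simp: sub_chain_def)
      show "F (Suc i) \<subseteq> F i"
      proof
        fix y assume y: "y \<in> F (Suc i)"
        then obtain x where x: "x \<in> F i" "N +>\<^sub>M y = N +>\<^sub>M x" using eq unfolding H_def by blast
        then have "y \<in> N +>\<^sub>M x" using coset_self[OF N] y Fi subm_carr by blast
        then show "y \<in> F i" using x Fi subm_add by (auto simp: mem_coset subset_iff)
      qed
    qed
    then have "{i. i < n \<and> F i \<noteq> F (Suc i)} \<subseteq> {i. i < n \<and> H i \<noteq> H (Suc i)}" by auto
    then have "steps n F \<le> steps n H" unfolding steps_def by (intro card_mono) auto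
    then show "enat (steps n F) \<le> module_length R (quot_module M N)"
      using 1 by (meson enat_ord_simps(1) order_trans)
  qed
qed

definition cyc :: "'c \<Rightarrow> 'c set" where "cyc x = (\<lambda>r. r \<odot>\<^sub>M x) ` carrier R"

fun gens :: "'c list \<Rightarrow> 'c set" where
  "gens [] = {\<zero>\<^sub>M}"
| "gens (x # xs) = cyc x <+>\<^sub>M gens xs"

definition ideal_cyc :: "'a set \<Rightarrow> 'c \<Rightarrow> 'c set" where "ideal_cyc I x = (\<lambda>r. r \<odot>\<^sub>M x) ` I"

lemma subm_ideal_cyc:
  assumes I: "ideal I R" and x: "x \<in> carrier M" shows "subm (ideal_cyc I x)"
proof (rule submI)
  interpret I: ideal I R by (rule I)
  show "ideal_cyc I x \<subseteq> carrier M" using x I.Icarr by (auto simp: ideal_cyc_def)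
  show "\<zero>\<^sub>M \<in> ideal_cyc I x"
    unfolding ideal_cyc_def using x by (intro image_eqI[OF _ I.zero_closed]) simp
  fix a b assume "a \<in> ideal_cyc I x" "b \<in> ideal_cyc I x"
  then obtain r s where "r \<in> I" "s \<in> I" "a = r \<odot>\<^sub>M x" "b = s \<odot>\<^sub>M x" by (auto simp: ideal_cyc_def)
  then show "a \<oplus>\<^sub>M b \<in> ideal_cyc I x"
    unfolding ideal_cyc_def using x I.Icarr
    by (intro image_eqI[of _ _ "r \<oplus> s"]) (auto simp: smult_l_distr)
next
  interpret I: ideal I R by (rule I)
  fix r a assume r: "r \<in> carrier R" and "a \<in> ideal_cyc I x"
  then obtain s where "s \<in> I" "a = s \<odot>\<^sub>M x" by (auto simp: ideal_cyc_def)
  then show "r \<odot>\<^sub>M a \<in> ideal_cyc I x"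
    unfolding ideal_cyc_def using x r I.Icarr
    by (intro image_eqI[of _ _ "r \<otimes> s"]) (auto simp: smult_assoc1 I.I_l_closed)
qed

lemma cyc_eq: "cyc x = ideal_cyc (carrier R) x"
  by (simp add: cyc_def ideal_cyc_def)

lemma subm_cyc: "x \<in> carrier M \<Longrightarrow> subm (cyc x)"
  unfolding cyc_eq by (rule subm_ideal_cyc[OF R.oneideal])

lemma mem_cyc: "x \<in> carrier M \<Longrightarrow> x \<in> cyc x"
  unfolding cyc_def by (rule image_eqI[of _ _ \<one>]) auto

lemma subm_gens: "set xs \<subseteq> carrier M \<Longrightarrow> subm (gens xs)"
proof (induction xs)
  case Nil
  show ?case by (rule submI) auto
qed (auto intro: subm_plus subm_cyc)

lemma set_subset_gens: "set xs \<subseteq> carrier M \<Longrightarrow> set xs \<subseteq> gens xs"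
proof (induction xs)
  case (Cons x xs)
  then have "cyc x \<subseteq> gens (x # xs)" "gens xs \<subseteq> gens (x # xs)"
    using plus_upper1 plus_upper2 subm_cyc subm_gens by auto
  then show ?case using Cons mem_cyc[of x] by auto
qed simp

lemma fin_gen_gens:
  assumes "fin_gen_module R M"
  shows "\<exists>xs. set xs \<subseteq> carrier M \<and> gens xs = carrier M"
proof -
  obtain S where S: "S \<subseteq> carrier M" "finite S" "submodule_span R M S = carrier M"
    using assms unfolding fin_gen_module_def by blast
  obtain xs where xs: "set xs = S" using S(2) finite_list by blast
  have "submodule_span R M S \<subseteq> gens xs"
    unfolding submodule_span_def using subm_gens set_subset_gens xs S(1) by blast
  moreover have "gens xs \<subseteq> carrier M" using subm_gens submoduleE(1) xs S(1) by blast
  ultimately show ?thesis using xs S by auto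
qed

end

lemma (in noetherian_ring) ideals_stabilize:
  assumes "\<And>i. ideal (F i) R" "\<And>i. F i \<subseteq> F (Suc i)"
  shows "\<exists>k. \<forall>i\<ge>k. F i = F k"
proof -
  have mono: "F i \<subseteq> F j" if "i \<le> j" for i j
    using assms(2) that by (rule lift_Suc_mono_le)
  have "\<Union>(range F) \<in> range F"
  proof (rule ideal_chain_is_trivial)
    show "subset.chain {I. ideal I R} (range F)"
      unfolding pred_on.chain_def
    proof (intro conjI ballI)
      fix X Y assume "X \<in> range F" "Y \<in> range F"
      then obtain i j where "X = F i" "Y = F j" by blast
      then show "(\<subset>)\<^sup>=\<^sup>= X Y \<or> (\<subset>)\<^sup>=\<^sup>= Y X" using mono[of i j] mono[of j i] by (cases "i \<le> j") auto
    qed (use assms(1) in auto)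
  qed simp
  then obtain k where k: "\<Union>(range F) = F k" by blast
  have "F i = F k" if "i \<ge> k" for i using k mono[OF that] by auto
  then show ?thesis by blast
qed

lemma (in noetherian_ring) wf_ideals: "wf {(J, I). ideal I R \<and> ideal J R \<and> I \<subset> J}"
  unfolding wf_iff_no_infinite_down_chain
proof clarify
  fix F assume "\<forall>i. (F (Suc i), F i) \<in> {(J, I). ideal I R \<and> ideal J R \<and> I \<subset> J}"
  then have F: "\<And>i. ideal (F i) R" "\<And>i. F i \<subset> F (Suc i)" by auto
  then obtain k where "\<forall>i\<ge>k. F i = F k" using ideals_stabilize[of F] by blast
  then have "F (Suc k) = F k" by (meson le_SucI order_refl)
  then show False using F(2)[of k] by simp
qed

text \<open>Induction over a list of generators. Modulo the span of \<open>xs\<close>, the part of \<open>F i\<close> in the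
  span of \<open>x\<close> and \<open>xs\<close> is described by the ideal of coefficients of \<open>x\<close>. When this ideal and the
  intersections with the span of \<open>xs\<close> have both become stationary, so has the chain.\<close>

lemma (in module) submodules_stabilize:
  assumes noeth: "noetherian_ring R" and fg: "fin_gen_module R M"
    and F: "\<And>i. subm (F i)" "\<And>i. F i \<subseteq> F (Suc i)"
  shows "\<exists>k. \<forall>i\<ge>k. F i = F k"
proof -
  have mono: "F i \<subseteq> F j" if "i \<le> j" for i j
    using F(2) that by (rule lift_Suc_mono_le)
  have "\<exists>k. \<forall>i\<ge>k. F i \<inter> gens xs = F k \<inter> gens xs" if "set xs \<subseteq> carrier M" for xs
    using that
  proof (induction xs)
    case Nil
    have "F i \<inter> gens [] = {\<zero>\<^sub>M}" for i using subm_zero[OF F(1)] by auto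
    then show ?case by (intro exI[of _ 0]) (simp del: gens.simps)
  next
    case (Cons x xs)
    then obtain k1 where k1: "\<And>i. i \<ge> k1 \<Longrightarrow> F i \<inter> gens xs = F k1 \<inter> gens xs" by auto
    have x: "x \<in> carrier M" and xs: "set xs \<subseteq> carrier M" using Cons.prems by auto
    note G = subm_gens[OF xs]
    define I where "I i = {r \<in> carrier R. \<exists>g\<in>gens xs. r \<odot>\<^sub>M x \<oplus>\<^sub>M g \<in> F i}" for i
    have II: "ideal (I i) R" for i
    proof (rule idealI)
      show "subgroup (I i) (add_monoid R)"
      proof (rule R.add.subgroupI)
        show "I i \<subseteq> carrier R" by (auto simp: I_def)
        have "\<zero> \<in> I i" using x subm_zero[OF G] subm_zero[OF F(1)] by (auto simp: I_def intro!: bexI[of _ "\<zero>\<^sub>M"])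
        then show "I i \<noteq> {}" by blast
        fix a assume "a \<in> I i"
        then obtain g where g: "a \<in> carrier R" "g \<in> gens xs" "a \<odot>\<^sub>M x \<oplus>\<^sub>M g \<in> F i" by (auto simp: I_def)
        have "(\<ominus> a) \<odot>\<^sub>M x \<oplus>\<^sub>M (\<ominus>\<^sub>M g) = \<ominus>\<^sub>M (a \<odot>\<^sub>M x \<oplus>\<^sub>M g)"
          using g x subm_carr[OF G g(2)] by (simp add: smult_l_minus M.minus_add)
        then show "\<ominus> a \<in> I i" using g subm_neg[OF G] subm_neg[OF F(1)]
          by (auto simp: I_def intro!: bexI[of _ "\<ominus>\<^sub>M g"])
      next
        fix a b assume "a \<in> I i" "b \<in> I i"
        then obtain g h where g: "a \<in> carrier R" "g \<in> gens xs" "a \<odot>\<^sub>M x \<oplus>\<^sub>M g \<in> F i"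
          and h: "b \<in> carrier R" "h \<in> gens xs" "b \<odot>\<^sub>M x \<oplus>\<^sub>M h \<in> F i" by (auto simp: I_def)
        have "(a \<oplus> b) \<odot>\<^sub>M x \<oplus>\<^sub>M (g \<oplus>\<^sub>M h) = (a \<odot>\<^sub>M x \<oplus>\<^sub>M g) \<oplus>\<^sub>M (b \<odot>\<^sub>M x \<oplus>\<^sub>M h)"
          using g h x subm_carr[OF G] by (simp add: smult_l_distr M.a_ac)
        then show "a \<oplus> b \<in> I i" using g h subm_add[OF G] subm_add[OF F(1)]
          by (auto simp: I_def intro!: bexI[of _ "g \<oplus>\<^sub>M h"])
      qed
      fix a r assume "a \<in> I i" and r: "r \<in> carrier R"
      then obtain g where g: "a \<in> carrier R" "g \<in> gens xs" "a \<odot>\<^sub>M x \<oplus>\<^sub>M g \<in> F i" by (auto simp: I_def)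
      have "(r \<otimes> a) \<odot>\<^sub>M x \<oplus>\<^sub>M (r \<odot>\<^sub>M g) = r \<odot>\<^sub>M (a \<odot>\<^sub>M x \<oplus>\<^sub>M g)"
        using g r x subm_carr[OF G g(2)] by (simp add: smult_assoc1 smult_r_distr)
      then show "r \<otimes> a \<in> I i" using g r subm_smult[OF G] subm_smult[OF F(1)]
        by (auto simp: I_def intro!: bexI[of _ "r \<odot>\<^sub>M g"])
      then show "a \<otimes> r \<in> I i" using g r R.m_comm by simp
    qed (rule R.ring_axioms)
    have I_mono: "I i \<subseteq> I (Suc i)" for i using F(2)[of i] by (auto simp: I_def)
    have "\<exists>k. \<forall>i\<ge>k. I i = I k"
      by (rule noetherian_ring.ideals_stabilize[OF noeth]; fact II I_mono)
    then obtain k2 where "\<forall>i\<ge>k2. I i = I k2" ..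
    then have k2: "I i = I k2" if "i \<ge> k2" for i using that by blast
    define k where "k = max k1 k2"
    have "F i \<inter> gens (x # xs) \<subseteq> F k" if i: "i \<ge> k" for i
    proof
      fix z assume z: "z \<in> F i \<inter> gens (x # xs)"
      then obtain r g where rg: "r \<in> carrier R" "g \<in> gens xs" "z = r \<odot>\<^sub>M x \<oplus>\<^sub>M g"
        by (auto simp: mem_plus cyc_def)
      then have "r \<in> I i" using z by (auto simp: I_def)
      then have "r \<in> I k" using k2[of i] k2[of k] i by (simp add: k_def)
      then obtain h where h: "h \<in> gens xs" "r \<odot>\<^sub>M x \<oplus>\<^sub>M h \<in> F k" by (auto simp: I_def)
      have carr: "g \<in> carrier M" "h \<in> carrier M" "r \<odot>\<^sub>M x \<in> carrier M"
        using rg h x subm_carr[OF G] by auto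
      have z_eq: "z = (r \<odot>\<^sub>M x \<oplus>\<^sub>M h) \<oplus>\<^sub>M (g \<ominus>\<^sub>M h)"
      proof -
        have "(r \<odot>\<^sub>M x \<oplus>\<^sub>M h) \<oplus>\<^sub>M (g \<ominus>\<^sub>M h) = (r \<odot>\<^sub>M x \<oplus>\<^sub>M g) \<oplus>\<^sub>M (h \<oplus>\<^sub>M \<ominus>\<^sub>M h)"
          using carr by (simp add: a_minus_def M.a_ac)
        then show ?thesis using carr rg(3) by (simp add: M.r_neg)
      qed
      have e: "z \<ominus>\<^sub>M (r \<odot>\<^sub>M x \<oplus>\<^sub>M h) = g \<ominus>\<^sub>M h"
        unfolding z_eq using carr by (intro add_diff_cancel_left) auto
      have "r \<odot>\<^sub>M x \<oplus>\<^sub>M h \<in> F i" using h mono[OF i] by blast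
      then have "g \<ominus>\<^sub>M h \<in> F i \<inter> gens xs"
        using z subm_diff[OF F(1)] subm_diff[OF G] rg h e by (metis IntI Int_iff)
      then have "g \<ominus>\<^sub>M h \<in> F k" using k1[of i] k1[of k] i by (auto simp: k_def)
      then have "(r \<odot>\<^sub>M x \<oplus>\<^sub>M h) \<oplus>\<^sub>M (g \<ominus>\<^sub>M h) \<in> F k" using h subm_add[OF F(1)] by blast
      also have "(r \<odot>\<^sub>M x \<oplus>\<^sub>M h) \<oplus>\<^sub>M (g \<ominus>\<^sub>M h) = z"
        using z_eq by simp
      finally show "z \<in> F k" .
    qed
    then show ?case using mono by (intro exI[of _ k]) blast
  qed
  moreover obtain xs where xs: "set xs \<subseteq> carrier M" "gens xs = carrier M" using fin_gen_gens[OF fg] by blast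
  ultimately have "\<exists>k. \<forall>i\<ge>k. F i \<inter> carrier M = F k \<inter> carrier M" by metis
  moreover have "F i \<inter> carrier M = F i" for i using submoduleE(1)[OF F(1)] by blast
  ultimately show ?thesis by simp
qed

definition (in module) rlen :: "'c set \<Rightarrow> 'c set \<Rightarrow> real" where
  "rlen A B = real (the_enat (len A B))"

lemma (in module) rlen_add:
  assumes "subm A" "subm B" "subm C" "A \<subseteq> B" "B \<subseteq> C" "len A C \<noteq> \<infinity>"
  shows "rlen A C = rlen A B + rlen B C"
  using len_add[OF assms(1-5)] assms(6) unfolding rlen_def
  by (cases "len A B"; cases "len B C") auto

section \<open>Leading coefficients and an Artin--Rees lemma\<close>

lemma nat_incseq_subseq:
  fixes f :: "nat \<Rightarrow> nat"
  shows "\<exists>r. strict_mono r \<and> incseq (f \<circ> r)"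
proof -
  obtain r where r: "strict_mono r" "monoseq (\<lambda>n. f (r n))" using seq_monosub by blast
  show ?thesis
  proof (cases "incseq (\<lambda>n. f (r n))")
    case True
    then show ?thesis using r(1) by (auto simp: comp_def)
  next
    case False
    then have dec: "decseq (\<lambda>n. f (r n))" using r(2) by (simp add: monoseq_iff)
    obtain k where k: "\<And>i. f (r k) \<le> f (r i)"
      using ex_has_least_nat[of "\<lambda>_. True" _ "\<lambda>i. f (r i)"] by auto
    have "f (r (i + k)) = f (r k)" for i
      using k[of "i + k"] decseqD[OF dec, of k "i + k"] by simp
    moreover have "strict_mono (\<lambda>i. r (i + k))"
      using r(1) by (simp add: strict_mono_def)
    ultimately show ?thesis by (intro exI[of _ "\<lambda>i. r (i + k)"]) (simp add: incseq_def)
  qed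
qed

text \<open>Dickson's lemma in the form of sequences.\<close>

lemma dickson_subseq:
  fixes F :: "nat \<Rightarrow> nat \<Rightarrow> nat"
  shows "\<exists>r. strict_mono r \<and> (\<forall>a<m. incseq (\<lambda>k. F (r k) a))"
proof (induction m)
  case 0
  then show ?case using strict_mono_id by auto
next
  case (Suc m)
  then obtain r where r: "strict_mono r" "\<And>a. a < m \<Longrightarrow> incseq (\<lambda>k. F (r k) a)" by blast
  obtain q where q: "strict_mono q" "incseq ((\<lambda>k. F (r k) m) \<circ> q)" using nat_incseq_subseq by blast
  have "incseq (\<lambda>k. F (r (q k)) a)" if "a < Suc m" for a
  proof (cases "a = m")
    case True
    then show ?thesis using q(2) by (simp add: comp_def)
  next
    case False
    then have "incseq (\<lambda>k. F (r k) a)" using r(2) that by simp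
    then show ?thesis using q(1) by (simp add: incseq_def strict_mono_less_eq)
  qed
  moreover have "strict_mono (\<lambda>k. r (q k))" using r(1) q(1) by (simp add: strict_mono_def)
  ultimately show ?case by blast
qed

definition exponents :: "nat \<Rightarrow> (nat \<Rightarrow> nat) set" where
  "exponents m = {\<alpha>. \<forall>a\<ge>m. \<alpha> a = 0}"

text \<open>The lexicographic order is used because it is total and compatible with raising one coordinate
  (\<open>lex_less_incr\<close>), as monomial orders have to be.\<close>

definition lex_less :: "(nat \<Rightarrow> nat) \<Rightarrow> (nat \<Rightarrow> nat) \<Rightarrow> bool" where
  "lex_less \<beta> \<alpha> \<longleftrightarrow> (\<exists>k. \<beta> k < \<alpha> k \<and> (\<forall>i<k. \<beta> i = \<alpha> i))"

lemma lex_less_irrefl: "\<not> lex_less \<alpha> \<alpha>"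
  by (simp add: lex_less_def)

lemma lex_less_trans: "lex_less \<alpha> \<beta> \<Longrightarrow> lex_less \<beta> \<gamma> \<Longrightarrow> lex_less \<alpha> \<gamma>"
proof -
  assume "lex_less \<alpha> \<beta>" "lex_less \<beta> \<gamma>"
  then obtain k l where "\<alpha> k < \<beta> k" "\<forall>i<k. \<alpha> i = \<beta> i" "\<beta> l < \<gamma> l" "\<forall>i<l. \<beta> i = \<gamma> i"
    by (auto simp: lex_less_def)
  then have "\<alpha> (min k l) < \<gamma> (min k l)" "\<forall>i<min k l. \<alpha> i = \<gamma> i"
    by (cases k l rule: linorder_cases; simp)+
  then show ?thesis unfolding lex_less_def by blast
qed

lemma lex_less_total: "\<alpha> \<noteq> \<beta> \<Longrightarrow> lex_less \<alpha> \<beta> \<or> lex_less \<beta> \<alpha>"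
proof -
  assume "\<alpha> \<noteq> \<beta>"
  define k where "k = (LEAST k. \<alpha> k \<noteq> \<beta> k)"
  have "\<exists>k. \<alpha> k \<noteq> \<beta> k" using \<open>\<alpha> \<noteq> \<beta>\<close> by auto
  then have "\<alpha> k \<noteq> \<beta> k" unfolding k_def by (rule LeastI_ex)
  moreover have eq: "\<alpha> i = \<beta> i" if "i < k" for i using not_less_Least[OF that[unfolded k_def]] by simp
  ultimately consider "\<alpha> k < \<beta> k" | "\<beta> k < \<alpha> k" by linarith
  then show ?thesis
  proof cases
    case 1
    then show ?thesis using eq unfolding lex_less_def by blast
  next
    case 2
    then show ?thesis using eq[symmetric] unfolding lex_less_def by blast
  qed
qed

lemma lex_less_incr: "lex_less (incr a \<beta>) (incr a \<alpha>) \<longleftrightarrow> lex_less \<beta> \<alpha>"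
proof -
  have "incr a \<beta> k < incr a \<alpha> k \<longleftrightarrow> \<beta> k < \<alpha> k" "incr a \<beta> k = incr a \<alpha> k \<longleftrightarrow> \<beta> k = \<alpha> k" for k
    by (auto simp: incr_def)
  then show ?thesis unfolding lex_less_def by simp
qed

lemma lex_less_maximum:
  assumes "finite T" "T \<noteq> {}"
  shows "\<exists>\<alpha>\<in>T. \<forall>\<beta>\<in>T. \<beta> = \<alpha> \<or> lex_less \<beta> \<alpha>"
  using assms
proof (induction T rule: finite_ne_induct)
  case (insert x T)
  then obtain \<alpha> where "\<alpha> \<in> T" "\<forall>\<beta>\<in>T. \<beta> = \<alpha> \<or> lex_less \<beta> \<alpha>" by blast
  then show ?case
  proof (cases "lex_less \<alpha> x")
    case True
    have "lex_less \<beta> x" if "\<beta> \<in> T" for \<beta>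
      using \<open>\<forall>\<beta>\<in>T. \<beta> = \<alpha> \<or> lex_less \<beta> \<alpha>\<close> that True lex_less_trans[of \<beta> \<alpha> x] by auto
    then show ?thesis by blast
  next
    case False
    then show ?thesis using \<open>\<alpha> \<in> T\<close> \<open>\<forall>\<beta>\<in>T. \<beta> = \<alpha> \<or> lex_less \<beta> \<alpha>\<close> lex_less_total[of x \<alpha>] by blast
  qed
qed simp

text \<open>The element \<open>z a\<close> is meant as a generator of \<open>J (g a)\<close>: multiplication by it raises
  the degree by the unit vector at \<open>g a\<close>.\<close>

locale graded_generators = module R M for R (structure) and M (structure) +
  fixes s m :: nat and z :: "nat \<Rightarrow> 'a" and g :: "nat \<Rightarrow> nat"
  assumes z_closed [simp]: "a < m \<Longrightarrow> z a \<in> carrier R"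
    and g_range: "a < m \<Longrightarrow> g a \<in> {1..s}"
begin

definition multidegree :: "(nat \<Rightarrow> nat) \<Rightarrow> nat \<Rightarrow> nat" where
  "multidegree \<alpha> j = (\<Sum>a | a < m \<and> g a = j. \<alpha> a)"

definition exponents_of :: "(nat \<Rightarrow> nat) \<Rightarrow> (nat \<Rightarrow> nat) set" where
  "exponents_of u = {\<alpha> \<in> exponents m. multidegree \<alpha> = u}"

definition zmon :: "(nat \<Rightarrow> nat) \<Rightarrow> 'a" where
  "zmon \<alpha> = (\<Otimes>a\<in>{..<m}. z a [^] \<alpha> a)"

text \<open>The submodule \<open>\<Sum>\<alpha>\<in>T. z\<^bsup>\<alpha>\<^esup>M\<close>, generated in a way that allows induction over such sums.\<close>

inductive_set mspan :: "(nat \<Rightarrow> nat) set \<Rightarrow> 'c set" for T where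
  zero: "\<zero>\<^sub>M \<in> mspan T"
| add: "\<alpha> \<in> T \<Longrightarrow> x \<in> carrier M \<Longrightarrow> w \<in> mspan T \<Longrightarrow> zmon \<alpha> \<odot>\<^sub>M x \<oplus>\<^sub>M w \<in> mspan T"

lemma multidegree_vecs: "multidegree \<alpha> \<in> vecs s"
proof -
  have "{a. a < m \<and> g a = j} = {}" if "j \<notin> {1..s}" for j
    using g_range that by auto
  then show ?thesis unfolding vecs_def multidegree_def by (auto simp del: atLeastAtMost_iff)
qed

lemma multidegree_incr:
  assumes "a < m" shows "multidegree (incr a \<alpha>) = incr (g a) (multidegree \<alpha>)"
proof
  fix j
  show "multidegree (incr a \<alpha>) j = incr (g a) (multidegree \<alpha>) j"
  proof (cases "j = g a")
    case True
    have "a \<in> {b. b < m \<and> g b = j}" using True assms by simp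
    then show ?thesis unfolding multidegree_def incr_def True
      by (subst (1 2) sum.remove[of _ a]) (auto intro!: sum.cong)
  next
    case False
    then show ?thesis unfolding multidegree_def incr_def by (auto intro!: sum.cong)
  qed
qed

lemma incr_exponents: "a < m \<Longrightarrow> \<alpha> \<in> exponents m \<Longrightarrow> incr a \<alpha> \<in> exponents m"
  by (auto simp: exponents_def incr_def)

lemma incr_inj: "incr a \<alpha> = incr a \<beta> \<Longrightarrow> \<alpha> = \<beta>"
  unfolding incr_def by (metis fun_upd_apply nat.inject ext)

lemma finite_exponents_of: "finite (exponents_of u)"
proof (rule finite_subset)
  show "exponents_of u \<subseteq> {\<alpha>. (\<forall>a. a \<in> {..<m} \<longrightarrow> \<alpha> a \<in> {..\<Sum>a<m. u (g a)}) \<and> (\<forall>a. a \<notin> {..<m} \<longrightarrow> \<alpha> a = 0)}"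
  proof clarsimp
    fix \<alpha> assume \<alpha>: "\<alpha> \<in> exponents_of u"
    have "\<alpha> a \<le> (\<Sum>a<m. u (g a))" if a: "a < m" for a
    proof -
      have "\<alpha> a \<le> multidegree \<alpha> (g a)" unfolding multidegree_def using a by (intro member_le_sum) auto
      also have "\<dots> = u (g a)" using \<alpha> by (simp add: exponents_of_def)
      also have "\<dots> \<le> (\<Sum>a<m. u (g a))" using a by (intro member_le_sum) auto
      finally show ?thesis .
    qed
    then show "(\<forall>a<m. \<alpha> a \<le> (\<Sum>a<m. u (g a))) \<and> (\<forall>a. \<not> a < m \<longrightarrow> \<alpha> a = 0)"
      using \<alpha> by (auto simp: exponents_of_def exponents_def)
  qed
next
  show "finite {\<alpha>. (\<forall>a. a \<in> {..<m} \<longrightarrow> \<alpha> a \<in> {..\<Sum>a<m. u (g a)}) \<and> (\<forall>a. a \<notin> {..<m} \<longrightarrow> \<alpha> a = 0)}"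
    using finite_set_of_finite_funs[of "{..<m}" "{..\<Sum>a<m. u (g a)}" "0::nat"] by (simp add: all_conj_distrib)
qed

lemma zmon_closed [simp]: "zmon \<alpha> \<in> carrier R"
  unfolding zmon_def by (intro R.finprod_closed) auto

lemma zmon_incr:
  assumes a: "a < m" shows "zmon (incr a \<alpha>) = z a \<otimes> zmon \<alpha>"
proof -
  have m: "{..<m} = insert a ({..<m} - {a})" using a by auto
  define q where "q = (\<Otimes>b\<in>{..<m} - {a}. z b [^] \<alpha> b)"
  have q: "q \<in> carrier R" unfolding q_def by (intro R.finprod_closed) auto
  have q': "(\<Otimes>b\<in>{..<m} - {a}. z b [^] incr a \<alpha> b) = q"
    unfolding q_def by (intro R.finprod_cong') (auto simp: incr_def)
  have "zmon \<alpha> = z a [^] \<alpha> a \<otimes> q"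
    unfolding zmon_def q_def by (subst m, subst R.finprod_insert) (use a in auto)
  moreover have "zmon (incr a \<alpha>) = z a [^] incr a \<alpha> a \<otimes> q"
    unfolding zmon_def q'[symmetric] by (subst m, subst R.finprod_insert) (use a in auto)
  ultimately show ?thesis using a q by (simp add: incr_def R.m_ac)
qed

lemma zmon_zero: "zmon (\<lambda>_. 0) = \<one>"
  unfolding zmon_def by (subst R.finprod_one_eqI) auto

lemma mspan_carr: "w \<in> mspan T \<Longrightarrow> w \<in> carrier M"
  by (induction rule: mspan.induct) auto

lemma mspan_add: "v \<in> mspan T \<Longrightarrow> w \<in> mspan T \<Longrightarrow> v \<oplus>\<^sub>M w \<in> mspan T"
proof (induction rule: mspan.induct)
  case zero
  then show ?case using mspan_carr by simp
next
  case (add \<alpha> x v)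
  then have "zmon \<alpha> \<odot>\<^sub>M x \<oplus>\<^sub>M (v \<oplus>\<^sub>M w) \<in> mspan T" by (intro mspan.add) auto
  then show ?case using add mspan_carr by (simp add: M.a_assoc)
qed

lemma subm_mspan: "subm (mspan T)"
proof (rule submI)
  fix r w assume "r \<in> carrier R" "w \<in> mspan T"
  from this(2,1) show "r \<odot>\<^sub>M w \<in> mspan T"
  proof (induction rule: mspan.induct)
    case zero
    then show ?case by (simp add: mspan.zero)
  next
    case (add \<alpha> x w)
    have "r \<odot>\<^sub>M (zmon \<alpha> \<odot>\<^sub>M x \<oplus>\<^sub>M w) = zmon \<alpha> \<odot>\<^sub>M (r \<odot>\<^sub>M x) \<oplus>\<^sub>M r \<odot>\<^sub>M w"
      using add mspan_carr[of w] by (simp add: smult_r_distr smult_assoc1[symmetric] R.m_comm)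
    then show ?case using add by (simp add: mspan.add)
  qed
qed (auto intro: mspan_carr mspan.zero mspan_add)

lemma mspan_mono: "T \<subseteq> T' \<Longrightarrow> mspan T \<subseteq> mspan T'"
proof
  fix w assume "T \<subseteq> T'" "w \<in> mspan T"
  from this(2,1) show "w \<in> mspan T'" by (induction rule: mspan.induct) (auto intro: mspan.intros)
qed

lemma mspan_shift: "w \<in> mspan T \<Longrightarrow> a < m \<Longrightarrow> z a \<odot>\<^sub>M w \<in> mspan (incr a ` T)"
proof (induction rule: mspan.induct)
  case zero
  then show ?case by (simp add: mspan.zero)
next
  case (add \<alpha> x w)
  have "z a \<odot>\<^sub>M (zmon \<alpha> \<odot>\<^sub>M x \<oplus>\<^sub>M w) = zmon (incr a \<alpha>) \<odot>\<^sub>M x \<oplus>\<^sub>M z a \<odot>\<^sub>M w"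
    using add mspan_carr[of w] by (simp add: zmon_incr smult_r_distr smult_assoc1)
  then show ?case using add by (simp add: mspan.add)
qed

lemma mspan_split:
  assumes "w \<in> mspan T"
  shows "\<exists>x\<in>carrier M. \<exists>v\<in>mspan (T - {\<alpha>}). w = zmon \<alpha> \<odot>\<^sub>M x \<oplus>\<^sub>M v"
  using assms
proof induction
  case zero
  show ?case by (intro bexI[of _ "\<zero>\<^sub>M"]) (auto intro: mspan.zero)
next
  case (add \<beta> y w)
  then obtain x v where xv: "x \<in> carrier M" "v \<in> mspan (T - {\<alpha>})" "w = zmon \<alpha> \<odot>\<^sub>M x \<oplus>\<^sub>M v" by blast
  note v = mspan_carr[OF xv(2)]
  show ?case
  proof (cases "\<beta> = \<alpha>")
    case True
    have "zmon \<beta> \<odot>\<^sub>M y \<oplus>\<^sub>M w = zmon \<alpha> \<odot>\<^sub>M (y \<oplus>\<^sub>M x) \<oplus>\<^sub>M v"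
      unfolding True xv(3) using add.hyps xv(1) v by (simp add: smult_r_distr M.a_assoc)
    then show ?thesis using add.hyps xv by blast
  next
    case False
    have "zmon \<beta> \<odot>\<^sub>M y \<oplus>\<^sub>M w = zmon \<alpha> \<odot>\<^sub>M x \<oplus>\<^sub>M (zmon \<beta> \<odot>\<^sub>M y \<oplus>\<^sub>M v)"
      unfolding xv(3) using add.hyps xv(1) v by (simp add: M.a_lcomm)
    moreover have "zmon \<beta> \<odot>\<^sub>M y \<oplus>\<^sub>M v \<in> mspan (T - {\<alpha>})"
      using add.hyps False xv by (intro mspan.add) auto
    ultimately show ?thesis using xv by blast
  qed
qed

text \<open>A homogeneous submodule of \<open>M[t\<^sub>1, \<dots>, t\<^sub>s]\<close> over the multi-Rees algebra, given by its components.\<close>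

definition stable :: "((nat \<Rightarrow> nat) \<Rightarrow> 'c set) \<Rightarrow> bool" where
  "stable A \<longleftrightarrow> (\<forall>u. subm (A u)) \<and>
     (\<forall>u\<in>vecs s. \<forall>a<m. \<forall>x\<in>A u. z a \<odot>\<^sub>M x \<in> A (incr (g a) u))"

text \<open>The coefficients \<open>x\<close> for which \<open>z\<^bsup>\<alpha>\<^esup>x\<close> is the leading term of an element of \<open>A\<close> of the same degree.
  A representation of an element of \<open>M\<close> as a combination of monomials in the generators is not
  unique, so all of them are admitted.\<close>

definition lead :: "((nat \<Rightarrow> nat) \<Rightarrow> 'c set) \<Rightarrow> (nat \<Rightarrow> nat) \<Rightarrow> 'c set" where
  "lead A \<alpha> = {x \<in> carrier M. \<exists>w\<in>mspan {\<beta> \<in> exponents_of (multidegree \<alpha>). lex_less \<beta> \<alpha>}. zmon \<alpha> \<odot>\<^sub>M x \<oplus>\<^sub>M w \<in> A (multidegree \<alpha>)}"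

lemma subm_lead:
  assumes A: "stable A" shows "subm (lead A \<alpha>)"
proof (rule submI)
  let ?V = "mspan {\<beta> \<in> exponents_of (multidegree \<alpha>). lex_less \<beta> \<alpha>}"
  have sA: "subm (A (multidegree \<alpha>))" using A by (simp add: stable_def)
  note sV = subm_mspan[of "{\<beta> \<in> exponents_of (multidegree \<alpha>). lex_less \<beta> \<alpha>}"]
  show "lead A \<alpha> \<subseteq> carrier M" by (auto simp: lead_def)
  show "\<zero>\<^sub>M \<in> lead A \<alpha>"
    using subm_zero[OF sA] by (auto simp: lead_def intro!: bexI[of _ "\<zero>\<^sub>M"] mspan.zero)
  fix x y assume "x \<in> lead A \<alpha>" "y \<in> lead A \<alpha>"
  then obtain v w where vw: "x \<in> carrier M" "v \<in> ?V" "zmon \<alpha> \<odot>\<^sub>M x \<oplus>\<^sub>M v \<in> A (multidegree \<alpha>)"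
    "y \<in> carrier M" "w \<in> ?V" "zmon \<alpha> \<odot>\<^sub>M y \<oplus>\<^sub>M w \<in> A (multidegree \<alpha>)" by (auto simp: lead_def)
  have "zmon \<alpha> \<odot>\<^sub>M (x \<oplus>\<^sub>M y) \<oplus>\<^sub>M (v \<oplus>\<^sub>M w) = (zmon \<alpha> \<odot>\<^sub>M x \<oplus>\<^sub>M v) \<oplus>\<^sub>M (zmon \<alpha> \<odot>\<^sub>M y \<oplus>\<^sub>M w)"
    using vw mspan_carr by (simp add: smult_r_distr M.a_ac)
  then show "x \<oplus>\<^sub>M y \<in> lead A \<alpha>"
    using vw subm_add[OF sA] subm_add[OF sV] by (auto simp: lead_def intro!: bexI[of _ "v \<oplus>\<^sub>M w"])
next
  let ?V = "mspan {\<beta> \<in> exponents_of (multidegree \<alpha>). lex_less \<beta> \<alpha>}"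
  have sA: "subm (A (multidegree \<alpha>))" using A by (simp add: stable_def)
  note sV = subm_mspan[of "{\<beta> \<in> exponents_of (multidegree \<alpha>). lex_less \<beta> \<alpha>}"]
  fix r x assume r: "r \<in> carrier R" and "x \<in> lead A \<alpha>"
  then obtain v where v: "x \<in> carrier M" "v \<in> ?V" "zmon \<alpha> \<odot>\<^sub>M x \<oplus>\<^sub>M v \<in> A (multidegree \<alpha>)" by (auto simp: lead_def)
  have "zmon \<alpha> \<odot>\<^sub>M (r \<odot>\<^sub>M x) \<oplus>\<^sub>M r \<odot>\<^sub>M v = r \<odot>\<^sub>M (zmon \<alpha> \<odot>\<^sub>M x \<oplus>\<^sub>M v)"
    using v r mspan_carr by (simp add: smult_r_distr smult_assoc1[symmetric] R.m_comm)
  then show "r \<odot>\<^sub>M x \<in> lead A \<alpha>"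
    using v r subm_smult[OF sA] subm_smult[OF sV] by (auto simp: lead_def intro!: bexI[of _ "r \<odot>\<^sub>M v"])
qed

text \<open>Multiply by \<open>z a\<close> an element with leading term \<open>z\<^bsup>\<alpha>\<^esup>x\<close>.\<close>

lemma lead_incr:
  assumes A: "stable A" and a: "a < m" and \<alpha>: "\<alpha> \<in> exponents m"
  shows "lead A \<alpha> \<subseteq> lead A (incr a \<alpha>)"
proof
  fix x assume "x \<in> lead A \<alpha>"
  then obtain w where w: "x \<in> carrier M" "w \<in> mspan {\<beta> \<in> exponents_of (multidegree \<alpha>). lex_less \<beta> \<alpha>}"
    "zmon \<alpha> \<odot>\<^sub>M x \<oplus>\<^sub>M w \<in> A (multidegree \<alpha>)" by (auto simp: lead_def)
  have "z a \<odot>\<^sub>M w \<in> mspan (incr a ` {\<beta> \<in> exponents_of (multidegree \<alpha>). lex_less \<beta> \<alpha>})" using mspan_shift w a by blast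
  moreover have "incr a ` {\<beta> \<in> exponents_of (multidegree \<alpha>). lex_less \<beta> \<alpha>} \<subseteq> {\<beta> \<in> exponents_of (multidegree (incr a \<alpha>)). lex_less \<beta> (incr a \<alpha>)}"
    using a by (auto simp: exponents_of_def multidegree_incr incr_exponents lex_less_incr)
  ultimately have "z a \<odot>\<^sub>M w \<in> mspan {\<beta> \<in> exponents_of (multidegree (incr a \<alpha>)). lex_less \<beta> (incr a \<alpha>)}"
    using mspan_mono by blast
  moreover have "z a \<odot>\<^sub>M (zmon \<alpha> \<odot>\<^sub>M x \<oplus>\<^sub>M w) \<in> A (multidegree (incr a \<alpha>))"
    using A w(3) a multidegree_vecs unfolding stable_def multidegree_incr[OF a] by blast
  moreover have "z a \<odot>\<^sub>M (zmon \<alpha> \<odot>\<^sub>M x \<oplus>\<^sub>M w) = zmon (incr a \<alpha>) \<odot>\<^sub>M x \<oplus>\<^sub>M z a \<odot>\<^sub>M w"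
    using w a mspan_carr[OF w(2)] by (simp add: zmon_incr smult_r_distr smult_assoc1)
  ultimately show "x \<in> lead A (incr a \<alpha>)" using w(1) by (auto simp: lead_def)
qed

lemma lead_mono:
  assumes A: "stable A" and "\<alpha> \<in> exponents m" "\<beta> \<in> exponents m" "\<And>a. a < m \<Longrightarrow> \<alpha> a \<le> \<beta> a"
  shows "lead A \<alpha> \<subseteq> lead A \<beta>"
  using assms(2-4)
proof (induction "\<Sum>a<m. \<beta> a - \<alpha> a" arbitrary: \<alpha>)
  case 0
  have "\<beta> = \<alpha>"
  proof
    fix a show "\<beta> a = \<alpha> a"
      using 0 by (cases "a < m") (auto simp: exponents_def intro!: le_antisym)
  qed
  then show ?case by simp
next
  case (Suc n)
  then obtain a where a: "a < m" "\<alpha> a < \<beta> a"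
    by (metis (no_types, lifting) lessThan_iff nat.distinct(1) sum.neutral zero_less_diff bot_nat_0.not_eq_extremum)
  have "n = (\<Sum>b<m. \<beta> b - incr a \<alpha> b)"
  proof -
    have "(\<Sum>b<m. \<beta> b - \<alpha> b) = (\<beta> a - \<alpha> a) + (\<Sum>b\<in>{..<m}-{a}. \<beta> b - \<alpha> b)"
      using a by (intro sum.remove) auto
    moreover have "(\<Sum>b<m. \<beta> b - incr a \<alpha> b) = (\<beta> a - incr a \<alpha> a) + (\<Sum>b\<in>{..<m}-{a}. \<beta> b - incr a \<alpha> b)"
      using a by (intro sum.remove) auto
    moreover have "(\<Sum>b\<in>{..<m}-{a}. \<beta> b - incr a \<alpha> b) = (\<Sum>b\<in>{..<m}-{a}. \<beta> b - \<alpha> b)"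
      by (intro sum.cong) (auto simp: incr_def)
    ultimately show ?thesis using Suc.hyps(2) a by (simp add: incr_def)
  qed
  then have "lead A (incr a \<alpha>) \<subseteq> lead A \<beta>"
    using Suc.prems a incr_exponents[OF a(1) Suc.prems(1)] by (intro Suc.hyps(1)) (auto simp: incr_def)
  then show ?case using lead_incr[OF A a(1) Suc.prems(1)] by blast
qed

text \<open>If the submodule of leading coefficients changes in direction \<open>a\<close> at exponents with
  arbitrarily large \<open>a\<close>-th coordinate, Dickson's lemma arranges them in an increasing sequence, and
  the leading coefficients along it form a chain of submodules that never becomes stationary.\<close>

lemma lead_stabilizes:
  assumes noeth: "noetherian_ring R" and fg: "fin_gen_module R M" and A: "stable A"
  shows "\<exists>b. \<forall>a<m. \<forall>\<alpha>\<in>exponents m. b \<le> \<alpha> a \<longrightarrow> lead A (incr a \<alpha>) = lead A \<alpha>"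
proof -
  have "\<exists>b. \<forall>\<alpha>\<in>exponents m. b \<le> \<alpha> a \<longrightarrow> lead A (incr a \<alpha>) = lead A \<alpha>" if a: "a < m" for a
  proof (rule ccontr)
    assume "\<nexists>b. \<forall>\<alpha>\<in>exponents m. b \<le> \<alpha> a \<longrightarrow> lead A (incr a \<alpha>) = lead A \<alpha>"
    then have "\<forall>b. \<exists>\<alpha>\<in>exponents m. b \<le> \<alpha> a \<and> lead A (incr a \<alpha>) \<noteq> lead A \<alpha>" by blast
    then obtain F where F: "\<And>b. F b \<in> exponents m" "\<And>b. b \<le> F b a" "\<And>b. lead A (incr a (F b)) \<noteq> lead A (F b)"
      by metis
    obtain r where r: "strict_mono r" "\<forall>a<m. incseq (\<lambda>k. F (r k) a)" using dickson_subseq by blast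
    have up: "lead A (F (r i)) \<subseteq> lead A (F (r (Suc i)))" for i
      using r(2) by (intro lead_mono A F) (auto simp: incseq_def)
    obtain k where k: "\<forall>i\<ge>k. lead A (F (r i)) = lead A (F (r k))"
      using submodules_stabilize[where F = "\<lambda>i. lead A (F (r i))", OF noeth fg subm_lead[OF A] up] by (rule exE)
    \<comment> \<open>Late enough for the chain to be stationary and for coordinate \<open>a\<close> to have grown past \<open>F (r k)\<close>.\<close>
    define i where "i = max k (Suc (F (r k) a))"
    have "F (r k) a < i" by (simp add: i_def)
    also have "i \<le> r i" using r(1) by (rule strict_mono_imp_increasing)
    also have "\<dots> \<le> F (r i) a" by (rule F(2))
    finally have lt: "F (r k) a < F (r i) a" .
    have "incr a (F (r k)) b \<le> F (r i) b" if "b < m" for b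
      using r(2) that lt by (auto simp: incr_def incseq_def i_def)
    then have "lead A (incr a (F (r k))) \<subseteq> lead A (F (r i))"
      by (intro lead_mono A F incr_exponents a)
    moreover have "lead A (F (r i)) = lead A (F (r k))" 
      by (rule k[rule_format]) (simp add: i_def)
    ultimately show False using F(3)[of "r k"] lead_incr[OF A a F(1)[of "r k"]] by blast
  qed
  then obtain b where b: "\<And>a \<alpha>. a < m \<Longrightarrow> \<alpha> \<in> exponents m \<Longrightarrow> b a \<le> \<alpha> a \<Longrightarrow> lead A (incr a \<alpha>) = lead A \<alpha>" by metis
  have "b a \<le> (\<Sum>a<m. b a)" if "a < m" for a using that by (intro member_le_sum) auto
  then show ?thesis using b by (intro exI[of _ "\<Sum>a<m. b a"]) (meson order_trans)
qed

text \<open>In degree \<open>u + e\<^sub>j\<close> with \<open>u\<^sub>j\<close> large, every exponent \<open>\<alpha>\<close> has a large coordinate \<open>a\<close> belonging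
  to \<open>J\<^sub>j\<close>. There the leading coefficients for \<open>\<alpha>\<close> are those for \<open>\<alpha> - e\<^sub>a\<close>, so the leading term
  of an element of \<open>A\<close> is removed by subtracting \<open>z a\<close> times an element of \<open>A\<^sub>u\<close>; repeat. The
  conclusion \<open>A\<^bsub>u+e\<^sub>j\<^esub> \<subseteq> \<Sum>\<^sub>a z\<^sub>a A\<^sub>u\<close> is expressed by the submodules \<open>X\<close> that contain the right-hand side.\<close>

lemma artin_rees:
  assumes noeth: "noetherian_ring R" and fg: "fin_gen_module R M" and A: "stable A"
    and sub: "\<And>u. u \<in> vecs s \<Longrightarrow> A u \<subseteq> mspan (exponents_of u)"
  shows "\<exists>b. \<forall>u\<in>vecs s. \<forall>j\<in>{1..s}. b \<le> u j \<longrightarrow> (\<forall>X. subm X \<longrightarrow>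
    (\<forall>a<m. g a = j \<longrightarrow> (\<forall>x\<in>A u. z a \<odot>\<^sub>M x \<in> X)) \<longrightarrow> A (incr j u) \<subseteq> X)"
proof -
  obtain b where b: "\<And>a \<alpha>. a < m \<Longrightarrow> \<alpha> \<in> exponents m \<Longrightarrow> b \<le> \<alpha> a \<Longrightarrow> lead A (incr a \<alpha>) = lead A \<alpha>"
    using lead_stabilizes[OF noeth fg A] by blast
  show ?thesis
  \<comment> \<open>At most \<open>m\<close> coordinates of an exponent contribute to its degree at \<open>j\<close>; a degree above \<open>m * b\<close> forces one above \<open>b\<close>.\<close>
  proof (intro exI[of _ "m * b"] ballI impI allI)
    fix u j X
    assume u: "u \<in> vecs s" and j: "j \<in> {1..s}" and ub: "m * b \<le> u j" and X: "subm X"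
      and zX: "\<forall>a<m. g a = j \<longrightarrow> (\<forall>x\<in>A u. z a \<odot>\<^sub>M x \<in> X)"
    define u' where "u' = incr j u"
    have u': "u' \<in> vecs s" unfolding u'_def incr_def using u j by (rule vecs_upd)
    have sA: "subm (A v)" for v using A by (simp add: stable_def)
    have "f \<in> X"
      if "T \<subseteq> exponents_of u'" "\<And>\<alpha> \<beta>. \<alpha> \<in> T \<Longrightarrow> \<beta> \<in> exponents_of u' \<Longrightarrow> lex_less \<beta> \<alpha> \<Longrightarrow> \<beta> \<in> T" "f \<in> A u'" "f \<in> mspan T" for T f
      using that
    proof (induction "card T" arbitrary: T f)
      case 0
      have "finite T" using 0 finite_exponents_of finite_subset by blast
      then have "T = {}" using 0 by simp
      then have "f = \<zero>\<^sub>M" using 0(5) by (auto elim: mspan.cases)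
      then show ?case using subm_zero[OF X] by simp
    next
      case (Suc n)
      have fin: "finite T" using Suc.prems(1) finite_exponents_of finite_subset by blast
      have "T \<noteq> {}" using Suc.hyps(2) by auto
      then obtain \<alpha> where \<alpha>: "\<alpha> \<in> T" "\<And>\<beta>. \<beta> \<in> T \<Longrightarrow> \<beta> = \<alpha> \<or> lex_less \<beta> \<alpha>"
        using lex_less_maximum[OF fin] by blast
      have \<alpha>exponents_of: "\<alpha> \<in> exponents m" "multidegree \<alpha> = u'" using \<alpha>(1) Suc.prems(1) by (auto simp: exponents_of_def)
      have T': "T - {\<alpha>} = {\<beta> \<in> exponents_of (multidegree \<alpha>). lex_less \<beta> \<alpha>}"
        using \<alpha> Suc.prems(1,2) lex_less_irrefl by (auto simp: \<alpha>exponents_of(2))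
      obtain x w where xw: "x \<in> carrier M" "w \<in> mspan (T - {\<alpha>})" "f = zmon \<alpha> \<odot>\<^sub>M x \<oplus>\<^sub>M w"
        using mspan_split[OF Suc.prems(4)] by blast
      have "x \<in> lead A \<alpha>"
        unfolding lead_def using xw Suc.prems(3) by (auto simp: T' \<alpha>exponents_of(2))
      have "\<exists>a<m. g a = j \<and> b < \<alpha> a"
      proof (rule ccontr)
        assume "\<not> (\<exists>a<m. g a = j \<and> b < \<alpha> a)"
        then have "\<alpha> a \<le> b" if "a < m" "g a = j" for a using that by (auto simp: not_less)
        then have "multidegree \<alpha> j \<le> (\<Sum>a | a < m \<and> g a = j. b)" unfolding multidegree_def by (intro sum_mono) auto
        also have "\<dots> \<le> (\<Sum>a<m. b)" by (intro sum_mono2) auto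
        finally show False using ub by (simp add: \<alpha>exponents_of(2) u'_def incr_def)
      qed
      then obtain a where a: "a < m" "g a = j" "b < \<alpha> a" by blast
      define \<alpha>' where "\<alpha>' = \<alpha>(a := \<alpha> a - 1)"
      have incr\<alpha>': "incr a \<alpha>' = \<alpha>" using a(3) by (auto simp: incr_def \<alpha>'_def)
      have \<alpha>'m: "\<alpha>' \<in> exponents m" using \<alpha>exponents_of(1) by (auto simp: exponents_def \<alpha>'_def)
      have multidegree\<alpha>': "multidegree \<alpha>' = u"
        using multidegree_incr[OF a(1), of \<alpha>'] incr_inj[of j] unfolding incr\<alpha>' \<alpha>exponents_of(2) u'_def a(2) by metis
      have "x \<in> lead A \<alpha>'"
      proof -
        have "b \<le> \<alpha>' a" using a(3) by (simp add: \<alpha>'_def)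
        from b[OF a(1) \<alpha>'m this] show ?thesis using \<open>x \<in> lead A \<alpha>\<close> by (simp only: incr\<alpha>')
      qed
      then obtain w' where w': "w' \<in> mspan {\<beta> \<in> exponents_of u. lex_less \<beta> \<alpha>'}" "zmon \<alpha>' \<odot>\<^sub>M x \<oplus>\<^sub>M w' \<in> A u"
        by (auto simp: lead_def multidegree\<alpha>')
      define y where "y = z a \<odot>\<^sub>M (zmon \<alpha>' \<odot>\<^sub>M x \<oplus>\<^sub>M w')"
      have yX: "y \<in> X" using zX a w'(2) by (simp add: y_def)
      have yA: "y \<in> A u'" using A w'(2) a u unfolding y_def u'_def stable_def by blast
      have y: "y = zmon \<alpha> \<odot>\<^sub>M x \<oplus>\<^sub>M z a \<odot>\<^sub>M w'"
        using a(1) xw(1) mspan_carr[OF w'(1)] zmon_incr[OF a(1), of \<alpha>']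
        by (simp add: y_def incr\<alpha>' smult_r_distr smult_assoc1)
      have "z a \<odot>\<^sub>M w' \<in> mspan (incr a ` {\<beta> \<in> exponents_of u. lex_less \<beta> \<alpha>'})" using mspan_shift w' a by blast
      moreover have "incr a ` {\<beta> \<in> exponents_of u. lex_less \<beta> \<alpha>'} \<subseteq> T - {\<alpha>}"
        unfolding T' using a(1,2) lex_less_incr[of a _ \<alpha>']
        by (auto simp: exponents_of_def multidegree_incr incr_exponents incr\<alpha>' \<alpha>exponents_of(2) u'_def)
      ultimately have w'T: "z a \<odot>\<^sub>M w' \<in> mspan (T - {\<alpha>})" using mspan_mono by blast
      have carr: "w \<in> carrier M" "z a \<odot>\<^sub>M w' \<in> carrier M" "zmon \<alpha> \<odot>\<^sub>M x \<in> carrier M"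
        using mspan_carr[OF xw(2)] mspan_carr[OF w'T] xw(1) by auto
      define h where "h = w \<ominus>\<^sub>M z a \<odot>\<^sub>M w'"
      have hc: "h \<in> carrier M" using carr by (simp add: h_def)
      have yc: "y \<in> carrier M" using carr by (simp add: y)
      have f: "f = y \<oplus>\<^sub>M h"
      proof -
        have "y \<oplus>\<^sub>M h = zmon \<alpha> \<odot>\<^sub>M x \<oplus>\<^sub>M (h \<oplus>\<^sub>M z a \<odot>\<^sub>M w')"
          unfolding y using carr hc by (simp add: M.a_ac)
        then show ?thesis using diff_add_cancel[OF carr(1,2)] by (simp add: xw(3) h_def)
      qed
      have "f \<ominus>\<^sub>M y = h" unfolding f using yc hc by (rule add_diff_cancel_left)
      then have hA: "h \<in> A u'" using subm_diff[OF sA] Suc.prems(3) yA by metis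
      have hW: "h \<in> mspan (T - {\<alpha>})" unfolding h_def by (rule subm_diff[OF subm_mspan xw(2) w'T])
      have "h \<in> X"
      proof (rule Suc.hyps(1))
        show "n = card (T - {\<alpha>})" using Suc.hyps(2) \<alpha>(1) fin by simp
        show "T - {\<alpha>} \<subseteq> exponents_of u'" using Suc.prems(1) by auto
        show "\<beta> \<in> T - {\<alpha>}" if "\<gamma> \<in> T - {\<alpha>}" "\<beta> \<in> exponents_of u'" "lex_less \<beta> \<gamma>" for \<gamma> \<beta>
          using that lex_less_trans[of \<beta> \<gamma> \<alpha>] unfolding T' \<alpha>exponents_of(2) by blast
      qed (rule hA, rule hW)
      then show ?case unfolding f using yX by (intro subm_add[OF X])
    qed
    from this[of "exponents_of u'"] show "A (incr j u) \<subseteq> X" using sub[OF u'] unfolding u'_def by blast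
  qed
qed

section \<open>Hilbert functions of families of submodules\<close>

lemma incr_comm: "incr i (incr j u) = incr j (incr i u)"
  by (auto simp: incr_def)

lemma incr_vecs: "u \<in> vecs s \<Longrightarrow> j \<in> {1..s} \<Longrightarrow> incr j u \<in> vecs s"
  unfolding incr_def by (rule vecs_upd)

text \<open>On the subquotient \<open>A/B\<close>, multiplication by \<open>z a\<close> has kernel \<open>colon_fam A B a\<close> modulo \<open>B\<close>, and
  cokernel \<open>A\<close> modulo \<open>plus_fam A B a\<close>. In degrees whose coordinate \<open>g a\<close> is \<open>0\<close> nothing is hit by
  the multiplication.\<close>

definition colon_fam where "colon_fam A B a u = {x \<in> A u. z a \<odot>\<^sub>M x \<in> B (incr (g a) u)}"

definition plus_fam where "plus_fam A B a u = B u <+>\<^sub>M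
  (if u (g a) = 0 then {\<zero>\<^sub>M} else (\<lambda>x. z a \<odot>\<^sub>M x) ` A (u(g a := u (g a) - 1)))"

lemma subm_trivial: "subm {\<zero>\<^sub>M}"
  by (rule submI) auto

lemma stable_subm: "stable A \<Longrightarrow> subm (A u)"
  by (simp add: stable_def)

lemma stable_mult: "stable A \<Longrightarrow> u \<in> vecs s \<Longrightarrow> a < m \<Longrightarrow> x \<in> A u \<Longrightarrow> z a \<odot>\<^sub>M x \<in> A (incr (g a) u)"
  by (simp add: stable_def)

lemma z_comm: "a < m \<Longrightarrow> b < m \<Longrightarrow> x \<in> carrier M \<Longrightarrow> z a \<odot>\<^sub>M (z b \<odot>\<^sub>M x) = z b \<odot>\<^sub>M (z a \<odot>\<^sub>M x)"
  by (metis R.m_comm smult_assoc1 z_closed)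

lemma stable_colon:
  assumes A: "stable A" and B: "stable B" and a: "a < m"
  shows "stable (colon_fam A B a)"
  unfolding stable_def
proof (intro conjI allI ballI impI)
  show "subm (colon_fam A B a u)" for u
    unfolding colon_fam_def by (intro subm_colon stable_subm[OF A] stable_subm[OF B] z_closed a)
  fix u b x assume u: "u \<in> vecs s" and b: "b < m" and x: "x \<in> colon_fam A B a u"
  have xc: "x \<in> carrier M" using x subm_carr[OF stable_subm[OF A]] by (auto simp: colon_fam_def)
  have "z b \<odot>\<^sub>M (z a \<odot>\<^sub>M x) \<in> B (incr (g b) (incr (g a) u))"
    using x stable_mult[OF B incr_vecs[OF u g_range[OF a]] b] by (simp add: colon_fam_def)
  then show "z b \<odot>\<^sub>M x \<in> colon_fam A B a (incr (g b) u)"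
    using x stable_mult[OF A u b] z_comm[OF a b xc] by (auto simp: colon_fam_def incr_comm)
qed

lemma stable_plus:
  assumes A: "stable A" and B: "stable B" and a: "a < m"
  shows "stable (plus_fam A B a)"
  unfolding stable_def
proof (intro conjI allI ballI impI)
  show "subm (plus_fam A B a u)" for u
    unfolding plus_fam_def
    by (intro subm_plus stable_subm[OF B]) (simp add: subm_smult_image stable_subm[OF A] subm_trivial a)
  fix u b x assume u: "u \<in> vecs s" and b: "b < m" and x: "x \<in> plus_fam A B a u"
  define S where "S u = (if u (g a) = 0 then {\<zero>\<^sub>M} else (\<lambda>x. z a \<odot>\<^sub>M x) ` A (u(g a := u (g a) - 1)))" for u
  have S: "subm (S u)" for u unfolding S_def
    by (simp add: subm_smult_image stable_subm[OF A] subm_trivial a)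
  obtain v w where vw: "v \<in> B u" "w \<in> S u" "x = v \<oplus>\<^sub>M w" using x by (auto simp: plus_fam_def S_def mem_plus)
  have carr: "v \<in> carrier M" "w \<in> carrier M" using vw subm_carr[OF S] subm_carr[OF stable_subm[OF B]] by auto
  have "z b \<odot>\<^sub>M w \<in> S (incr (g b) u)"
  proof (cases "u (g a) = 0")
    case True
    then have "w = \<zero>\<^sub>M" using vw(2) by (simp add: S_def)
    then show ?thesis using subm_zero[OF S] b by simp
  next
    case False
    then obtain y where y: "y \<in> A (u(g a := u (g a) - 1))" "w = z a \<odot>\<^sub>M y" using vw(2) by (auto simp: S_def)
    have yc: "y \<in> carrier M" using y subm_carr[OF stable_subm[OF A]] by blast
    define v where "v = u(g a := u (g a) - 1)"
    have v: "v \<in> vecs s" unfolding v_def using u g_range[OF a] by (rule vecs_upd)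
    have "z b \<odot>\<^sub>M y \<in> A (incr (g b) v)"
      using y(1) unfolding v_def[symmetric] by (rule stable_mult[OF A v b])
    moreover have "incr (g b) v = (incr (g b) u)(g a := incr (g b) u (g a) - 1)"
      using False unfolding v_def incr_def by (intro ext) auto
    ultimately have "z a \<odot>\<^sub>M (z b \<odot>\<^sub>M y) \<in> S (incr (g b) u)"
      using False by (simp add: S_def incr_def)
    then show ?thesis unfolding y(2) z_comm[OF a b yc] .
  qed
  moreover have "z b \<odot>\<^sub>M v \<in> B (incr (g b) u)" by (rule stable_mult[OF B u b vw(1)])
  ultimately show "z b \<odot>\<^sub>M x \<in> plus_fam A B a (incr (g b) u)"
    using carr b by (auto simp: vw(3) plus_fam_def S_def[symmetric] mem_plus smult_r_distr)
qed

lemma plus_fam_incr: "plus_fam A B a (incr (g a) u) = B (incr (g a) u) <+>\<^sub>M (\<lambda>x. z a \<odot>\<^sub>M x) ` A u"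
  by (simp add: plus_fam_def incr_def)

lemma plus_fam_le:
  assumes A: "stable A" and B: "B u \<subseteq> A u" and a: "a < m" and u: "u \<in> vecs s"
  shows "plus_fam A B a u \<subseteq> A u"
  unfolding plus_fam_def
proof (intro plus_least stable_subm[OF A] B)
  show "(if u (g a) = 0 then {\<zero>\<^sub>M} else (\<lambda>x. z a \<odot>\<^sub>M x) ` A (u(g a := u (g a) - 1))) \<subseteq> A u"
  proof (cases "u (g a) = 0")
    case False
    define v where "v = u(g a := u (g a) - 1)"
    have "v \<in> vecs s" unfolding v_def using u g_range[OF a] by (rule vecs_upd)
    moreover have "incr (g a) v = u" using False by (auto simp: v_def incr_def)
    ultimately have "(\<lambda>x. z a \<odot>\<^sub>M x) ` A v \<subseteq> A u" using stable_mult[OF A _ a, of v] by auto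
    then show ?thesis using False by (simp add: v_def)
  qed (use subm_zero[OF stable_subm[OF A]] in auto)
qed

text \<open>The exact sequence of kernel and cokernel of multiplication by \<open>z a\<close> on \<open>A/B\<close>:
  the difference of the lengths of target and source equals that of cokernel and kernel.\<close>

lemma colon_plus_difference:
  assumes A: "stable A" and B: "stable B" and BA: "\<And>u. u \<in> vecs s \<Longrightarrow> B u \<subseteq> A u"
    and fin: "\<And>u. u \<in> vecs s \<Longrightarrow> len (B u) (A u) \<noteq> \<infinity>" and a: "a < m" and u: "u \<in> vecs s"
  shows "rlen (B (incr (g a) u)) (A (incr (g a) u)) - rlen (B u) (A u) =
    rlen (plus_fam A B a (incr (g a) u)) (A (incr (g a) u)) - rlen (B u) (colon_fam A B a u)"
proof -
  let ?v = "incr (g a) u"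
  note sub = stable_subm[OF A] stable_subm[OF B] stable_subm[OF stable_plus[OF A B a]]
    stable_subm[OF stable_colon[OF A B a]]
  have v: "?v \<in> vecs s" using u g_range[OF a] by (rule incr_vecs)
  have "B ?v \<subseteq> plus_fam A B a ?v"
    unfolding plus_fam_incr by (intro plus_upper1 subm_smult_image sub(1,2) z_closed a)
  then have 1: "rlen (B ?v) (A ?v) = rlen (B ?v) (plus_fam A B a ?v) + rlen (plus_fam A B a ?v) (A ?v)"
    by (intro rlen_add sub fin v plus_fam_le A BA a)
  have "B u \<subseteq> colon_fam A B a u"
    using BA[OF u] stable_mult[OF B u a] by (auto simp: colon_fam_def)
  then have 2: "rlen (B u) (A u) = rlen (B u) (colon_fam A B a u) + rlen (colon_fam A B a u) (A u)"
    by (intro rlen_add sub fin u) (auto simp: colon_fam_def)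
  have "rlen (colon_fam A B a u) (A u) = rlen (B ?v) (plus_fam A B a ?v)"
    unfolding rlen_def plus_fam_incr colon_fam_def
    using len_smult[OF sub(1,2) z_closed[OF a], of u ?v] by simp
  with 1 2 show ?thesis by simp
qed

text \<open>Induction on the set \<open>K\<close> of generators that may act nontrivially on \<open>A/B\<close>. If every
  \<open>J\<^sub>j\<close> has a generator in \<open>K\<close>, then all differences are eventually polynomial, since the kernel and the
  cokernel are annihilated by one generator more. Otherwise \<open>J\<^sub>j A\<^sub>u \<subseteq> B\<^bsub>u+e\<^sub>j\<^esub>\<close> for some \<open>j\<close>, and
  \<open>A\<close> equals \<open>B\<close> in all degrees with large \<open>j\<close>-th coordinate.\<close>

theorem hilbert_polynomial:
  assumes noeth: "noetherian_ring R" and fg: "fin_gen_module R M"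
    and "finite K" and "stable A" and "stable B"
    and "\<And>u. u \<in> vecs s \<Longrightarrow> B u \<subseteq> A u"
    and "\<And>u. u \<in> vecs s \<Longrightarrow> A u \<subseteq> mspan (exponents_of u)"
    and "\<And>u. u \<in> vecs s \<Longrightarrow> len (B u) (A u) \<noteq> \<infinity>"
    and "\<And>a u x. a < m \<Longrightarrow> a \<notin> K \<Longrightarrow> u \<in> vecs s \<Longrightarrow> x \<in> A u \<Longrightarrow> z a \<odot>\<^sub>M x \<in> B (incr (g a) u)"
    and "\<And>a. a \<in> K \<Longrightarrow> a < m"
  shows "eventually_poly s (\<lambda>u. rlen (B u) (A u))"
  using assms(3-)
proof (induction K arbitrary: A B rule: finite_psubset_induct)
  case (psubset K A B)
  note A = psubset.prems(1) and B = psubset.prems(2) and BA = psubset.prems(3)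
    and AW = psubset.prems(4) and fin = psubset.prems(5) and kill = psubset.prems(6)
  show ?case
  proof (cases "\<exists>j\<in>{1..s}. \<forall>a\<in>K. g a \<noteq> j")
    case True
    then obtain j where j: "j \<in> {1..s}" "\<forall>a\<in>K. g a \<noteq> j" by blast
    obtain b where b': "\<forall>u\<in>vecs s. \<forall>j\<in>{1..s}. b \<le> u j \<longrightarrow> (\<forall>X. subm X \<longrightarrow>
        (\<forall>a<m. g a = j \<longrightarrow> (\<forall>x\<in>A u. z a \<odot>\<^sub>M x \<in> X)) \<longrightarrow> A (incr j u) \<subseteq> X)"
      using artin_rees[OF noeth fg A AW] by (rule exE)
    have b: "A (incr j u) \<subseteq> X" if "u \<in> vecs s" "b \<le> u j" "subm X"
        "\<forall>a<m. g a = j \<longrightarrow> (\<forall>x\<in>A u. z a \<odot>\<^sub>M x \<in> X)" for u X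
      using b'[rule_format, OF that(1) j(1) that(2,3)] that(4) by simp
    have "rlen (B u) (A u) = 0" if u: "u \<in> vecs s" and ub: "\<forall>j\<in>{1..s}. Suc b \<le> u j" for u
    proof -
      define v where "v = u(j := u j - 1)"
      have uj: "Suc b \<le> u j" using ub j(1) by blast
      have v: "v \<in> vecs s" unfolding v_def using u j(1) by (rule vecs_upd)
      have iv: "incr j v = u" using uj by (auto simp: incr_def v_def)
      have "A (incr j v) \<subseteq> B (incr j v)"
      proof (rule b[OF v _ stable_subm[OF B]])
        show "b \<le> v j" using uj by (simp add: v_def)
        show "\<forall>a<m. g a = j \<longrightarrow> (\<forall>x\<in>A v. z a \<odot>\<^sub>M x \<in> B (incr j v))"
          using kill[OF _ _ v] j(2) by blast
      qed
      then have "A u = B u" using BA[OF u] by (simp add: iv)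
      then show ?thesis by (simp add: rlen_def zero_enat_def)
    qed
    then show ?thesis unfolding eventually_poly_def using polyfun_const[of s 0] by blast
  next
    case False
    show ?thesis
    proof (rule eventually_poly_of_differences)
      fix j assume j: "j \<in> {1..s}"
      then obtain a where a: "a \<in> K" "g a = j" using False by blast
      have am: "a < m" using psubset.prems(7) a by blast
      have sub: "K - {a} \<subset> K" using a by auto
      note sC = stable_colon[OF A B am] and sP = stable_plus[OF A B am]
      have Bcolon: "B u \<subseteq> colon_fam A B a u" if "u \<in> vecs s" for u
        using BA that stable_mult[OF B that am] by (auto simp: colon_fam_def)
      have Bplus: "B u \<subseteq> plus_fam A B a u" for u
        unfolding plus_fam_def
        by (intro plus_upper1 stable_subm[OF B]) (simp add: subm_smult_image stable_subm[OF A] subm_trivial am)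
      have "eventually_poly s (\<lambda>u. rlen (plus_fam A B a u) (A u))"
      proof (rule psubset.IH[OF sub A sP])
        show "len (plus_fam A B a u) (A u) \<noteq> \<infinity>" if "u \<in> vecs s" for u
          using fin[OF that] len_mono[OF Bplus[of u] order_refl, of "A u"] by (metis infinity_ileE not_infinity_eq)
        show "z b \<odot>\<^sub>M x \<in> plus_fam A B a (incr (g b) u)"
          if b: "b < m" "b \<notin> K - {a}" and u: "u \<in> vecs s" and x: "x \<in> A u" for b u x
        proof (cases "b = a")
          case True
          have "(\<lambda>x. z a \<odot>\<^sub>M x) ` A u \<subseteq> plus_fam A B a (incr (g a) u)"
            unfolding plus_fam_incr by (intro plus_upper2 subm_smult_image stable_subm[OF A] stable_subm[OF B] z_closed am)
          then show ?thesis using True x by auto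
        next
          case False
          then show ?thesis using kill[OF b(1) _ u x] b(2) Bplus by blast
        qed
        show "plus_fam A B a u \<subseteq> A u" if "u \<in> vecs s" for u
          using plus_fam_le[where A = A and B = B and u = u, OF A BA[OF that] am that] .
      qed (use AW psubset.prems(7) in auto)
      moreover have "eventually_poly s (\<lambda>u. rlen (B u) (colon_fam A B a u))"
      proof (rule psubset.IH[OF sub sC B Bcolon])
        have le: "colon_fam A B a u \<subseteq> A u" for u by (auto simp: colon_fam_def)
        show "colon_fam A B a u \<subseteq> mspan (exponents_of u)" if "u \<in> vecs s" for u using le AW[OF that] by blast
        show "len (B u) (colon_fam A B a u) \<noteq> \<infinity>" if "u \<in> vecs s" for u
          using fin[OF that] len_mono[OF order_refl le[of u], of "B u"] by (metis infinity_ileE not_infinity_eq)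
        show "z b \<odot>\<^sub>M x \<in> B (incr (g b) u)"
          if b: "b < m" "b \<notin> K - {a}" and u: "u \<in> vecs s" and x: "x \<in> colon_fam A B a u" for b u x
          using kill[OF b(1) _ u, of x] b(2) x by (cases "b = a") (auto simp: colon_fam_def)
      qed (use psubset.prems(7) in auto)
      ultimately have "eventually_poly s (\<lambda>u. rlen (plus_fam A B a (incr j u)) (A (incr j u)) - rlen (B u) (colon_fam A B a u))"
        unfolding incr_def by (intro eventually_poly_diff eventually_poly_shift[OF _ j])
      then show "eventually_poly s (\<lambda>u. rlen (B (u(j := Suc (u j)))) (A (u(j := Suc (u j)))) - rlen (B u) (A u))"
        unfolding incr_def[symmetric]
        by (rule eventually_poly_shift_const[rotated])
          (use colon_plus_difference[OF A B BA fin am] a(2) in auto)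
    qed
  qed
qed

end

section \<open>Ideals of Noetherian rings\<close>

lemma (in ring) ideal_coset_prime:
  assumes "cring R" and I: "ideal I R" and P: "primeideal P R" and IP: "I \<subseteq> P"
  shows "primeideal ((+>) I ` P) (R Quot I)" and "\<And>a. a \<in> carrier R \<Longrightarrow> I +> a \<in> (+>) I ` P \<longleftrightarrow> a \<in> P"
proof -
  interpret I: ideal I R by (rule I)
  interpret P: primeideal P R by (rule P)
  let ?Q = "(+>) I ` P"
  have Q: "ideal ?Q (R Quot I)" by (rule ring_ideal_imp_quot_ideal[OF I P.is_ideal])
  interpret Q: ideal ?Q "R Quot I" by (rule Q)
  have "\<Union>?Q = P" using ideal_incl_iff[OF I P.is_ideal] IP by auto
  then show mem: "I +> a \<in> ?Q \<longleftrightarrow> a \<in> P" if "a \<in> carrier R" for a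
    using canonical_proj_vimage_mem_iff[OF I Q.a_subset that] by simp
  show "primeideal ?Q (R Quot I)"
  proof (rule primeidealI[OF Q I.quotient_is_cring[OF assms(1)]])
    obtain a where "a \<in> carrier R" "a \<notin> P" using P.I_notcarr P.Icarr by blast
    then have "I +> a \<in> carrier (R Quot I)" "I +> a \<notin> ?Q"
      using mem by (auto simp: FactRing_def A_RCOSETS_def')
    then show "carrier (R Quot I) \<noteq> ?Q" by blast
  next
    fix X Y assume "X \<in> carrier (R Quot I)" "Y \<in> carrier (R Quot I)" and XY: "X \<otimes>\<^bsub>R Quot I\<^esub> Y \<in> ?Q"
    then obtain x y where xy: "x \<in> carrier R" "X = I +> x" "y \<in> carrier R" "Y = I +> y"
      by (auto simp: FactRing_def A_RCOSETS_def')
    then have "I +> (x \<otimes> y) \<in> ?Q" using XY by (simp add: FactRing_def I.rcoset_mult_add)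
    then have "x \<otimes> y \<in> P" using mem xy by simp
    then show "X \<in> ?Q \<or> Y \<in> ?Q" using P.I_prime xy mem by blast
  qed
qed

definition prime_chain :: "('a, 'r) ring_scheme \<Rightarrow> 'a set \<Rightarrow> nat \<Rightarrow> bool" where
  "prime_chain R I d \<longleftrightarrow> (\<exists>P :: nat \<Rightarrow> 'a set. (\<forall>i\<le>d. primeideal (P i) R \<and> I \<subseteq> P i) \<and> (\<forall>i<d. P i \<subset> P (Suc i)))"

lemma prime_chain_mono: "prime_chain R J d \<Longrightarrow> I \<subseteq> J \<Longrightarrow> prime_chain R I d"
  unfolding prime_chain_def by blast

text \<open>Chains of primes containing \<open>I\<close> descend to the quotient ring.\<close>

lemma (in ring) prime_chain_le_krull_dim:
  assumes "cring R" and I: "ideal I R" and "prime_chain R I d"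
  shows "enat d \<le> krull_dim (R Quot I)"
proof -
  obtain P where P: "\<And>i. i \<le> d \<Longrightarrow> primeideal (P i) R" "\<And>i. i \<le> d \<Longrightarrow> I \<subseteq> P i" "\<And>i. i < d \<Longrightarrow> P i \<subset> P (Suc i)"
    using assms(3) unfolding prime_chain_def by blast
  let ?Q = "\<lambda>i. (+>) I ` P i"
  have Q: "primeideal (?Q i) (R Quot I)" "\<And>a. a \<in> carrier R \<Longrightarrow> I +> a \<in> ?Q i \<longleftrightarrow> a \<in> P i" if "i \<le> d" for i
    using ideal_coset_prime[OF assms(1) I P(1)[OF that] P(2)[OF that]] by auto
  have "?Q i \<subset> ?Q (Suc i)" if i: "i < d" for i
  proof
    show "?Q i \<subseteq> ?Q (Suc i)" using P(3)[OF i] by auto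
    obtain a where a: "a \<in> P (Suc i)" "a \<notin> P i" using P(3)[OF i] by blast
    interpret S: primeideal "P (Suc i)" R using P(1) i by simp
    have "I +> a \<notin> ?Q i" using Q(2)[of i a] a i S.Icarr by simp
    then show "?Q i \<noteq> ?Q (Suc i)" using a by blast
  qed
  then have "\<exists>Q. (\<forall>i\<le>d. primeideal (Q i) (R Quot I)) \<and> (\<forall>i<d. Q i \<subset> Q (Suc i))"
    using Q(1) by (intro exI[of _ ?Q]) blast
  then show ?thesis unfolding krull_dim_def by (intro Sup_upper) simp
qed

context cring
begin

lemma mem_ideal_plus: "z \<in> I <+> J \<longleftrightarrow> (\<exists>a\<in>I. \<exists>b\<in>J. z = a \<oplus> b)"
  by (auto simp: set_add_def')

definition adjoin :: "'a set \<Rightarrow> 'a \<Rightarrow> 'a set" where "adjoin I a = I <+> PIdl a"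

lemma mem_adjoin: "z \<in> adjoin I a \<longleftrightarrow> (\<exists>i\<in>I. \<exists>t\<in>carrier R. z = i \<oplus> t \<otimes> a)"
  unfolding adjoin_def mem_ideal_plus by (auto simp: cgenideal_def)

lemma adjoin_ideal: "ideal I R \<Longrightarrow> a \<in> carrier R \<Longrightarrow> ideal (adjoin I a) R"
  unfolding adjoin_def by (intro add_ideals cgenideal_ideal)

lemma adjoin_upper:
  assumes I: "ideal I R" and a: "a \<in> carrier R" shows "I \<subseteq> adjoin I a" "a \<in> adjoin I a"
proof -
  interpret I: ideal I R by (rule I)
  show "I \<subseteq> adjoin I a"
  proof
    fix i assume "i \<in> I"
    then show "i \<in> adjoin I a" unfolding mem_adjoin using a I.Icarr by (intro bexI[of _ i] bexI[of _ \<zero>]) auto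
  qed
  show "a \<in> adjoin I a"
    unfolding mem_adjoin using a I.zero_closed by (intro bexI[of _ \<zero>] bexI[of _ \<one>]) auto
qed

lemma adjoin_psubset: "ideal I R \<Longrightarrow> a \<in> carrier R \<Longrightarrow> a \<notin> I \<Longrightarrow> I \<subset> adjoin I a"
  using adjoin_upper by blast

lemma colon_ideal:
  assumes L: "ideal L R" and z: "z \<in> carrier R" shows "ideal {r \<in> carrier R. r \<otimes> z \<in> L} R"
proof -
  interpret L: ideal L R by (rule L)
  show ?thesis
  proof (rule idealI)
    show "subgroup {r \<in> carrier R. r \<otimes> z \<in> L} (add_monoid R)"
    proof (rule add.subgroupI)
      show "{r \<in> carrier R. r \<otimes> z \<in> L} \<noteq> {}" using z L.zero_closed by (auto intro!: exI[of _ \<zero>])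
    qed (use z in \<open>auto simp: l_distr l_minus\<close>)
    fix a x assume a: "a \<in> {r \<in> carrier R. r \<otimes> z \<in> L}" and x: "x \<in> carrier R"
    then have "x \<otimes> a \<otimes> z \<in> L" using z L.I_l_closed by (simp add: m_assoc)
    then show "x \<otimes> a \<in> {r \<in> carrier R. r \<otimes> z \<in> L}" using a x by simp
    then show "a \<otimes> x \<in> {r \<in> carrier R. r \<otimes> z \<in> L}" using a x m_comm by simp
  qed (rule ring_axioms)
qed

abbreviation ideal_pow :: "'a set \<Rightarrow> nat \<Rightarrow> 'a set" where "ideal_pow I n \<equiv> I [^]\<^bsub>ideals_set R\<^esub> n"

lemma ideals_carrier: "carrier (ideals_set R) = {I. ideal I R}"
  and ideals_mult: "I \<otimes>\<^bsub>ideals_set R\<^esub> J = ideal_prod R I J"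
  and ideals_one: "\<one>\<^bsub>ideals_set R\<^esub> = carrier R"
  by (simp_all add: ideals_set_def)

lemma ideal_pow_ideal: "ideal I R \<Longrightarrow> ideal (ideal_pow I n) R"
proof -
  interpret S: comm_monoid "ideals_set R" by (rule ideals_set_is_comm_monoid)
  show "ideal I R \<Longrightarrow> ideal (ideal_pow I n) R" using S.nat_pow_closed[of I n] by (simp add: ideals_carrier)
qed

text \<open>Noetherian induction on \<open>L\<close>. If \<open>y \<in> I - L\<close> and \<open>w\<close> is the last power of \<open>y\<close> outside
  \<open>L\<close>, then \<open>L + (w)\<close> and \<open>(L : w)\<close> are strictly larger than \<open>L\<close>, and their product lies in \<open>L\<close>.\<close>

lemma ideal_power_subset:
  assumes noeth: "noetherian_ring R" and I: "ideal I R" and L: "ideal L R" and "I \<subseteq> radical R L"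
  shows "\<exists>c. ideal_pow I c \<subseteq> L"
proof -
  interpret noetherian_ring R by (rule noeth)
  interpret S: comm_monoid "ideals_set R" by (rule ideals_set_is_comm_monoid)
  show ?thesis
    using wf_ideals L assms(4)
  proof (induction L rule: wf_induct_rule)
    case (less L)
    interpret L: ideal L R by (rule less.prems(1))
    show ?case
    proof (cases "I \<subseteq> L")
      case True
      have "ideal_pow I 1 = I" using I by (simp add: ideals_mult ideals_one S.l_one[unfolded ideals_one ideals_mult ideals_carrier])
      then show ?thesis using True by metis
    next
      case False
      then obtain y where y: "y \<in> I" "y \<notin> L" by blast
      have yc: "y \<in> carrier R" using y(1) ideal.Icarr[OF I] by blast
      have ex: "\<exists>k::nat. y [^] k \<in> L" using less.prems(2) y(1) by (auto simp: radical_def)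
      define k where "k = (LEAST k::nat. y [^] k \<in> L)"
      have k: "y [^] k \<in> L" unfolding k_def using LeastI_ex[OF ex] .
      have "k \<noteq> 0"
      proof
        assume "k = 0"
        then have "L = carrier R" using k L.one_imp_carrier by simp
        then show False using y yc by simp
      qed
      then obtain l where l: "k = Suc l" by (cases k) auto
      \<comment> \<open>The last power of \<open>y\<close> outside \<open>L\<close>, so that \<open>y\<close> lies in \<open>(L : w)\<close>.\<close>
      define w where "w = y [^] l"
      have wL: "w \<notin> L" using not_less_Least[of l "\<lambda>k. y [^] k \<in> L"] l by (auto simp: w_def k_def)
      have wc: "w \<in> carrier R" using yc by (simp add: w_def)
      have yw: "y \<otimes> w \<in> L" using k yc by (simp add: l w_def m_comm)
      define L1 where "L1 = adjoin L w"
      define L2 where "L2 = {r \<in> carrier R. r \<otimes> w \<in> L}"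
      have L1: "ideal L1 R" "L \<subset> L1"
        unfolding L1_def using adjoin_ideal[OF less.prems(1) wc] adjoin_psubset[OF less.prems(1) wc wL] by auto
      have L2: "ideal L2 R" "L \<subset> L2"
        unfolding L2_def using colon_ideal[OF less.prems(1) wc] L.Icarr L.I_r_closed wc yw yc y(2) by auto
      have rad: "I \<subseteq> radical R K" if "L \<subset> K" for K
        using less.prems(2) that unfolding radical_def by blast
      obtain c1 where c1: "ideal_pow I c1 \<subseteq> L1" using less.IH[of L1] L1 less.prems(1) rad by auto
      obtain c2 where c2: "ideal_pow I c2 \<subseteq> L2" using less.IH[of L2] L2 less.prems(1) rad by auto
      have "ideal_pow I (c1 + c2) = ideal_prod R (ideal_pow I c1) (ideal_pow I c2)"
        using S.nat_pow_mult[of I c1 c2] I by (simp add: ideals_carrier ideals_mult)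
      moreover have "x \<in> L" if "x \<in> ideal_prod R (ideal_pow I c1) (ideal_pow I c2)" for x
        using that
      proof induction
        case (prod i j)
        obtain v t where vt: "v \<in> L" "t \<in> carrier R" "i = v \<oplus> t \<otimes> w"
          using prod(1) c1 unfolding L1_def by (auto simp: mem_adjoin subset_iff)
        have j: "j \<in> carrier R" "j \<otimes> w \<in> L" using prod(2) c2 by (auto simp: L2_def)
        have "i \<otimes> j = v \<otimes> j \<oplus> t \<otimes> (j \<otimes> w)"
          using vt j wc L.Icarr[OF vt(1)] by (simp add: l_distr m_ac r_distr)
        then show ?case using vt j by (simp add: L.I_r_closed L.I_l_closed)
      qed simp
      ultimately show ?thesis by blast
    qed
  qed
qed

lemma exists_maximalideal:
  assumes noeth: "noetherian_ring R" and "ideal I R" "I \<noteq> carrier R"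
  shows "\<exists>P. maximalideal P R \<and> I \<subseteq> P"
proof -
  interpret noetherian_ring R by (rule noeth)
  show ?thesis
    using wf_ideals assms(2,3)
  proof (induction I rule: wf_induct_rule)
    case (less I)
    show ?case
    proof (cases "maximalideal I R")
      case False
      then obtain J where "ideal J R" "I \<subset> J" "J \<noteq> carrier R"
        using maximalidealI[of I R] less.prems by blast
      then show ?thesis using less.IH[of J] less.prems by auto
    qed auto
  qed
qed

lemma ideal_prod_mono: "I \<subseteq> I' \<Longrightarrow> J \<subseteq> J' \<Longrightarrow> ideal_prod R I J \<subseteq> ideal_prod R I' J'"
proof
  fix x assume *: "I \<subseteq> I'" "J \<subseteq> J'" "x \<in> ideal_prod R I J"
  from *(3) show "x \<in> ideal_prod R I' J'"
    by induction (use *(1,2) in \<open>auto intro: ideal_prod.intros\<close>)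
qed

lemma ideal_pow_mono: "I \<subseteq> I' \<Longrightarrow> ideal_pow I n \<subseteq> ideal_pow I' n"
  by (induction n) (auto simp: ideals_one ideals_mult dest: ideal_prod_mono)

lemma ideal_power_prod_ideal:
  assumes "\<And>i. i \<in> {1..s} \<Longrightarrow> ideal (J i) R"
  shows "ideal (ideal_power_prod R s J u) R"
proof -
  interpret S: comm_monoid "ideals_set R" by (rule ideals_set_is_comm_monoid)
  show ?thesis
    unfolding ideal_power_prod_def
    using S.finprod_closed[of "\<lambda>i. ideal_pow (J i) (u i)" "{1..s}"] assms ideal_pow_ideal
    by (auto simp: ideals_carrier)
qed

lemma ideal_power_prod_add:
  assumes "\<And>i. i \<in> {1..s} \<Longrightarrow> ideal (J i) R"
  shows "ideal_power_prod R s J (\<lambda>i. u i + v i) =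
    ideal_prod R (ideal_power_prod R s J u) (ideal_power_prod R s J v)"
proof -
  interpret S: comm_monoid "ideals_set R" by (rule ideals_set_is_comm_monoid)
  have "ideal_power_prod R s J (\<lambda>i. u i + v i) =
      (\<Otimes>\<^bsub>ideals_set R\<^esub>i\<in>{1..s}. ideal_pow (J i) (u i) \<otimes>\<^bsub>ideals_set R\<^esub> ideal_pow (J i) (v i))"
    unfolding ideal_power_prod_def
    by (rule S.finprod_cong') (use assms ideal_pow_ideal in \<open>auto simp: S.nat_pow_mult ideals_carrier\<close>)
  also have "\<dots> = ideal_power_prod R s J u \<otimes>\<^bsub>ideals_set R\<^esub> ideal_power_prod R s J v"
    unfolding ideal_power_prod_def
    by (rule S.finprod_multf) (use assms ideal_pow_ideal in \<open>auto simp: ideals_carrier\<close>)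
  finally show ?thesis by (simp add: ideals_mult)
qed

lemma ideal_power_prod_cong:
  assumes "\<And>i. i \<in> {1..s} \<Longrightarrow> ideal (J i) R" and "\<And>i. i \<in> {1..s} \<Longrightarrow> u i = v i"
  shows "ideal_power_prod R s J u = ideal_power_prod R s J v"
proof -
  interpret S: comm_monoid "ideals_set R" by (rule ideals_set_is_comm_monoid)
  show ?thesis unfolding ideal_power_prod_def
    by (rule S.finprod_cong') (use assms ideal_pow_ideal in \<open>auto simp: ideals_carrier\<close>)
qed

lemma ideal_power_prod_zero:
  assumes "\<And>i. i \<in> {1..s} \<Longrightarrow> u i = 0"
  shows "ideal_power_prod R s J u = carrier R"
proof -
  interpret S: comm_monoid "ideals_set R" by (rule ideals_set_is_comm_monoid)
  show ?thesis unfolding ideal_power_prod_def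
    using assms by (subst S.finprod_one_eqI) (auto simp: ideals_one)
qed

lemma ideal_power_prod_incr:
  assumes J: "\<And>i. i \<in> {1..s} \<Longrightarrow> ideal (J i) R" and j: "j \<in> {1..s}"
  shows "ideal_power_prod R s J (incr j u) = ideal_prod R (ideal_power_prod R s J u) (J j)"
proof -
  interpret S: comm_monoid "ideals_set R" by (rule ideals_set_is_comm_monoid)
  define e where "e i = (if i = j then 1 else 0::nat)" for i
  have one: "carrier R \<otimes>\<^bsub>ideals_set R\<^esub> J j = J j"
    using S.l_one[of "J j"] J[OF j] by (simp add: ideals_carrier ideals_one)
  have "incr j u = (\<lambda>i. u i + e i)" by (auto simp: incr_def e_def)
  moreover have "ideal_power_prod R s J e = J j"
  proof -
    have "ideal_power_prod R s J e = (\<Otimes>\<^bsub>ideals_set R\<^esub>i\<in>{1..s}. if j = i then J i else \<one>\<^bsub>ideals_set R\<^esub>)"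
      unfolding ideal_power_prod_def
      by (rule S.finprod_cong') (use J j oneideal one in \<open>auto simp: e_def ideals_carrier ideals_one\<close>)
    also have "\<dots> = J j"
      using J j by (intro S.finprod_singleton) (auto simp: ideals_carrier ideals_one oneideal)
    finally show ?thesis .
  qed
  ultimately show ?thesis using ideal_power_prod_add[where s = s and J = J and u = u and v = e, OF J] by simp
qed

lemma ideal_pow_ideal_power_prod:
  assumes J: "\<And>i. i \<in> {1..s} \<Longrightarrow> ideal (J i) R"
  shows "ideal_pow (ideal_power_prod R s J n) k = ideal_power_prod R s J (\<lambda>i. k * n i)"
proof (induction k)
  case 0
  show ?case using ideal_power_prod_zero[of s "\<lambda>_. 0" J] by (simp add: ideals_one)
next
  case (Suc k)
  then show ?case
    using ideal_power_prod_add[where s = s and J = J and u = "\<lambda>i. k * n i" and v = n, OF J]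
    by (simp add: ideals_mult add.commute)
qed

lemma ideal_pow_add: "ideal I R \<Longrightarrow> ideal_pow I (a + b) = ideal_prod R (ideal_pow I a) (ideal_pow I b)"
proof -
  interpret S: comm_monoid "ideals_set R" by (rule ideals_set_is_comm_monoid)
  show "ideal I R \<Longrightarrow> ideal_pow I (a + b) = ideal_prod R (ideal_pow I a) (ideal_pow I b)"
    using S.nat_pow_mult[of I a b] by (simp add: ideals_carrier ideals_mult)
qed

lemma ideal_pow_antimono:
  assumes I: "ideal I R" and "a \<le> b" shows "ideal_pow I b \<subseteq> ideal_pow I a"
proof -
  have "ideal_pow I b = ideal_prod R (ideal_pow I a) (ideal_pow I (b - a))"
    using ideal_pow_add[OF I, of a "b - a"] assms(2) by simp
  also have "\<dots> \<subseteq> ideal_pow I a" using ideal_prod_inter[OF ideal_pow_ideal[OF I] ideal_pow_ideal[OF I]] by blast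
  finally show ?thesis .
qed

end

section \<open>Growth of powers of the maximal ideal\<close>

context module
begin

abbreviation cyc_len :: "'a set \<Rightarrow> nat \<Rightarrow> 'c set \<Rightarrow> 'c \<Rightarrow> enat" where
  "cyc_len \<mm> n N x \<equiv> len (N <+>\<^sub>M ideal_cyc (R.ideal_pow \<mm> n) x) (N <+>\<^sub>M cyc x)"

lemma ideal_cyc_subset_cyc: "ideal I R \<Longrightarrow> ideal_cyc I x \<subseteq> cyc x"
  using ideal.Icarr[of I R] by (auto simp: cyc_def ideal_cyc_def)

lemma cyc_least: "subm N \<Longrightarrow> x \<in> N \<Longrightarrow> cyc x \<subseteq> N"
  by (auto simp: cyc_def intro: subm_smult)

text \<open>With \<open>y = ax\<close>, the module \<open>(N + Rx)/(N + Px)\<close> is filtered by \<open>N + Ry + Px\<close>. The lower factor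
  is a quotient of \<open>(N + Ry)/(N + Qy)\<close> because \<open>Qy \<subseteq> Px\<close>; the upper one is the original
  expression for \<open>N + Ry\<close>, modulo which \<open>x\<close> is annihilated by \<open>a\<close> as well. Both factors are of the
  original form, which is what makes an induction possible.\<close>

lemma len_step:
  assumes N: "subm N" and x: "x \<in> carrier M" and a: "a \<in> carrier R"
    and P: "ideal P R" and Q: "ideal Q R" and QP: "\<And>q. q \<in> Q \<Longrightarrow> q \<otimes> a \<in> P"
  shows "len (N <+>\<^sub>M ideal_cyc P x) (N <+>\<^sub>M cyc x) \<le>
    len (N <+>\<^sub>M ideal_cyc Q (a \<odot>\<^sub>M x)) (N <+>\<^sub>M cyc (a \<odot>\<^sub>M x)) +
    len ((N <+>\<^sub>M cyc (a \<odot>\<^sub>M x)) <+>\<^sub>M ideal_cyc P x) ((N <+>\<^sub>M cyc (a \<odot>\<^sub>M x)) <+>\<^sub>M cyc x)"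
proof -
  let ?y = "a \<odot>\<^sub>M x"
  let ?Z = "ideal_cyc P x" and ?N' = "N <+>\<^sub>M cyc ?y"
  have y: "?y \<in> carrier M" using a x by simp
  note s = N subm_ideal_cyc[OF P x] subm_ideal_cyc[OF Q y] subm_cyc[OF x] subm_cyc[OF y]
  have yx: "cyc ?y \<subseteq> cyc x" using s a by (intro cyc_least) (auto simp: cyc_def)
  have ZyZ: "ideal_cyc Q ?y \<subseteq> ?Z"
  proof
    fix v assume "v \<in> ideal_cyc Q ?y"
    then obtain q where q: "q \<in> Q" "v = q \<odot>\<^sub>M ?y" by (auto simp: ideal_cyc_def)
    then have "v = (q \<otimes> a) \<odot>\<^sub>M x" using a x ideal.Icarr[OF Q] by (simp add: smult_assoc1)
    then show "v \<in> ?Z" using QP[OF q(1)] by (auto simp: ideal_cyc_def)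
  qed
  note sum = subm_plus
  have sN': "subm ?N'" by (intro sum s)
  have u1: "N \<subseteq> N <+>\<^sub>M cyc x" "cyc x \<subseteq> N <+>\<^sub>M cyc x" using plus_upper1 plus_upper2 s by blast+
  have u2: "N \<subseteq> ?N'" "cyc ?y \<subseteq> ?N'" using plus_upper1 plus_upper2 s by blast+
  have N'le: "?N' \<subseteq> N <+>\<^sub>M cyc x" using yx u1 by (intro plus_least sum s) auto
  have top: "?N' <+>\<^sub>M cyc x = N <+>\<^sub>M cyc x"
    using N'le u1 u2 by (intro subset_antisym plus_least plus_mono sum s) auto
  have "len (N <+>\<^sub>M ?Z) (N <+>\<^sub>M cyc x) \<le> len (N <+>\<^sub>M ?Z) (?N' <+>\<^sub>M ?Z) + len (?N' <+>\<^sub>M ?Z) (N <+>\<^sub>M cyc x)"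
    using N'le u1 u2 ideal_cyc_subset_cyc[OF P, of x] by (intro len_add_le sum s plus_mono plus_least) auto
  also have "len (N <+>\<^sub>M ?Z) (?N' <+>\<^sub>M ?Z) \<le>
      len ((N <+>\<^sub>M ideal_cyc Q ?y) <+>\<^sub>M ?Z) (?N' <+>\<^sub>M ?Z)"
  proof (rule len_mono[OF _ order_refl])
    have "N \<subseteq> N <+>\<^sub>M ?Z" "?Z \<subseteq> N <+>\<^sub>M ?Z" using plus_upper1 plus_upper2 s by blast+
    then show "(N <+>\<^sub>M ideal_cyc Q ?y) <+>\<^sub>M ?Z \<subseteq> N <+>\<^sub>M ?Z"
      using ZyZ by (intro plus_least sum s) auto
  qed
  also have "\<dots> \<le> len (N <+>\<^sub>M ideal_cyc Q ?y) ?N'"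
    using ideal_cyc_subset_cyc[OF Q, of ?y] by (intro len_shift sum s plus_mono) auto
  finally show ?thesis unfolding top by (simp add: add_right_mono)
qed

text \<open>The quotient is generated by one element and annihilated by a maximal ideal.\<close>

lemma len_simple_step:
  assumes N: "subm N" and x: "x \<in> carrier M" and m: "maximalideal \<mm> R"
    and kill: "\<And>r. r \<in> \<mm> \<Longrightarrow> r \<odot>\<^sub>M x \<in> N"
  shows "len N (N <+>\<^sub>M cyc x) \<le> 1"
proof (rule len_least)
  fix n F assume F: "sub_chain n F N (N <+>\<^sub>M cyc x)"
  interpret m: maximalideal \<mm> R by (rule m)
  \<comment> \<open>The interval has only its two end points, so a chain has at most one strict step.\<close>
  have two: "X = N \<or> X = N <+>\<^sub>M cyc x" if X: "subm X" "N \<subseteq> X" "X \<subseteq> N <+>\<^sub>M cyc x" for X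
  proof (rule disjCI)
    assume "X \<noteq> N <+>\<^sub>M cyc x"
    then have xX: "x \<notin> X" using X N cyc_least[OF X(1), of x] plus_least[OF X(1), of N "cyc x"] by blast
    show "X = N"
    proof (rule ccontr)
      assume "X \<noteq> N"
      then obtain v where v: "v \<in> X" "v \<notin> N" using X(2) by blast
      then obtain h r where hr: "h \<in> N" "r \<in> carrier R" "v = h \<oplus>\<^sub>M r \<odot>\<^sub>M x"
        using X(3) by (auto simp: mem_plus cyc_def subset_iff)
      have hc: "h \<in> carrier M" using hr N subm_carr by blast
      have "v \<ominus>\<^sub>M h \<in> X" using v hr X by (intro subm_diff) auto
      then have rx: "r \<odot>\<^sub>M x \<in> X" using add_diff_cancel_left hc hr x by simp
      have "r \<notin> \<mm>" using kill[of r] hr v(2) subm_add[OF N] by blast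
      then have "\<mm> \<subset> R.adjoin \<mm> r" using R.adjoin_psubset[OF m.is_ideal hr(2)] by blast
      moreover have "R.adjoin \<mm> r \<subseteq> carrier R"
        using ideal.Icarr[OF R.adjoin_ideal[OF m.is_ideal hr(2)]] by blast
      ultimately have "R.adjoin \<mm> r = carrier R"
        using m.I_maximal[OF R.adjoin_ideal[OF m.is_ideal hr(2)]] by blast
      then obtain i t where it: "i \<in> \<mm>" "t \<in> carrier R" "\<one> = i \<oplus> t \<otimes> r"
        using R.one_closed R.mem_adjoin[of \<one> \<mm> r] by auto
      have "x = (i \<oplus> t \<otimes> r) \<odot>\<^sub>M x" using x by (simp add: it(3)[symmetric])
      also have "\<dots> = i \<odot>\<^sub>M x \<oplus>\<^sub>M t \<odot>\<^sub>M (r \<odot>\<^sub>M x)"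
        using it hr x m.Icarr by (simp add: smult_l_distr smult_assoc1)
      also have "\<dots> \<in> X"
        using kill[OF it(1)] X(2) by (intro subm_add[OF X(1)] subm_smult[OF X(1) it(2) rx]) blast
      finally show False using xX by simp
    qed
  qed
  have "i = j" if ij: "i < n" "F i \<noteq> F (Suc i)" "j < n" "F j \<noteq> F (Suc j)" for i j
  proof (rule ccontr)
    assume "i \<noteq> j"
    have *: False if "a < b" "b < n" "F a \<noteq> F (Suc a)" "F b \<noteq> F (Suc b)" for a b
    proof -
      have le: "F a \<subseteq> F (Suc a)" "F b \<subseteq> F (Suc b)" using F that by (auto simp: sub_chain_def)
      have "F c = N \<or> F c = N <+>\<^sub>M cyc x" if "c \<le> n" for c
        using F that by (intro two) (auto simp: sub_chain_def)
      moreover have bd: "N \<subseteq> F c \<and> F c \<subseteq> N <+>\<^sub>M cyc x" if "c \<le> n" for c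
        using F that by (auto simp: sub_chain_def)
      ultimately have top: "F (Suc a) = N <+>\<^sub>M cyc x"
        using that(1,2,3) le bd[of a] by (metis Suc_leI less_trans order_less_imp_le subset_antisym)
      have "F (Suc a) \<subseteq> F b"
      proof -
        have "F (Suc a) \<subseteq> F (Suc a + k)" if "Suc a + k \<le> b" for k
          using that
        proof (induction k)
          case (Suc k)
          then have "F (Suc a + k) \<subseteq> F (Suc (Suc a + k))" using F \<open>b < n\<close> by (simp add: sub_chain_def)
          then show ?case using Suc by auto
        qed simp
        from this[of "b - Suc a"] show ?thesis using that(1) by simp
      qed
      then show False using top le bd[of "Suc b"] that by auto
    qed
    show False using *[of i j] *[of j i] ij \<open>i \<noteq> j\<close> by (meson nat_neq_iff)
  qed
  then have "card {i. i < n \<and> F i \<noteq> F (Suc i)} \<le> 1"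
    by (subst card_le_Suc0_iff_eq[folded One_nat_def]) auto
  then show "enat (steps n F) \<le> 1" by (simp add: steps_def one_enat_def)
qed

text \<open>Noetherian induction on \<open>I\<close>, with \<open>C\<close> independent of \<open>N\<close> and \<open>x\<close>; the cyclic module is
  \<open>(N + Rx)/N\<close>. If \<open>ab \<in> I\<close> with \<open>a, b \<notin> I\<close>, then \<open>len_step\<close> reduces to \<open>I + (a)\<close> and \<open>I + (b)\<close>. If \<open>I\<close> is a
  prime other than \<open>\<mm>\<close>, take \<open>y \<in> \<mm> - I\<close>: then \<open>len_step\<close> bounds the increment from \<open>n\<close> to \<open>n + 1\<close> by
  the function for \<open>I + (y)\<close>, above which chains of primes are shorter, and summation raises the
  exponent by one.\<close>

theorem cyclic_growth:
  assumes noeth: "noetherian_ring R" and loc: "local_ring R \<mm>" and "ideal I R" and "\<not> prime_chain R I (Suc d)"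
  shows "\<exists>C. \<forall>N x n. subm N \<longrightarrow> x \<in> carrier M \<longrightarrow> (\<forall>r\<in>I. r \<odot>\<^sub>M x \<in> N) \<longrightarrow>
    cyc_len \<mm> n N x \<le> enat (C * (n + 1) ^ d)"
proof -
  interpret nr: noetherian_ring R by (rule noeth)
  have m: "maximalideal \<mm> R" and uniq: "\<And>P. maximalideal P R \<Longrightarrow> P = \<mm>"
    using loc by (auto simp: local_ring_def)
  interpret m: maximalideal \<mm> R by (rule m)
  have pn: "ideal (R.ideal_pow \<mm> n) R" for n by (rule R.ideal_pow_ideal[OF m.is_ideal])
  have kill_adjoin: "r \<odot>\<^sub>M x \<in> N"
    if "subm N" "x \<in> carrier M" "\<forall>r\<in>I. r \<odot>\<^sub>M x \<in> N" "a \<in> carrier R" "a \<odot>\<^sub>M x \<in> N" "ideal I R" and r: "r \<in> R.adjoin I a"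
    for N x a r I
  proof -
    obtain i t where it: "i \<in> I" "t \<in> carrier R" "r = i \<oplus> t \<otimes> a" using r R.mem_adjoin by blast
    have "r \<odot>\<^sub>M x = i \<odot>\<^sub>M x \<oplus>\<^sub>M t \<odot>\<^sub>M (a \<odot>\<^sub>M x)"
      using it that ideal.Icarr[OF that(6)] by (simp add: smult_l_distr smult_assoc1)
    moreover have "i \<odot>\<^sub>M x \<in> N" using that(3) it(1) by blast
    ultimately show ?thesis using subm_add[OF that(1)] subm_smult[OF that(1) it(2) that(5)] by simp
  qed
  show ?thesis
    using nr.wf_ideals assms(3,4)
  proof (induction I arbitrary: d rule: wf_induct_rule)
    case (less I d)
    note I = less.prems(1)
    interpret I: ideal I R by (rule I)
    consider (one) "I = carrier R" | (nonprime) "I \<noteq> carrier R" "\<not> primeideal I R"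
      | (max) "I = \<mm>" | (prime) "primeideal I R" "I \<noteq> \<mm>" by blast
    then show ?case
    proof cases
      case one
      have "cyc_len \<mm> n N x \<le> enat (0 * (n + 1) ^ d)"
        if N: "subm N" and x: "x \<in> carrier M" and kill: "\<forall>r\<in>I. r \<odot>\<^sub>M x \<in> N" for N x n
      proof -
        have "cyc x \<subseteq> N" using kill by (auto simp: cyc_def one)
        then have "N <+>\<^sub>M cyc x \<subseteq> N <+>\<^sub>M ideal_cyc (R.ideal_pow \<mm> n) x"
          using N plus_upper1[OF N subm_ideal_cyc[OF pn x]] plus_least[OF N] by blast
        then have "cyc_len \<mm> n N x \<le>
            len (N <+>\<^sub>M cyc x) (N <+>\<^sub>M cyc x)" by (intro len_mono) auto
        then show ?thesis by (simp add: zero_enat_def)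
      qed
      then show ?thesis by blast
    next
      case nonprime
      then obtain a b where ab: "a \<in> carrier R" "b \<in> carrier R" "a \<otimes> b \<in> I" "a \<notin> I" "b \<notin> I"
        using primeidealI[OF I R.is_cring] by blast
      have "\<not> prime_chain R (R.adjoin I a) (Suc d)" "\<not> prime_chain R (R.adjoin I b) (Suc d)"
        using less.prems(2) prime_chain_mono R.adjoin_upper(1)[OF I] ab by metis+
      note np = this
      have rela: "(R.adjoin I a, I) \<in> {(J, I). ideal I R \<and> ideal J R \<and> I \<subset> J}"
        using I R.adjoin_ideal[OF I ab(1)] R.adjoin_psubset[OF I ab(1) ab(4)] by simp
      obtain Ca where Ca': "\<forall>N x n. subm N \<longrightarrow> x \<in> carrier M \<longrightarrow> (\<forall>r\<in>R.adjoin I a. r \<odot>\<^sub>M x \<in> N) \<longrightarrow>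
          cyc_len \<mm> n N x \<le> enat (Ca * (n + 1) ^ d)"
        using less.IH[OF rela R.adjoin_ideal[OF I ab(1)] np(1)] by (rule exE)
      have Ca: "cyc_len \<mm> n N x \<le> enat (Ca * (n + 1) ^ d)"
        if "subm N" "x \<in> carrier M" "\<forall>r\<in>R.adjoin I a. r \<odot>\<^sub>M x \<in> N" for N x n
        using Ca' that by blast
      have relb: "(R.adjoin I b, I) \<in> {(J, I). ideal I R \<and> ideal J R \<and> I \<subset> J}"
        using I R.adjoin_ideal[OF I ab(2)] R.adjoin_psubset[OF I ab(2) ab(5)] by simp
      obtain Cb where Cb': "\<forall>N x n. subm N \<longrightarrow> x \<in> carrier M \<longrightarrow> (\<forall>r\<in>R.adjoin I b. r \<odot>\<^sub>M x \<in> N) \<longrightarrow>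
          cyc_len \<mm> n N x \<le> enat (Cb * (n + 1) ^ d)"
        using less.IH[OF relb R.adjoin_ideal[OF I ab(2)] np(2)] by (rule exE)
      have Cb: "cyc_len \<mm> n N x \<le> enat (Cb * (n + 1) ^ d)"
        if "subm N" "x \<in> carrier M" "\<forall>r\<in>R.adjoin I b. r \<odot>\<^sub>M x \<in> N" for N x n
        using Cb' that by blast
      have "cyc_len \<mm> n N x \<le> enat ((Cb + Ca) * (n + 1) ^ d)"
        if N: "subm N" and x: "x \<in> carrier M" and kill: "\<forall>r\<in>I. r \<odot>\<^sub>M x \<in> N" for N x n
      proof -
        let ?y = "a \<odot>\<^sub>M x" and ?N' = "N <+>\<^sub>M cyc (a \<odot>\<^sub>M x)"
        have y: "?y \<in> carrier M" using ab x by simp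
        have N': "subm ?N'" by (intro subm_plus N subm_cyc y)
        have up: "N \<subseteq> ?N'" "?y \<in> ?N'"
          using plus_upper1[OF N subm_cyc[OF y]] plus_upper2[OF N subm_cyc[OF y]] mem_cyc[OF y] by auto
        have killy: "\<forall>r\<in>I. r \<odot>\<^sub>M ?y \<in> N"
        proof
          fix r assume r: "r \<in> I"
          have "r \<odot>\<^sub>M ?y = (r \<otimes> a) \<odot>\<^sub>M x" using r I.Icarr ab x by (simp add: smult_assoc1)
          then show "r \<odot>\<^sub>M ?y \<in> N" using kill I.I_r_closed[OF r ab(1)] by simp
        qed
        have "b \<odot>\<^sub>M ?y = (a \<otimes> b) \<odot>\<^sub>M x" using ab x by (simp add: smult_assoc1[symmetric] R.m_comm)
        then have byN: "b \<odot>\<^sub>M ?y \<in> N" using kill ab(3) by simp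
        have "cyc_len \<mm> n N ?y \<le> enat (Cb * (n + 1) ^ d)"
          using kill_adjoin[OF N y killy ab(2) byN I] by (intro Cb N y) blast
        moreover have "cyc_len \<mm> n ?N' x \<le> enat (Ca * (n + 1) ^ d)"
          using kill_adjoin[OF N' x _ ab(1) up(2) I] kill up(1) by (intro Ca N' x) blast
        moreover have "q \<otimes> a \<in> R.ideal_pow \<mm> n" if "q \<in> R.ideal_pow \<mm> n" for q
          using ideal.I_r_closed[OF pn that ab(1)] .
        ultimately have "cyc_len \<mm> n N x \<le>
            enat (Cb * (n + 1) ^ d) + enat (Ca * (n + 1) ^ d)"
          using len_step[OF N x ab(1) pn pn, of n n] by (meson add_mono order_trans)
        then show ?thesis by (simp add: algebra_simps)
      qed
      then show ?thesis by blast
    next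
      case max
      have "cyc_len \<mm> n N x \<le> enat (1 * (n + 1) ^ d)"
        if N: "subm N" and x: "x \<in> carrier M" and kill: "\<forall>r\<in>I. r \<odot>\<^sub>M x \<in> N" for N x n
      proof -
        have "cyc_len \<mm> n N x \<le> len N (N <+>\<^sub>M cyc x)"
          using plus_upper1[OF N subm_ideal_cyc[OF pn x]] by (intro len_mono) auto
        also have "\<dots> \<le> 1" using kill max by (intro len_simple_step[OF N x m]) auto
        also have "\<dots> \<le> enat (1 * (n + 1) ^ d)" by (simp add: one_enat_def)
        finally show ?thesis .
      qed
      then show ?thesis by blast
    next
      case prime
      interpret p: primeideal I R by (rule prime(1))
      have "I \<subseteq> \<mm>" using R.exists_maximalideal[OF noeth I] p.I_notcarr uniq by metis
      then obtain y where y: "y \<in> \<mm>" "y \<notin> I" and Im: "I \<subset> \<mm>" using prime(2) by blast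
      have yc: "y \<in> carrier R" using y m.Icarr by blast
      obtain d' where d: "d = Suc d'"
      proof (cases d)
        case 0
        have "prime_chain R I (Suc 0)"
          unfolding prime_chain_def
          by (rule exI[of _ "\<lambda>i. if i = 0 then I else \<mm>"])
            (use Im prime(1) R.maximalideal_prime[OF m] in auto)
        then show ?thesis using less.prems(2) 0 by simp
      qed auto
      have "\<not> prime_chain R (R.adjoin I y) (Suc d')"
      proof
        assume "prime_chain R (R.adjoin I y) (Suc d')"
        then obtain P where P: "\<And>i. i \<le> Suc d' \<Longrightarrow> primeideal (P i) R" "\<And>i. i \<le> Suc d' \<Longrightarrow> R.adjoin I y \<subseteq> P i"
          "\<And>i. i < Suc d' \<Longrightarrow> P i \<subset> P (Suc i)" unfolding prime_chain_def by blast
        have sub: "I \<subset> P i" if "i \<le> Suc d'" for i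
          using P(2)[OF that] R.adjoin_psubset[OF I yc y(2)] by blast
        have "prime_chain R I (Suc d)"
          unfolding prime_chain_def d
          by (rule exI[of _ "\<lambda>i. case i of 0 \<Rightarrow> I | Suc j \<Rightarrow> P j"])
            (use P sub prime(1) in \<open>auto split: nat.splits simp: less_imp_le\<close>)
        then show False using less.prems(2) by blast
      qed
      note np = this
      have rely: "(R.adjoin I y, I) \<in> {(J, I). ideal I R \<and> ideal J R \<and> I \<subset> J}"
        using I R.adjoin_ideal[OF I yc] R.adjoin_psubset[OF I yc y(2)] by simp
      obtain Cy where Cy': "\<forall>N x n. subm N \<longrightarrow> x \<in> carrier M \<longrightarrow> (\<forall>r\<in>R.adjoin I y. r \<odot>\<^sub>M x \<in> N) \<longrightarrow>
          cyc_len \<mm> n N x \<le> enat (Cy * (n + 1) ^ d')"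
        using less.IH[OF rely R.adjoin_ideal[OF I yc] np] by (rule exE)
      have Cy: "cyc_len \<mm> n N x \<le> enat (Cy * (n + 1) ^ d')"
        if "subm N" "x \<in> carrier M" "\<forall>r\<in>R.adjoin I y. r \<odot>\<^sub>M x \<in> N" for N x n
        using Cy' that by blast
      \<comment> \<open>Sum of the increments; the factor \<open>n\<close> counts them.\<close>
      have bd: "cyc_len \<mm> n N x \<le> enat (Cy * n * (n + 1) ^ d')"
        if N: "subm N" and x: "x \<in> carrier M" and kill: "\<forall>r\<in>I. r \<odot>\<^sub>M x \<in> N" for N x n
        using that
      proof (induction n arbitrary: x)
        case 0
        then show ?case by (simp add: R.ideals_one cyc_eq[symmetric] zero_enat_def)
      next
        case (Suc n)
        note x = Suc.prems(2) and kill = Suc.prems(3)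
        let ?y = "y \<odot>\<^sub>M x" and ?N' = "N <+>\<^sub>M cyc (y \<odot>\<^sub>M x)"
        have yM: "?y \<in> carrier M" using yc x by simp
        have N': "subm ?N'" by (intro subm_plus N subm_cyc yM)
        have up: "N \<subseteq> ?N'" "?y \<in> ?N'"
          using plus_upper1[OF N subm_cyc[OF yM]] plus_upper2[OF N subm_cyc[OF yM]] mem_cyc[OF yM] by auto
        have killy: "\<forall>r\<in>I. r \<odot>\<^sub>M ?y \<in> N"
        proof
          fix r assume r: "r \<in> I"
          have "r \<odot>\<^sub>M ?y = (r \<otimes> y) \<odot>\<^sub>M x" using r I.Icarr yc x by (simp add: smult_assoc1)
          then show "r \<odot>\<^sub>M ?y \<in> N" using kill I.I_r_closed[OF r yc] by simp
        qed
        have "cyc_len \<mm> n N ?y \<le> enat (Cy * n * (n + 1) ^ d')"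
          by (rule Suc.IH[OF N yM killy])
        moreover have "cyc_len \<mm> (Suc n) ?N' x \<le> enat (Cy * (Suc n + 1) ^ d')"
          using kill_adjoin[OF N' x _ yc up(2) I] kill up(1) by (intro Cy N' x) blast
        moreover have "q \<otimes> y \<in> R.ideal_pow \<mm> (Suc n)" if "q \<in> R.ideal_pow \<mm> n" for q
          using ideal_prod.prod[OF that y(1)] by (simp add: R.ideals_mult)
        ultimately have "cyc_len \<mm> (Suc n) N x \<le>
            enat (Cy * n * (n + 1) ^ d') + enat (Cy * (Suc n + 1) ^ d')"
          using len_step[OF N x yc pn pn, of n "Suc n"] by (meson add_mono order_trans)
        also have "\<dots> \<le> enat (Cy * n * (Suc n + 1) ^ d' + Cy * (Suc n + 1) ^ d')"
          by (simp add: power_mono)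
        also have "\<dots> = enat (Cy * Suc n * (Suc n + 1) ^ d')" by (simp add: algebra_simps)
        finally show ?case .
      qed
      have le: "Cy * n * (n + 1) ^ d' \<le> Cy * (n + 1) ^ d" for n
        unfolding d by (simp add: algebra_simps)
      show ?thesis
        by (intro exI[of _ Cy] allI impI order_trans[OF bd]) (use le in auto)
    qed
  qed
qed

lemma subm_ideal_smult: "subm (ideal_smult R I M)" if "ideal I R"
proof -
  let ?S = "{r \<odot>\<^sub>M x | r x. r \<in> I \<and> x \<in> carrier M}"
  have S: "?S \<subseteq> carrier M" using ideal.Icarr[OF that] by auto
  show ?thesis
    unfolding ideal_smult_def submodule_span_def
  proof (rule submI)
    show "\<Inter>{N. subm N \<and> ?S \<subseteq> N} \<subseteq> carrier M" using S carrier_is_submodule by blast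
    show "\<zero>\<^sub>M \<in> \<Inter>{N. subm N \<and> ?S \<subseteq> N}" using subm_zero by simp
    fix a b assume "a \<in> \<Inter>{N. subm N \<and> ?S \<subseteq> N}" "b \<in> \<Inter>{N. subm N \<and> ?S \<subseteq> N}"
    then show "a \<oplus>\<^sub>M b \<in> \<Inter>{N. subm N \<and> ?S \<subseteq> N}" using subm_add by simp
  next
    fix r x assume "r \<in> carrier R" "x \<in> \<Inter>{N. subm N \<and> ?S \<subseteq> N}"
    then show "r \<odot>\<^sub>M x \<in> \<Inter>{N. subm N \<and> ?S \<subseteq> N}" using subm_smult by simp
  qed
qed

lemma ideal_smult_mem: "r \<in> I \<Longrightarrow> x \<in> carrier M \<Longrightarrow> r \<odot>\<^sub>M x \<in> ideal_smult R I M"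
  unfolding ideal_smult_def submodule_span_def by blast

lemma ideal_smult_least:
  "subm X \<Longrightarrow> (\<And>r x. r \<in> I \<Longrightarrow> x \<in> carrier M \<Longrightarrow> r \<odot>\<^sub>M x \<in> X) \<Longrightarrow> ideal_smult R I M \<subseteq> X"
  unfolding ideal_smult_def submodule_span_def by blast

lemma ideal_smult_carrier: "ideal I R \<Longrightarrow> ideal_smult R I M \<subseteq> carrier M"
  by (rule submoduleE(1)[OF subm_ideal_smult])

lemma ideal_smult_mono: "ideal I' R \<Longrightarrow> I \<subseteq> I' \<Longrightarrow> ideal_smult R I M \<subseteq> ideal_smult R I' M"
  using ideal_smult_mem by (intro ideal_smult_least subm_ideal_smult) auto

lemma ideal_smult_one: "ideal_smult R (carrier R) M = carrier M"
  using ideal_smult_carrier[OF R.oneideal] ideal_smult_mem[OF R.one_closed] by auto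

lemma smult_ideal_smult:
  assumes I: "ideal I R" and J: "ideal J R" and r: "r \<in> J" and x: "x \<in> ideal_smult R I M"
  shows "r \<odot>\<^sub>M x \<in> ideal_smult R (ideal_prod R I J) M"
proof -
  let ?X = "ideal_smult R (ideal_prod R I J) M"
  have rc: "r \<in> carrier R" using r ideal.Icarr[OF J] by blast
  have X: "subm ?X" by (rule subm_ideal_smult[OF R.ideal_prod_is_ideal[OF I J]])
  have "ideal_smult R I M \<subseteq> {x \<in> carrier M. r \<odot>\<^sub>M x \<in> ?X}"
  proof (rule ideal_smult_least[OF subm_colon[OF carrier_is_submodule X rc]])
    fix i x assume i: "i \<in> I" and x: "x \<in> carrier M"
    have ic: "i \<in> carrier R" using i ideal.Icarr[OF I] by blast
    have "r \<odot>\<^sub>M (i \<odot>\<^sub>M x) = (i \<otimes> r) \<odot>\<^sub>M x" using rc ic x by (simp add: smult_assoc1[symmetric] R.m_comm)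
    also have "\<dots> \<in> ?X" using ideal_prod.prod[OF i r] x by (intro ideal_smult_mem)
    finally show "i \<odot>\<^sub>M x \<in> {x \<in> carrier M. r \<odot>\<^sub>M x \<in> ?X}" using ic x by simp
  qed
  then show ?thesis using x by blast
qed

lemma ideal_smult_prod_least:
  assumes I: "ideal I R" and J: "ideal J R" and X: "subm X"
    and "\<And>r x. r \<in> J \<Longrightarrow> x \<in> ideal_smult R I M \<Longrightarrow> r \<odot>\<^sub>M x \<in> X"
  shows "ideal_smult R (ideal_prod R I J) M \<subseteq> X"
proof (rule ideal_smult_least[OF X])
  fix r x assume r: "r \<in> ideal_prod R I J" and x: "x \<in> carrier M"
  from r show "r \<odot>\<^sub>M x \<in> X"
  proof induction
    case (prod i j)
    have "i \<in> carrier R" "j \<in> carrier R" using ideal.Icarr[OF I prod(1)] ideal.Icarr[OF J prod(2)] by auto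
    then have "(i \<otimes> j) \<odot>\<^sub>M x = j \<odot>\<^sub>M (i \<odot>\<^sub>M x)" using x by (simp add: smult_assoc1[symmetric] R.m_comm)
    then show ?case using assms(4)[OF prod(2) ideal_smult_mem[OF prod(1) x]] by simp
  next
    case (sum a b)
    have "a \<in> carrier R" "b \<in> carrier R" using sum R.ideal_prod_in_carrier[OF I J] by blast+
    then show ?case using sum X x by (simp add: smult_l_distr subm_add)
  qed
qed

lemma colength_eq_rlen: "ideal I R \<Longrightarrow> colength R M I = rlen (ideal_smult R I M) (carrier M)"
  unfolding colength_def rlen_def by (simp add: module_length_quot subm_ideal_smult)

lemma annihilator_ideal: "ideal (annihilator R M) R"
proof (rule idealI)
  show "subgroup (annihilator R M) (add_monoid R)"
    by (rule R.add.subgroupI) (auto simp: annihilator_def smult_l_distr smult_l_minus intro: exI[of _ \<zero>])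
  fix a x assume "a \<in> annihilator R M" and x: "x \<in> carrier R"
  then show "x \<otimes> a \<in> annihilator R M" by (auto simp: annihilator_def smult_assoc1)
  then show "a \<otimes> x \<in> annihilator R M" using \<open>a \<in> annihilator R M\<close> x by (auto simp: annihilator_def R.m_comm)
qed (rule R.ring_axioms)

text \<open>Filter \<open>M/\<mm>\<^bsup>n\<^esup>M\<close> by the submodules spanned by initial parts of a list of generators; the
  factors are cyclic and annihilated by the annihilator of \<open>M\<close>.\<close>

theorem module_growth:
  assumes noeth: "noetherian_ring R" and fg: "fin_gen_module R M" and loc: "local_ring R \<mm>"
    and dim: "module_dim R M = enat D"
  shows "\<exists>C. \<forall>n. len (ideal_smult R (R.ideal_pow \<mm> n) M) (carrier M) \<le> enat (C * (n + 1) ^ D)"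
proof -
  have m: "ideal \<mm> R" using loc maximalideal.axioms(1) by (auto simp: local_ring_def)
  have pn: "ideal (R.ideal_pow \<mm> n) R" for n by (rule R.ideal_pow_ideal[OF m])
  have "\<not> prime_chain R (annihilator R M) (Suc D)"
  proof
    assume "prime_chain R (annihilator R M) (Suc D)"
    then have "enat (Suc D) \<le> krull_dim (R Quot annihilator R M)"
      by (rule R.prime_chain_le_krull_dim[OF R.is_cring annihilator_ideal])
    then show False using dim by (simp add: module_dim_def)
  qed
  from cyclic_growth[OF noeth loc annihilator_ideal this] obtain C where
    C: "\<forall>N x n. subm N \<longrightarrow> x \<in> carrier M \<longrightarrow> (\<forall>r\<in>annihilator R M. r \<odot>\<^sub>M x \<in> N) \<longrightarrow>
      cyc_len \<mm> n N x \<le> enat (C * (n + 1) ^ D)" by (rule exE)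
  obtain xs where xs: "set xs \<subseteq> carrier M" "gens xs = carrier M" using fin_gen_gens[OF fg] by blast
  have "len (ideal_smult R (R.ideal_pow \<mm> n) M) (carrier M) \<le> enat (length xs * C * (n + 1) ^ D)" for n
  proof -
    let ?X = "ideal_smult R (R.ideal_pow \<mm> n) M"
    have X: "subm ?X" by (rule subm_ideal_smult[OF pn])
    have "len ?X (?X <+>\<^sub>M gens ys) \<le> enat (length ys * C * (n + 1) ^ D)" if "set ys \<subseteq> carrier M" for ys
      using that
    proof (induction ys)
      case Nil
      have "?X <+>\<^sub>M gens [] \<subseteq> ?X" using subm_zero[OF X] by (intro plus_least X) auto
      then have "len ?X (?X <+>\<^sub>M gens []) \<le> len ?X ?X" by (intro len_mono) auto
      then show ?case by (simp add: zero_enat_def)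
    next
      case (Cons y ys)
      have y: "y \<in> carrier M" and ys: "set ys \<subseteq> carrier M" using Cons.prems by auto
      define N where "N = ?X <+>\<^sub>M gens ys"
      note g = subm_gens[OF ys] and c = subm_cyc[OF y]
      have N: "subm N" unfolding N_def by (intro subm_plus X g)
      have up: "?X \<subseteq> N" "gens ys \<subseteq> N" using plus_upper1[OF X g] plus_upper2[OF X g] by (auto simp: N_def)
      have up2: "N \<subseteq> N <+>\<^sub>M cyc y" "cyc y \<subseteq> N <+>\<^sub>M cyc y" using plus_upper1[OF N c] plus_upper2[OF N c] by auto
      have s: "subm (N <+>\<^sub>M cyc y)" by (intro subm_plus N c)
      have "ideal_cyc (R.ideal_pow \<mm> n) y \<subseteq> ?X" using y by (auto simp: ideal_cyc_def intro: ideal_smult_mem)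
      then have "N <+>\<^sub>M ideal_cyc (R.ideal_pow \<mm> n) y \<subseteq> N" using up by (intro plus_least N) auto
      then have "len N (N <+>\<^sub>M cyc y) \<le> cyc_len \<mm> n N y"
        by (intro len_mono) auto
      also have "\<dots> \<le> enat (C * (n + 1) ^ D)"
        using C[rule_format, OF N y] subm_zero[OF N] y by (auto simp: annihilator_def)
      finally have 1: "len N (N <+>\<^sub>M cyc y) \<le> enat (C * (n + 1) ^ D)" .
      have "?X <+>\<^sub>M gens (y # ys) \<subseteq> N <+>\<^sub>M cyc y"
        unfolding gens.simps using up up2 by (intro plus_least s) auto
      then have "len ?X (?X <+>\<^sub>M gens (y # ys)) \<le> len ?X (N <+>\<^sub>M cyc y)" by (intro len_mono) auto
      also have "\<dots> \<le> len ?X N + len N (N <+>\<^sub>M cyc y)"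
        by (rule len_add_le[OF X N s up(1) up2(1)])
      also have "\<dots> \<le> enat (length ys * C * (n + 1) ^ D) + enat (C * (n + 1) ^ D)"
        using Cons.IH[OF ys] 1 unfolding N_def by (rule add_mono)
      finally show ?case by (simp add: algebra_simps)
    qed
    from this[OF xs(1)] have 1: "len ?X (?X <+>\<^sub>M carrier M) \<le> enat (length xs * C * (n + 1) ^ D)" by (simp add: xs(2))
    have "len ?X (carrier M) \<le> len ?X (?X <+>\<^sub>M carrier M)"
      by (rule len_mono[OF order_refl plus_upper2[OF X carrier_is_submodule]])
    then show ?thesis using 1 by (rule order_trans)
  qed
  then show ?thesis by blast
qed

end

section \<open>Mixed multiplicities\<close>

locale primary_family = module R M for R (structure) and M (structure) +
  fixes \<mm> :: "'a set" and D s :: nat and J :: "nat \<Rightarrow> 'a set"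
  assumes noeth: "noetherian_ring R" and loc: "local_ring R \<mm>"
    and fg: "fin_gen_module R M" and dim: "module_dim R M = enat D"
    and prim: "i \<in> {1..s} \<Longrightarrow> primary_to R \<mm> (J i)"
begin

definition J_pow :: "(nat \<Rightarrow> nat) \<Rightarrow> 'a set" where "J_pow u = ideal_power_prod R s J u"

definition JM :: "(nat \<Rightarrow> nat) \<Rightarrow> 'c set" where "JM u = ideal_smult R (J_pow u) M"

definition JM_colength :: "(nat \<Rightarrow> nat) \<Rightarrow> real" where "JM_colength u = colength R M (J_pow u)"

lemma J_ideal: "i \<in> {1..s} \<Longrightarrow> ideal (J i) R"
  using prim by (auto simp: primary_to_def primary_ideal_def)

lemma m_ideal: "ideal \<mm> R"
  using loc maximalideal.axioms(1) by (auto simp: local_ring_def)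

lemma J_pow_ideal: "ideal (J_pow u) R"
  unfolding J_pow_def by (rule R.ideal_power_prod_ideal[OF J_ideal])

lemma JM_subm: "subm (JM u)"
  unfolding JM_def by (rule subm_ideal_smult[OF J_pow_ideal])

lemma JM_carrier: "JM u \<subseteq> carrier M"
  unfolding JM_def by (rule ideal_smult_carrier[OF J_pow_ideal])

lemma JM_colength_eq: "JM_colength u = rlen (JM u) (carrier M)"
  unfolding JM_colength_def JM_def by (rule colength_eq_rlen[OF J_pow_ideal])

lemma J_pow_incr: "j \<in> {1..s} \<Longrightarrow> J_pow (incr j u) = ideal_prod R (J_pow u) (J j)"
  unfolding J_pow_def by (rule R.ideal_power_prod_incr[OF J_ideal])

lemma J_pow_add: "J_pow (\<lambda>i. u i + v i) = ideal_prod R (J_pow u) (J_pow v)"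
  unfolding J_pow_def by (rule R.ideal_power_prod_add[OF J_ideal])

lemma J_pow_cong: "(\<And>i. i \<in> {1..s} \<Longrightarrow> u i = v i) \<Longrightarrow> J_pow u = J_pow v"
  unfolding J_pow_def by (rule R.ideal_power_prod_cong[OF J_ideal])

lemma J_pow_zero: "J_pow (\<lambda>_. 0) = carrier R"
  unfolding J_pow_def by (rule R.ideal_power_prod_zero) simp

lemma ideal_pow_J_pow: "R.ideal_pow (J_pow n) k = J_pow (\<lambda>i. k * n i)"
  unfolding J_pow_def by (rule R.ideal_pow_ideal_power_prod[OF J_ideal])

lemma J_pow_antimono: "(\<And>i. u i \<le> v i) \<Longrightarrow> J_pow v \<subseteq> J_pow u"
proof -
  assume le: "\<And>i. u i \<le> v i"
  have "J_pow v = J_pow (\<lambda>i. u i + (v i - u i))" using le by simp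
  also have "\<dots> \<subseteq> J_pow u" unfolding J_pow_add using R.ideal_prod_inter[OF J_pow_ideal J_pow_ideal] by blast
  finally show ?thesis .
qed

lemma J_power: "\<exists>c. \<forall>j\<in>{1..s}. R.ideal_pow \<mm> c \<subseteq> J j"
proof -
  have "\<exists>c. R.ideal_pow \<mm> c \<subseteq> J j" if "j \<in> {1..s}" for j
    using prim[OF that] by (intro R.ideal_power_subset[OF noeth m_ideal J_ideal[OF that]]) (simp add: primary_to_def)
  then obtain c where c: "\<And>j. j \<in> {1..s} \<Longrightarrow> R.ideal_pow \<mm> (c j) \<subseteq> J j" by metis
  have "R.ideal_pow \<mm> (\<Sum>j=1..s. c j) \<subseteq> J j" if j: "j \<in> {1..s}" for j
  proof -
    have "c j \<le> (\<Sum>j=1..s. c j)" using j by (intro member_le_sum) auto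
    then show ?thesis using R.ideal_pow_antimono[OF m_ideal] c[OF j] by blast
  qed
  then show ?thesis by blast
qed

lemma m_power_subset_J_pow: "\<exists>c. \<forall>u\<in>vecs s. R.ideal_pow \<mm> (c * (\<Sum>i=1..s. u i)) \<subseteq> J_pow u"
proof -
  obtain c where c: "\<forall>j\<in>{1..s}. R.ideal_pow \<mm> c \<subseteq> J j" using J_power by blast
  have "R.ideal_pow \<mm> (c * (\<Sum>i=1..s. u i)) \<subseteq> J_pow u" if "u \<in> vecs s" for u
    using that
  proof (induction rule: vecs_induct)
    case zero
    then show ?case by (simp add: J_pow_zero R.ideals_one)
  next
    case (step j u)
    have "R.ideal_pow \<mm> (c * (\<Sum>i=1..s. incr j u i)) = R.ideal_pow \<mm> (c * (\<Sum>i=1..s. u i) + c)"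
      unfolding sum_incr[OF step(1)] by (simp add: algebra_simps)
    also have "\<dots> = ideal_prod R (R.ideal_pow \<mm> (c * (\<Sum>i=1..s. u i))) (R.ideal_pow \<mm> c)"
      by (rule R.ideal_pow_add[OF m_ideal])
    also have "\<dots> \<subseteq> ideal_prod R (J_pow u) (J j)"
      using step c by (intro R.ideal_prod_mono) auto
    finally show ?case by (simp add: J_pow_incr[OF step(1)])
  qed
  then show ?thesis by blast
qed

text \<open>Powers of the ideals \<open>J i\<close> depend only on the coordinates in \<open>{1..s}\<close>; clipping the others moves an
  arbitrary vector into \<open>vecs s\<close>.\<close>

definition clip :: "(nat \<Rightarrow> nat) \<Rightarrow> nat \<Rightarrow> nat" where "clip u = (\<lambda>i. if i \<in> {1..s} then u i else 0)"

lemma clip_vecs: "clip u \<in> vecs s"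
  by (auto simp: clip_def vecs_def)

lemma J_pow_clip: "J_pow (clip u) = J_pow u"
  by (rule J_pow_cong) (simp add: clip_def)

text \<open>The power \<open>\<mm>\<^bsup>c\<bar>u\<bar>\<^esup>\<close> is contained in \<open>J\<^bsup>u\<^esup>\<close>. In particular all lengths are finite.\<close>

lemma JM_growth: "\<exists>C. \<forall>u. len (JM u) (carrier M) \<le> enat (C * ((\<Sum>i=1..s. u i) + 1) ^ D)"
proof -
  obtain c where c: "\<forall>u\<in>vecs s. R.ideal_pow \<mm> (c * (\<Sum>i=1..s. u i)) \<subseteq> J_pow u" using m_power_subset_J_pow by blast
  obtain C where C: "\<And>n. len (ideal_smult R (R.ideal_pow \<mm> n) M) (carrier M) \<le> enat (C * (n + 1) ^ D)"
    using module_growth[OF noeth fg loc dim] by blast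
  have "len (JM u) (carrier M) \<le> enat ((C * (c + 1) ^ D) * ((\<Sum>i=1..s. u i) + 1) ^ D)" for u
  proof -
    define S where "S = (\<Sum>i=1..s. u i)"
    have S: "(\<Sum>i=1..s. clip u i) = S" unfolding S_def by (intro sum.cong) (auto simp: clip_def)
    have "R.ideal_pow \<mm> (c * S) \<subseteq> J_pow u" using c[rule_format, OF clip_vecs, of u] unfolding S J_pow_clip .
    then have "len (JM u) (carrier M) \<le> len (ideal_smult R (R.ideal_pow \<mm> (c * S)) M) (carrier M)"
      unfolding JM_def by (intro len_mono ideal_smult_mono J_pow_ideal) auto
    also have "\<dots> \<le> enat (C * (c * S + 1) ^ D)" by (rule C)
    also have "\<dots> \<le> enat ((C * (c + 1) ^ D) * (S + 1) ^ D)"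
    proof -
      have "(c * S + 1) ^ D \<le> ((c + 1) * (S + 1)) ^ D" by (intro power_mono) (auto simp: algebra_simps)
      then have "C * (c * S + 1) ^ D \<le> C * ((c + 1) ^ D * (S + 1) ^ D)"
        unfolding power_mult_distrib by (rule mult_le_mono2)
      then show ?thesis by (simp add: mult.assoc)
    qed
    finally show ?thesis by (simp add: S_def)
  qed
  then show ?thesis by blast
qed

lemma JM_finite: "len (JM u) (carrier M) \<noteq> \<infinity>"
  using JM_growth by (metis enat_ord_simps(4) infinity_ileE not_infinity_eq)

lemma JM_colength_antimono_JM: "JM u \<subseteq> JM v \<Longrightarrow> JM_colength v \<le> JM_colength u"
proof -
  assume "JM u \<subseteq> JM v"
  then have "len (JM v) (carrier M) \<le> len (JM u) (carrier M)" by (intro len_mono) auto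
  then show ?thesis unfolding JM_colength_eq rlen_def using JM_finite[of u] JM_finite[of v]
    by (cases "len (JM u) (carrier M)"; cases "len (JM v) (carrier M)") auto
qed

lemma JM_colength_antimono: "J_pow u \<subseteq> J_pow v \<Longrightarrow> JM_colength v \<le> JM_colength u"
  unfolding JM_def[symmetric] by (rule JM_colength_antimono_JM) (simp add: JM_def ideal_smult_mono J_pow_ideal)

lemma JM_step: "j \<in> {1..s} \<Longrightarrow> r \<in> J j \<Longrightarrow> x \<in> JM u \<Longrightarrow> r \<odot>\<^sub>M x \<in> JM (incr j u)"
  unfolding JM_def J_pow_incr by (rule smult_ideal_smult[OF J_pow_ideal J_ideal])

lemma JM_step_least:
  "j \<in> {1..s} \<Longrightarrow> subm X \<Longrightarrow> (\<And>r x. r \<in> J j \<Longrightarrow> x \<in> JM u \<Longrightarrow> r \<odot>\<^sub>M x \<in> X) \<Longrightarrow> JM (incr j u) \<subseteq> X"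
  unfolding JM_def J_pow_incr by (rule ideal_smult_prod_least[OF J_pow_ideal J_ideal])

lemma JM_incr_subset: "j \<in> {1..s} \<Longrightarrow> JM (incr j u) \<subseteq> JM u"
  using subm_smult[OF JM_subm] ideal.Icarr[OF J_ideal] by (intro JM_step_least JM_subm) blast+

lemma JM_colength_incr: "j \<in> {1..s} \<Longrightarrow> JM_colength (incr j u) - JM_colength u = rlen (JM (incr j u)) (JM u)"
  unfolding JM_colength_eq
  using rlen_add[OF JM_subm JM_subm carrier_is_submodule JM_incr_subset JM_carrier JM_finite] by simp

text \<open>The pairs of an index \<open>j\<close> and a generator of \<open>J j\<close>, arranged in a list.\<close>

lemma exists_generators:
  "\<exists>m z g. graded_generators R M s m z g \<and> (\<forall>a<m. z a \<in> J (g a)) \<and> (\<forall>j\<in>{1..s}. J j = genideal R {z a | a. a < m \<and> g a = j})"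
proof -
  interpret noetherian_ring R by (rule noeth)
  have "\<exists>S. S \<subseteq> carrier R \<and> finite S \<and> J j = Idl S" if "j \<in> {1..s}" for j
    using finetely_gen[OF J_ideal[OF that]] by blast
  then obtain S where S: "\<And>j. j \<in> {1..s} \<Longrightarrow> S j \<subseteq> carrier R" "\<And>j. j \<in> {1..s} \<Longrightarrow> finite (S j)"
    "\<And>j. j \<in> {1..s} \<Longrightarrow> J j = Idl (S j)" by metis
  have "finite (SIGMA j:{1..s}. S j)" using S(2) by blast
  then obtain ps where ps: "set ps = (SIGMA j:{1..s}. S j)" using finite_list by blast
  define z where "z a = snd (ps ! a)" for a
  define g where "g a = fst (ps ! a)" for a
  have mem: "g a \<in> {1..s} \<and> z a \<in> S (g a)" if "a < length ps" for a
  proof -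
    have "ps ! a \<in> (SIGMA j:{1..s}. S j)" using that ps nth_mem by blast
    then show ?thesis by (auto simp: z_def g_def mem_Sigma_iff split: prod.splits)
  qed
  have "graded_generators R M s (length ps) z g"
    by (intro graded_generators.intro module_axioms graded_generators_axioms.intro) (use mem S(1) in blast)+
  moreover have "z a \<in> J (g a)" if "a < length ps" for a
    using mem[OF that] S genideal_self by blast
  moreover have "{z a | a. a < length ps \<and> g a = j} = S j" if j: "j \<in> {1..s}" for j
  proof
    show "{z a | a. a < length ps \<and> g a = j} \<subseteq> S j" using mem by auto
    show "S j \<subseteq> {z a | a. a < length ps \<and> g a = j}"
    proof
      fix x assume "x \<in> S j"
      then have "(j, x) \<in> set ps" using ps j by auto
      then obtain a where "a < length ps" "ps ! a = (j, x)" by (auto simp: in_set_conv_nth)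
      then show "x \<in> {z a | a. a < length ps \<and> g a = j}" by (auto simp: z_def g_def intro!: exI[of _ a])
    qed
  qed
  ultimately show ?thesis using S(3) by (intro exI[of _ "length ps"] exI[of _ z] exI[of _ g]) auto
qed

text \<open>The families \<open>J\<^bsup>u\<^esup>M\<close> and \<open>J\<^bsup>u+e\<^sub>j\<^esup>M\<close> satisfy the hypotheses of \<open>hilbert_polynomial\<close>
  with all generators allowed to act nontrivially.\<close>

theorem JM_colength_eventually_poly: "eventually_poly s JM_colength"
proof -
  obtain m z g where mg: "graded_generators R M s m z g" and zJ: "\<And>a. a < m \<Longrightarrow> z a \<in> J (g a)"
    and Jz: "\<And>j. j \<in> {1..s} \<Longrightarrow> J j = Idl {z a | a. a < m \<and> g a = j}"
    using exists_generators by blast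
  interpret mg: graded_generators R M s m z g by (rule mg)
  have VW: "JM u \<subseteq> mg.mspan (mg.exponents_of u)" if "u \<in> vecs s" for u
    using that
  proof (induction rule: vecs_induct)
    case zero
    have "(\<lambda>_. 0) \<in> mg.exponents_of (\<lambda>_. 0)" by (auto simp: mg.exponents_of_def exponents_def mg.multidegree_def)
    from mg.mspan.add[OF this _ mg.mspan.zero] have "x \<in> mg.mspan (mg.exponents_of (\<lambda>_. 0))" if "x \<in> carrier M" for x
      using that by (fastforce simp: mg.zmon_zero)
    then show ?case using JM_carrier by blast
  next
    case (step j u)
    let ?W = "mg.mspan (mg.exponents_of u)" and ?W' = "mg.mspan (mg.exponents_of (incr j u))"
    note sW' = mg.subm_mspan[of "mg.exponents_of (incr j u)"]
    \<comment> \<open>An ideal that contains the generators of \<open>J j\<close> contains \<open>J j\<close>.\<close>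
    define I where "I = {r \<in> carrier R. \<forall>w\<in>?W. r \<odot>\<^sub>M w \<in> ?W'}"
    have I: "ideal I R"
    proof (rule idealI)
      show "subgroup I (add_monoid R)"
      proof (rule R.add.subgroupI)
        show "I \<noteq> {}" using mg.mspan_carr subm_zero[OF sW'] by (auto simp: I_def intro!: exI[of _ \<zero>])
        show "\<ominus> a \<in> I" if "a \<in> I" for a
          using that mg.mspan_carr subm_neg[OF sW'] by (auto simp: I_def smult_l_minus)
        show "a \<oplus> b \<in> I" if "a \<in> I" "b \<in> I" for a b
          using that mg.mspan_carr subm_add[OF sW'] by (auto simp: I_def smult_l_distr)
      qed (auto simp: I_def)
      fix a x assume a: "a \<in> I" and x: "x \<in> carrier R"
      then show "x \<otimes> a \<in> I" using mg.mspan_carr subm_smult[OF sW'] by (auto simp: I_def smult_assoc1)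
      then show "a \<otimes> x \<in> I" using a x by (auto simp: I_def R.m_comm)
    qed (rule R.ring_axioms)
    have "z a \<in> I" if a: "a < m" "g a = j" for a
    proof -
      have "incr a ` mg.exponents_of u \<subseteq> mg.exponents_of (incr j u)" using a by (auto simp: mg.exponents_of_def mg.multidegree_incr mg.incr_exponents)
      from mg.mspan_mono[OF this] show ?thesis
        using mg.mspan_shift[OF _ a(1)] mg.z_closed[OF a(1)] by (auto simp: I_def)
    qed
    then have "J j \<subseteq> I" unfolding Jz[OF step(1)] by (intro R.genideal_minimal I) auto
    then show ?case
      using step(3) by (intro JM_step_least[OF step(1) sW']) (auto simp: I_def)
  qed
  have JM_stable: "mg.stable JM"
    unfolding mg.stable_def using JM_subm JM_step zJ mg.g_range by blast
  show ?thesis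
  proof (rule eventually_poly_of_differences)
    fix j assume j: "j \<in> {1..s}"
    have B: "mg.stable (\<lambda>u. JM (incr j u))"
      unfolding mg.stable_def
    proof (intro conjI allI ballI impI JM_subm)
      fix u a x assume a: "a < m" and x: "x \<in> JM (incr j u)"
      show "z a \<odot>\<^sub>M x \<in> JM (incr j (incr (g a) u))"
        unfolding mg.incr_comm[of j] by (rule JM_step[OF mg.g_range[OF a] zJ[OF a] x])
    qed
    have "eventually_poly s (\<lambda>u. rlen (JM (incr j u)) (JM u))"
    proof (rule mg.hilbert_polynomial[OF noeth fg, of "{..<m}"])
      show "mg.stable JM" "mg.stable (\<lambda>u. JM (incr j u))" by (rule JM_stable, rule B)
      show "JM (incr j u) \<subseteq> JM u" for u by (rule JM_incr_subset[OF j])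
      show "JM u \<subseteq> mg.mspan (mg.exponents_of u)" if "u \<in> vecs s" for u by (rule VW[OF that])
      show "len (JM (incr j u)) (JM u) \<noteq> \<infinity>" for u
        using len_mono[OF order_refl JM_carrier, of "JM (incr j u)" u] JM_finite[of "incr j u"]
        by (metis infinity_ileE not_infinity_eq)
    qed auto
    then show "eventually_poly s (\<lambda>u. JM_colength (u(j := Suc (u j))) - JM_colength u)"
      unfolding incr_def[symmetric] JM_colength_incr[OF j] .
  qed
qed

text \<open>On a ray \<open>tu\<close> the polynomial is \<open>O(t\<^bsup>D\<^esup>)\<close>, so its homogeneous parts of degree above \<open>D\<close>
  vanish at all \<open>u\<close> with positive coordinates, hence identically.\<close>

lemma JM_colength_polynomial:
  "\<exists>c u0. \<forall>u. (\<forall>i\<in>{1..s}. u0 \<le> u i) \<longrightarrow> JM_colength u = (\<Sum>k<Suc D. hom_part s c k u)"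
proof -
  obtain p u0 where p: "polyfun s p" "\<forall>u\<in>vecs s. (\<forall>j\<in>{1..s}. u0 \<le> u j) \<longrightarrow> JM_colength u = p u"
    using JM_colength_eventually_poly unfolding eventually_poly_def by blast
  obtain K c where K: "\<forall>L\<ge>K. \<forall>u. p u = (\<Sum>k<L. hom_part s c k u)"
    using polyfun_normal_form[OF p(1)] by blast
  define L where "L = max K (Suc D)"
  have JM_colength: "JM_colength u = (\<Sum>k<L. hom_part s c k u)" if "\<forall>i\<in>{1..s}. u0 \<le> u i" for u
  proof -
    have "JM_colength u = JM_colength (clip u)" unfolding JM_colength_def J_pow_clip ..
    also have "\<dots> = p (clip u)" using p(2) clip_vecs[of u] that by (simp add: clip_def)
    also have "\<dots> = (\<Sum>k<L. hom_part s c k (clip u))" using K by (simp add: L_def)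
    also have "\<dots> = (\<Sum>k<L. hom_part s c k u)"
      by (intro sum.cong hom_part_cong) (auto simp: clip_def)
    finally show ?thesis .
  qed
  obtain C where C: "\<And>u. len (JM u) (carrier M) \<le> enat (C * ((\<Sum>i=1..s. u i) + 1) ^ D)"
    using JM_growth by blast
  have GC: "0 \<le> JM_colength u \<and> JM_colength u \<le> real (C * ((\<Sum>i=1..s. u i) + 1) ^ D)" for u
  proof -
    have "the_enat (len (JM u) (carrier M)) \<le> C * ((\<Sum>i=1..s. u i) + 1) ^ D"
      using C[of u] by (cases "len (JM u) (carrier M)") auto
    then show ?thesis unfolding JM_colength_eq rlen_def by (metis of_nat_0_le_iff of_nat_le_iff)
  qed
  have vanish: "hom_part s c k u = 0" if u: "\<And>i. 1 \<le> u i" and k: "Suc D \<le> k" "k < L" for k u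
  proof (rule poly_tail_zero[where a = "\<lambda>k. hom_part s c k u", OF _ k])
    define S where "S = (\<Sum>i=1..s. u i)"
    define f where "f t = (\<Sum>k<L. hom_part s c k u * real t ^ k) / real t ^ Suc D" for t
    have ev: "\<forall>\<^sub>F t in sequentially. 0 \<le> f t \<and> f t \<le> real (C * (S + 1) ^ D) * inverse (real t)"
      using eventually_ge_at_top[of "Suc u0"]
    proof eventually_elim
      case (elim t)
      then have t: "t > 0" by simp
      have "u0 \<le> t * u i" for i using u[of i] elim by (metis Suc_leD le_trans mult.right_neutral mult_le_mono2)
      then have "JM_colength (\<lambda>i. t * u i) = (\<Sum>k<L. hom_part s c k u * real t ^ k)"
        unfolding hom_part_scale[symmetric] by (intro JM_colength) blast
      moreover have "(\<Sum>i=1..s. t * u i) + 1 \<le> (S + 1) * t"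
        unfolding S_def sum_distrib_left[symmetric] using t by (simp add: algebra_simps)
      then have "C * ((\<Sum>i=1..s. t * u i) + 1) ^ D \<le> C * ((S + 1) * t) ^ D"
        by (intro mult_left_mono power_mono) auto
      ultimately have "0 \<le> (\<Sum>k<L. hom_part s c k u * real t ^ k) \<and>
          (\<Sum>k<L. hom_part s c k u * real t ^ k) \<le> real (C * ((S + 1) * t) ^ D)"
        using GC[of "\<lambda>i. t * u i"] by (metis of_nat_le_iff order_trans)
      then have "0 \<le> f t \<and> f t \<le> real (C * ((S + 1) * t) ^ D) / real t ^ Suc D"
        unfolding f_def by (auto intro!: divide_right_mono)
      also have "real (C * ((S + 1) * t) ^ D) / real t ^ Suc D = real (C * (S + 1) ^ D) * inverse (real t)"
        using t by (simp only: of_nat_mult of_nat_power power_mult_distrib) (simp add: field_simps)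
      finally show ?case .
    qed
    have "(\<lambda>t. real (C * (S + 1) ^ D) * inverse (real t)) \<longlonglongrightarrow> real (C * (S + 1) ^ D) * 0"
      by (intro tendsto_intros lim_inverse_n)
    then have "f \<longlonglongrightarrow> 0"
      by (intro tendsto_sandwich[of "\<lambda>_. 0" f sequentially "\<lambda>t. real (C * (S + 1) ^ D) * inverse (real t)" 0])
        (use ev in \<open>auto elim: eventually_mono\<close>)
    then show "(\<lambda>t. (\<Sum>k<L. hom_part s c k u * real t ^ k) / real t ^ Suc D) \<longlonglongrightarrow> 0"
      unfolding f_def .
  qed
  have "hom_part s c k u = 0" if "Suc D \<le> k" "k < L" for k u
    unfolding hom_part_def using hom_part_zero_coeffs[OF vanish[OF _ that]] by simp
  then have "(\<Sum>k<L. hom_part s c k u) = (\<Sum>k<Suc D. hom_part s c k u)" for u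
    by (intro sum.mono_neutral_right) (auto simp: L_def)
  then show ?thesis using JM_colength by metis
qed

text \<open>The coefficients of the leading form that belongs to the mixed multiplicities \<open>e\<close>.\<close>

definition norm_coeffs :: "((nat \<Rightarrow> nat) \<Rightarrow> real) \<Rightarrow> (nat \<Rightarrow> nat) \<Rightarrow> real" where
  "norm_coeffs e d = e d / (\<Prod>i=1..s. fact (d i))"

lemma system_iff:
  "mixed_multiplicity_system R M s J e \<longleftrightarrow> (\<exists>c u0. \<forall>u. (\<forall>i\<in>{1..s}. u0 \<le> u i) \<longrightarrow>
    JM_colength u = hom_part s (norm_coeffs e) D u + (\<Sum>k<D. hom_part s c k u))"
  unfolding mixed_multiplicity_system_def dim JM_colength_def J_pow_def hom_part_def norm_coeffs_def by (simp add: Let_def)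

lemma system_exists: "\<exists>e. mixed_multiplicity_system R M s J e"
proof -
  obtain c u0 where c: "\<And>u. (\<forall>i\<in>{1..s}. u0 \<le> u i) \<Longrightarrow> JM_colength u = (\<Sum>k<Suc D. hom_part s c k u)"
    using JM_colength_polynomial by blast
  \<comment> \<open>Undoes the factorials in the definition of a system of mixed multiplicities.\<close>
  define e where "e d = c d * (\<Prod>i=1..s. fact (d i))" for d :: "nat \<Rightarrow> nat"
  have "norm_coeffs e = c" by (auto simp: norm_coeffs_def e_def prod_zero_iff)
  then have "mixed_multiplicity_system R M s J e"
    unfolding system_iff using c by (intro exI[of _ c] exI[of _ u0]) simp
  then show ?thesis by blast
qed

lemma system_ray_limit:
  assumes "mixed_multiplicity_system R M s J e"
  shows "\<exists>u0. \<forall>v\<ge>u0. \<forall>n. (\<lambda>k. JM_colength (\<lambda>i. k * n i + v) / real k ^ D) \<longlonglongrightarrow> hom_part s (norm_coeffs e) D n"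
proof -
  obtain c u0 where c: "\<And>u. (\<forall>i\<in>{1..s}. u0 \<le> u i) \<Longrightarrow>
      JM_colength u = hom_part s (norm_coeffs e) D u + (\<Sum>k<D. hom_part s c k u)"
    using assms unfolding system_iff by blast
  have "(\<lambda>k. JM_colength (\<lambda>i. k * n i + v) / real k ^ D) \<longlonglongrightarrow> hom_part s (norm_coeffs e) D n" if v: "v \<ge> u0" for v n
  proof -
    have "(\<lambda>k. hom_part s (norm_coeffs e) D (\<lambda>i. k * n i + v) / real k ^ D +
        (\<Sum>j<D. hom_part s c j (\<lambda>i. k * n i + v) / real k ^ D)) \<longlonglongrightarrow>
        (if D = D then hom_part s (norm_coeffs e) D n else 0) + (\<Sum>j<D. if j = D then hom_part s c D n else 0)"
      by (intro tendsto_add tendsto_sum hom_part_ray_limit) auto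
    then show ?thesis using v by (simp add: c add_divide_distrib sum_divide_distrib trans_le_add2)
  qed
  then show ?thesis by blast
qed

text \<open>The values of the leading form are limits along rays, and they determine its coefficients.\<close>

lemma system_unique:
  assumes e: "mixed_multiplicity_system R M s J e" and e': "mixed_multiplicity_system R M s J e'"
    and d: "d \<in> multi_indices s D"
  shows "e d = e' d"
proof -
  obtain u0 where u0: "\<And>v n. v \<ge> u0 \<Longrightarrow> (\<lambda>k. JM_colength (\<lambda>i. k * n i + v) / real k ^ D) \<longlonglongrightarrow> hom_part s (norm_coeffs e) D n"
    using system_ray_limit[OF e] by blast
  obtain u1 where u1: "\<And>v n. v \<ge> u1 \<Longrightarrow> (\<lambda>k. JM_colength (\<lambda>i. k * n i + v) / real k ^ D) \<longlonglongrightarrow> hom_part s (norm_coeffs e') D n"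
    using system_ray_limit[OF e'] by blast
  have "hom_part s (norm_coeffs e) D n = hom_part s (norm_coeffs e') D n" for n
    using LIMSEQ_unique[OF u0[of "max u0 u1" n] u1[of "max u0 u1" n]] by simp
  then have "hom_part s (\<lambda>d. norm_coeffs e d - norm_coeffs e' d) D n = 0" for n
    by (simp add: hom_part_def left_diff_distrib sum_subtractf)
  from hom_part_zero_coeffs[OF this d] show ?thesis
    by (simp add: norm_coeffs_def prod_zero_iff)
qed

lemma mixed_multiplicity_eq:
  assumes e: "mixed_multiplicity_system R M s J e" and d: "d \<in> multi_indices s D"
  shows "mixed_multiplicity R M s J d = e d"
  unfolding mixed_multiplicity_def
proof (rule the_equality)
  show "\<exists>e'. mixed_multiplicity_system R M s J e' \<and> e' d = e d" using e by blast
  fix x assume "\<exists>e'. mixed_multiplicity_system R M s J e' \<and> e' d = x"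
  then show "x = e d" using system_unique[OF _ e d] by blast
qed

text \<open>The sandwich between \<open>J\<^bsup>kn\<^esup>\<close>, \<open>J\<^bsup>kn+u0\<^esup>\<close> and \<open>J\<^bsup>(k+N)n\<^esup>\<close> carries the limit from
  the ray \<open>kn + u0\<close>, where the polynomial is available, to the ray \<open>kn\<close>. If \<open>n = 0\<close>, both sides are \<open>0\<close>
  since \<open>D \<ge> 1\<close>.\<close>

lemma colength_power_limit:
  assumes e: "mixed_multiplicity_system R M s J e" and D: "D \<ge> 1"
  shows "(\<lambda>k. JM_colength (\<lambda>i. k * n i) / real k ^ D) \<longlonglongrightarrow> hom_part s (norm_coeffs e) D n"
proof (cases "\<forall>i\<in>{1..s}. n i = 0")
  case True
  have "monval s d n = 0" if d: "d \<in> multi_indices s D" for d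
  proof -
    have "(\<Sum>i=1..s. d i) \<noteq> 0" using d D by (auto simp: multi_indices_def)
    then obtain i where "i \<in> {1..s}" "d i \<noteq> 0" by (metis sum.neutral)
    then show ?thesis using True by (intro prod_zero) auto
  qed
  then have "hom_part s (norm_coeffs e) D n = 0"
    unfolding hom_part_def by (intro sum.neutral ballI) (simp only: mult_zero_right)
  moreover have "JM_colength (\<lambda>i. k * n i) = 0" for k
  proof -
    have "J_pow (\<lambda>i. k * n i) = carrier R"
      unfolding J_pow_def using True by (intro R.ideal_power_prod_zero) simp
    then show ?thesis unfolding JM_colength_eq JM_def by (simp add: ideal_smult_one rlen_def zero_enat_def)
  qed
  ultimately show ?thesis by simp
next
  case False
  then obtain i where i: "i \<in> {1..s}" "n i \<noteq> 0" by blast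
  obtain u0 where u0: "\<And>v n. v \<ge> u0 \<Longrightarrow> (\<lambda>k. JM_colength (\<lambda>i. k * n i + v) / real k ^ D) \<longlonglongrightarrow> hom_part s (norm_coeffs e) D n"
    using system_ray_limit[OF e] by blast
  define q where "q k = JM_colength (\<lambda>i. k * n i + u0)" for k
  define h where "h k = JM_colength (\<lambda>i. k * n i)" for k
  define T where "T = hom_part s (norm_coeffs e) D n"
  have q: "(\<lambda>k. q k / real k ^ D) \<longlonglongrightarrow> T" unfolding q_def T_def by (rule u0) simp
  have hq: "h k \<le> q k" for k
    unfolding h_def q_def by (intro JM_colength_antimono J_pow_antimono) simp
  obtain N where N: "R.ideal_pow \<mm> N \<subseteq> J_pow (\<lambda>_. u0)"
    using m_power_subset_J_pow clip_vecs[of "\<lambda>_. u0"] J_pow_clip by metis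
  have "J_pow n \<subseteq> \<mm>"
  proof -
    have "incr i (n(i := n i - 1)) = n" using i by (auto simp: incr_def)
    then have "J_pow n = ideal_prod R (J_pow (n(i := n i - 1))) (J i)" using J_pow_incr[OF i(1), of "n(i := n i - 1)"] by simp
    then have "J_pow n \<subseteq> J i" using R.ideal_prod_inter[OF J_pow_ideal J_ideal[OF i(1)]] by blast
    also have "J i \<subseteq> radical R (J i)"
    proof
      fix x assume x: "x \<in> J i"
      then have xc: "x \<in> carrier R" using ideal.Icarr[OF J_ideal[OF i(1)]] by blast
      then have "x [^] (1::nat) \<in> J i" using x by simp
      then show "x \<in> radical R (J i)" using xc unfolding radical_def by blast
    qed
    also have "radical R (J i) = \<mm>" using prim[OF i(1)] by (simp add: primary_to_def)
    finally show ?thesis .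
  qed
  then have "R.ideal_pow (J_pow n) N \<subseteq> J_pow (\<lambda>_. u0)" using R.ideal_pow_mono N by blast
  then have N': "J_pow (\<lambda>i. N * n i) \<subseteq> J_pow (\<lambda>_. u0)" by (simp add: ideal_pow_J_pow)
  have qh: "q k \<le> h (k + N)" for k
  proof -
    have "J_pow (\<lambda>i. (k + N) * n i) = ideal_prod R (J_pow (\<lambda>i. k * n i)) (J_pow (\<lambda>i. N * n i))"
      unfolding J_pow_add[symmetric] by (simp add: algebra_simps)
    also have "\<dots> \<subseteq> ideal_prod R (J_pow (\<lambda>i. k * n i)) (J_pow (\<lambda>_. u0))"
      using N' by (intro R.ideal_prod_mono) auto
    also have "\<dots> = J_pow (\<lambda>i. k * n i + u0)" by (rule J_pow_add[symmetric])
    finally show ?thesis unfolding q_def h_def by (rule JM_colength_antimono)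
  qed
  have "(\<lambda>k. h (k + N) / real (k + N) ^ D) \<longlonglongrightarrow> T"
  proof (rule tendsto_sandwich[of "\<lambda>k. q k / real (k + N) ^ D" _ _ "\<lambda>k. q (k + N) / real (k + N) ^ D"])
    show "(\<lambda>k. q (k + N) / real (k + N) ^ D) \<longlonglongrightarrow> T" using q by (rule LIMSEQ_ignore_initial_segment)
    show "\<forall>\<^sub>F k in sequentially. h (k + N) / real (k + N) ^ D \<le> q (k + N) / real (k + N) ^ D"
      using hq by (intro always_eventually allI divide_right_mono) auto
    show "\<forall>\<^sub>F k in sequentially. q k / real (k + N) ^ D \<le> h (k + N) / real (k + N) ^ D"
      using qh by (intro always_eventually allI divide_right_mono) auto
    have "(\<lambda>k. q k / real k ^ D / (real (k * 1 + N) / real k) ^ D) \<longlonglongrightarrow> T / real 1 ^ D"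
      by (intro tendsto_intros q ratio_limit) simp
    then have "(\<lambda>k. q k / real k ^ D / (real (k * 1 + N) / real k) ^ D) \<longlonglongrightarrow> T" by simp
    then show "(\<lambda>k. q k / real (k + N) ^ D) \<longlonglongrightarrow> T"
    proof (rule Lim_transform_eventually)
      show "\<forall>\<^sub>F k in sequentially. q k / real k ^ D / (real (k * 1 + N) / real k) ^ D = q k / real (k + N) ^ D"
        using eventually_gt_at_top[of 0] by eventually_elim (simp add: power_divide)
    qed
  qed
  then show ?thesis unfolding h_def T_def by (rule LIMSEQ_offset)
qed

theorem hilbert_samuel_expansion:
  assumes D: "D \<ge> 1"
  shows "hilbert_samuel_mult R M (ideal_power_prod R s J n) =
    (\<Sum>d\<in>multi_indices s D. fact D / (\<Prod>i=1..s. fact (d i)) *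
       mixed_multiplicity R M s J d * (\<Prod>i=1..s. real (n i) ^ d i))"
proof -
  obtain e where e: "mixed_multiplicity_system R M s J e" using system_exists by blast
  have "(\<lambda>k. fact D * (JM_colength (\<lambda>i. k * n i) / real k ^ D)) \<longlonglongrightarrow> fact D * hom_part s (norm_coeffs e) D n"
    by (intro tendsto_mult tendsto_const colength_power_limit[OF e D])
  then have "hilbert_samuel_mult R M (J_pow n) = fact D * hom_part s (norm_coeffs e) D n"
    unfolding hilbert_samuel_mult_def dim ideal_pow_J_pow JM_colength_def by (simp add: limI)
  also have "\<dots> = (\<Sum>d\<in>multi_indices s D. fact D / (\<Prod>i=1..s. fact (d i)) *
       mixed_multiplicity R M s J d * (\<Prod>i=1..s. real (n i) ^ d i))"
    unfolding hom_part_def sum_distrib_left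
    by (intro sum.cong) (simp_all add: norm_coeffs_def mixed_multiplicity_eq[OF e])
  finally show ?thesis by (simp add: J_pow_def)
qed

end

theorem corollary5p2:
  fixes R :: "('a, 'r) ring_scheme" and M :: "('a, 'b, 'm) module_scheme"
    and \<mm> :: "'a set" and D s :: nat and J :: "nat \<Rightarrow> 'a set" and n :: "nat \<Rightarrow> nat"
  assumes "noetherian_ring R" and "local_ring R \<mm>"
    and "Module.module R M" and "fin_gen_module R M" and "carrier M \<noteq> {\<zero>\<^bsub>M\<^esub>}"
    and "module_dim R M = enat D" and "D \<ge> 1"
    and "\<And>i. i \<in> {1..s} \<Longrightarrow> primary_to R \<mm> (J i)"
  shows "hilbert_samuel_mult R M (ideal_power_prod R s J n) =
    (\<Sum>d\<in>multi_indices s D. fact D / (\<Prod>i=1..s. fact (d i)) *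
       mixed_multiplicity R M s J d * (\<Prod>i=1..s. real (n i) ^ d i))"
proof -
  interpret primary_family R M \<mm> D s J
    by (intro primary_family.intro primary_family_axioms.intro assms)
  show ?thesis by (rule hilbert_samuel_expansion[OF assms(7)])
qed

end
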